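(* Let $m,p,l\in\mathbb{N}_0$, with $e_j,a_k\in\mathbb{R}$, $\eta_j,\gamma_k,\alpha_k,b_i>0$, $\beta_k\in(0,1)$ such that $e_j+\eta_j>0$, $a_k+\alpha_k>0$, for $i=1,\dots,p$, $j=1,\dots,p+m$ and $k=1,\dots,l$. Put $c_k:=a_k-\alpha_k\gamma_k+\alpha_k$. Then the following functions $\varrho_\iota$, $\iota=0,\dots,7$, belong to the class FHdam (Fox-$H$ densities with all moments finite). (C0) For $m=p=0$: $\varrho_0(x):=\frac1{K_0}H^{0,0}_{0,0}[x]=\delta_1(x)$, $x>0$, where $K_0:=1$. (C1) For $m>0$: $\varrho_1(x):=\frac1{K_1}H^{m,0}_{0,m}\left[x\,\Big|{-\atop(e_i,\eta_i)_{1,m}}\right]$, $x>0$, where $K_1:=\prod_{i=1}^m\Gamma(e_i+\eta_i)$. (C2) For $p>0$: $\varrho_2(x):=\frac1{K_2}H^{p,0}_{p,p}\left[x\,\Big|{(e_i+b_i,\eta_i)_{1,p}\atop(e_i,\eta_i)_{1,p}}\right]$, $x\in(0,1)$, where $K_2:=\prod_{i=1}^p\frac{\Gamma(e_i+\eta_i)}{\Gamma(e_i+b_i+\eta_i)}$. (C3) For $m,p>0$: $\varrho_3(x):=\frac1{K_3}H^{m+p,0}_{p,m+p}\left[x\,\Big|{(e_i+b_i,\eta_i)_{1,p}\atop(e_i,\eta_i)_{1,p+m}}\right]$, $x>0$, where $K_3:=\prod_{i=1}^p\frac{\Gamma(e_i+\eta_i)}{\Gamma(e_i+b_i+\eta_i)}\prod_{i=p+1}^{p+m}\Gamma(e_i+\eta_i)$.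 (C4) For $l>0$: $\varrho_4(x):=\frac1{K_4}H^{l,0}_{l,l}\left[x\,\Big|{(1-\beta_k+\beta_kc_k,\alpha_k\beta_k\gamma_k)_{1,l}\atop(c_k,\alpha_k\gamma_k)_{1,l}}\right]$, $x>0$, where $K_4:=\prod_{k=1}^l\frac{\Gamma(a_k+\alpha_k)}{\Gamma(1-\beta_k+\beta_ka_k+\beta_k\alpha_k)}$. (C5) For $m,l>0$: $\varrho_5(x):=\frac1{K_5}H^{m+l,0}_{l,m+l}\left[x\,\Big|{(1-\beta_k+\beta_kc_k,\alpha_k\beta_k\gamma_k)_{1,l}\atop(e_i,\eta_i)_{1,m},(c_k,\alpha_k\gamma_k)_{1,l}}\right]$, $x>0$, where $K_5:=K_1K_4$. (C6) For $p,l>0$: $\varrho_6(x):=\frac1{K_6}H^{p+l,0}_{p+l,p+l}\left[x\,\Big|{(e_i+b_i,\eta_i)_{1,p},(1-\beta_k+\beta_kc_k,\alpha_k\beta_k\gamma_k)_{1,l}\atop(e_i,\eta_i)_{1,p},(c_k,\alpha_k\gamma_k)_{1,l}}\right]$, $x>0$, where $K_6:=K_2K_4$. (C7) For $m,p,l>0$: $\varrho_7(x):=\frac1{K_7}H^{m+p+l,0}_{p+l,m+p+l}\left[x\,\Big|{(e_i+b_i,\eta_i)_{1,p},(1-\beta_k+\beta_kc_k,\alpha_k\beta_k\gamma_k)_{1,l}\atop(e_i,\eta_i)_{1,p+m},(c_k,\alpha_k\gamma_k)_{1,l}}\right]$, $x>0$, where $K_7:=K_3K_4$.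
   Context: Fox-$H$ function: for integers $M,P\ge0$, $A_i,B_j\in\mathbb{R}$ and $\mathsf{a}_i,\mathsf{b}_j>0$, $$H^{M,0}_{P,M}\left[x\,\Big|{(A_i,\mathsf{a}_i)_{1,P}\atop(B_j,\mathsf{b}_j)_{1,M}}\right]=\frac1{2\pi\mathrm{i}}\int_{\mathcal{L}}\frac{\prod_{j=1}^M\Gamma(B_j+s\mathsf{b}_j)}{\prod_{i=1}^P\Gamma(A_i+s\mathsf{a}_i)}x^{-s}\,\mathrm{d}s,$$ with empty products equal to $1$ and a dash denoting an empty parameter list; $\mathcal{L}$ is a contour with all poles $-(B_j+l)/\mathsf{b}_j$, $l\in\mathbb{N}_0$, on its left, either from $\gamma-\mathrm{i}\infty$ to $\gamma+\mathrm{i}\infty$ ($\gamma\in\mathbb{R}$) or a left loop in a horizontal strip from $-\infty+\mathrm{i}\phi_1$ to $-\infty+\mathrm{i}\phi_2$, $\phi_1<\phi_2$, chosen so that the integral converges (e.g. the left loop for $x\in(0,1)$ in (C2)). FHdam class: Fox-$H$ densities with all moments finite, i.e. probability densities on $(0,\infty)$ that are (a constant multiple $1/K$ of) Fox-$H$ functions of the form $H^{M,0}_{P,M}$, extended by zero outside the indicated domain, and have finite moments of all orders. In case (C0), $H^{0,0}_{0,0}$ is understood as a distribution, $H^{0,0}_{0,0}(x)=\frac1{2\pi}\int_{\mathbb{R}}x^{-\mathrm{i}t}\,\mathrm{d}t$, and $\delta_1$ is the Dirac distribution at $1$ (the law of a random variable a.s. equal to $1$), which the paper counts as a degenerate member of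 the class. *)

theory Defs
  imports "HOL-Probability.Probability" "HOL-Complex_Analysis.Complex_Analysis"
begin

text \<open>
  A parameter list \<open>(A\<^sub>i, a\<^sub>i)\<close>, \<open>i = k, \<dots>, n\<close>, is a list of pairs of reals. Below, \<open>As\<close> is always
  the upper list (of length \<open>P\<close>) and \<open>Bs\<close> the lower list (of length \<open>M\<close>).
\<close>

definition fox_params :: "(nat \<Rightarrow> real) \<Rightarrow> (nat \<Rightarrow> real) \<Rightarrow> nat \<Rightarrow> nat \<Rightarrow> (real \<times> real) list" where
  "fox_params A a k n = map (\<lambda>i. (A i, a i)) [k..<Suc n]"

text \<open>
  In the library \<open>Gamma\<close> is \<open>0\<close> at its poles and \<open>x / 0 = 0\<close>. The zeros of the reciprocal Gamma
  functions in the denominator are therefore represented correctly, and the poles of the numerator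
  are never evaluated, since the contours below avoid them.
\<close>

definition fox_kernel :: "(real \<times> real) list \<Rightarrow> (real \<times> real) list \<Rightarrow> complex \<Rightarrow> complex" where
  "fox_kernel As Bs s =
     (\<Prod>(B, b)\<leftarrow>Bs. Gamma (of_real B + s * of_real b)) /
     (\<Prod>(A, a)\<leftarrow>As. Gamma (of_real A + s * of_real a))"

definition fox_poles :: "(real \<times> real) list \<Rightarrow> real set" where
  "fox_poles Bs = {- (B + real l) / b | B b l. (B, b) \<in> set Bs}"

text \<open>
  A contour is given by its truncations, indexed by two independent cut-off parameters, one for
  each end. All poles are real and bounded above, so the contours
  can be taken straight: vertical lines to the right of all poles, and left loops formed by two
  horizontal rays, below and above the real axis, and a vertical segment to the right of all poles.
\<close>

definition vertical_line :: "real \<Rightarrow> real \<Rightarrow> real \<Rightarrow> real \<Rightarrow> complex" where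
  "vertical_line \<gamma> R T = linepath (Complex \<gamma> (- R)) (Complex \<gamma> T)"

definition left_loop :: "real \<Rightarrow> real \<Rightarrow> real \<Rightarrow> real \<Rightarrow> real \<Rightarrow> real \<Rightarrow> complex" where
  "left_loop \<gamma> \<phi>1 \<phi>2 R T =
     linepath (Complex (- R) \<phi>1) (Complex \<gamma> \<phi>1) +++
     linepath (Complex \<gamma> \<phi>1) (Complex \<gamma> \<phi>2) +++
     linepath (Complex \<gamma> \<phi>2) (Complex (- T) \<phi>2)"

definition fox_contours :: "(real \<times> real) list \<Rightarrow> (real \<Rightarrow> real \<Rightarrow> real \<Rightarrow> complex) set" where
  "fox_contours Bs =
     {vertical_line \<gamma> | \<gamma>. \<forall>z\<in>fox_poles Bs. z < \<gamma>} \<union>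
     {left_loop \<gamma> \<phi>1 \<phi>2 | \<gamma> \<phi>1 \<phi>2. \<phi>1 < 0 \<and> 0 < \<phi>2 \<and> (\<forall>z\<in>fox_poles Bs. z < \<gamma>)}"

text \<open>
  \<open>has_fox_H As Bs x h\<close>: along some admissible contour the (improper) integral defining the
  Fox-H function at \<open>x\<close> converges, with value \<open>h\<close>.
\<close>

definition has_fox_H :: "(real \<times> real) list \<Rightarrow> (real \<times> real) list \<Rightarrow> real \<Rightarrow> complex \<Rightarrow> bool" where
  "has_fox_H As Bs x h \<longleftrightarrow>
     (\<exists>L\<in>fox_contours Bs.
        ((\<lambda>(R, T). 1 / (2 * of_real pi * \<i>) *
            contour_integral (L R T) (\<lambda>s. fox_kernel As Bs s * of_real x powr (- s)))
          \<longlongrightarrow> h) (at_top \<times>\<^sub>F at_top))"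

text \<open>The common value along all admissible contours for which the integral converges.\<close>

definition fox_H :: "(real \<times> real) list \<Rightarrow> (real \<times> real) list \<Rightarrow> real \<Rightarrow> complex" where
  "fox_H As Bs x = (THE h. has_fox_H As Bs x h)"

text \<open>
  \<open>f\<close> is \<open>1 / K\<close> times the Fox-H function on \<open>D\<close>, extended by zero. This includes that the
  Fox-H function is well defined on \<open>D\<close> (some admissible contour works, and the value does not
  depend on the choice) and that it is real valued there.
\<close>

definition is_scaled_fox_H ::
    "real \<Rightarrow> real set \<Rightarrow> (real \<times> real) list \<Rightarrow> (real \<times> real) list \<Rightarrow> (real \<Rightarrow> real) \<Rightarrow> bool" where
  "is_scaled_fox_H K D As Bs f \<longleftrightarrow>
     (\<forall>x\<in>D. (\<exists>!h. has_fox_H As Bs x h) \<and> of_real (f x) = fox_H As Bs x / of_real K) \<and>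
     (\<forall>x. x \<notin> D \<longrightarrow> f x = 0)"

definition scaled_fox_H ::
    "real \<Rightarrow> real set \<Rightarrow> (real \<times> real) list \<Rightarrow> (real \<times> real) list \<Rightarrow> real \<Rightarrow> real" where
  "scaled_fox_H K D As Bs x = (if x \<in> D then Re (fox_H As Bs x) / K else 0)"

text \<open>
  Test functions on \<open>(0, \<infinity>)\<close>, and the distribution \<open>H\<^sup>0\<^sup>0 = 1/(2\<pi>) \<integral> x\<^sup>-\<^sup>i\<^sup>t dt\<close>: as usual for a
  distribution given by an oscillatory integral, the functions \<open>x \<mapsto> x\<^sup>-\<^sup>i\<^sup>t\<close> are paired with
  the test function first and the result is then integrated over \<open>t\<close>.
\<close>

definition test_function :: "(real \<Rightarrow> real) \<Rightarrow> bool" where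
  "test_function \<phi> \<longleftrightarrow>
     (\<forall>n. (deriv ^^ n) \<phi> differentiable_on UNIV) \<and>
     compact (closure {x. \<phi> x \<noteq> 0}) \<and> closure {x. \<phi> x \<noteq> 0} \<subseteq> {0<..}"

definition mellin_pairing :: "(real \<Rightarrow> real) \<Rightarrow> real \<Rightarrow> complex" where
  "mellin_pairing \<phi> t = (LINT x:{0<..}|lborel. of_real (\<phi> x) * of_real x powr (- (\<i> * of_real t)))"

definition fox_H00 :: "(real \<Rightarrow> real) \<Rightarrow> complex" where
  "fox_H00 \<phi> = 1 / (2 * of_real pi) * (LINT t|lborel. mellin_pairing \<phi> t)"

text \<open>The law \<open>\<mu>\<close> equals \<open>1 / K\<close> times \<open>H\<^sup>0\<^sup>0\<close> as a distribution on \<open>(0, \<infinity>)\<close>.\<close>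

definition is_scaled_fox_H00 :: "real \<Rightarrow> real measure \<Rightarrow> bool" where
  "is_scaled_fox_H00 K \<mu> \<longleftrightarrow>
     (\<forall>\<phi>. test_function \<phi> \<longrightarrow>
        integrable lborel (mellin_pairing \<phi>) \<and>
        of_real (LINT x|\<mu>. \<phi> x) = fox_H00 \<phi> / of_real K)"

definition law_with_all_moments :: "real measure \<Rightarrow> bool" where
  "law_with_all_moments \<mu> \<longleftrightarrow>
     prob_space \<mu> \<and> sets \<mu> = sets borel \<and> (AE x in \<mu>. 0 < x) \<and> (\<forall>n::nat. integrable \<mu> (\<lambda>x. x ^ n))"

text \<open>
  The class contains genuine densities and, as degenerate members, densities that only exist as
  distributions; the latter are represented by their laws.
\<close>

datatype gen_density = Density_fun "real \<Rightarrow> real" | Degenerate "real measure"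

definition FHdam :: "gen_density set" where
  "FHdam =
     {Density_fun f | f.
        (\<exists>K D As Bs. K \<noteq> 0 \<and> (D = {0<..} \<or> (\<exists>r>0. D = {0<..<r})) \<and>
           (\<forall>(A, a)\<in>set As. 0 < a) \<and> (\<forall>(B, b)\<in>set Bs. 0 < b) \<and>
           is_scaled_fox_H K D As Bs f) \<and>
        f \<in> borel_measurable borel \<and> (\<forall>x. 0 \<le> f x) \<and>
        law_with_all_moments (density lborel (\<lambda>x. ennreal (f x)))} \<union>
     {Degenerate \<mu> | \<mu>. (\<exists>K. K \<noteq> 0 \<and> is_scaled_fox_H00 K \<mu>) \<and> law_with_all_moments \<mu>}"

end

theory Submission
  imports Defs "HOL-Real_Asymp.Real_Asymp"
begin

text \<open>
  Each kernel \<open>F\<close> of the theorem is a product of factors \<open>\<Gamma>(B + bs)\<close> and \<open>\<Gamma>(B + bs)/\<Gamma>(A + as)\<close>, with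
  \<open>F(1) = K\<close>. The Fox-H function is its inverse Mellin transform \<open>f\<close>, so formally \<open>\<integral> x\<^sup>n f(x) dx = F(n + 1)\<close>, and
  \<open>f/K\<close> has mass one and finite moments. What has to be proved is that the contour integrals converge to
  a common value, that \<open>f\<close> is nonnegative, and that the formal identity holds.

  Convergence. By Stirling's formula (\<open>stirling_bounds\<close>), which is uniform away from the negative half-axis,
  \<open>F(s)\<close> is \<open>exp (\<mu> s Ln s + \<kappa> s + \<nu> Ln s)\<close> up to a bounded factor. Every Gamma factor and every factor with
  the parameter \<open>\<beta>\<close> contributes positively to \<open>\<mu>\<close>, while a beta factor contributes nothing to \<open>\<mu>\<close> and \<open>\<kappa>\<close>
  and \<open>- b\<close> to \<open>\<nu>\<close>. Hence \<open>F(s) x\<^sup>-\<^sup>s\<close> decays in left quarter planes: for all \<open>x > 0\<close> if \<open>\<mu> > 0\<close>, and for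
  \<open>x < 1\<close> if only beta factors occur. Cauchy's theorem on rectangles (\<open>quarter_plane_limit\<close>) then shows that all vertical
  lines and left loops give the same value (\<open>fox_contours_common_value\<close>).

  Positivity. By Gauss's product, \<open>F(1 + it)/F(1)\<close> is a limit of products of characters and of factors
  \<open>p + (1 - p) a/(a + it)\<close> with \<open>0 \<le> p \<le> 1\<close>. Up to a reflection, such a factor is the characteristic
  function of a mixture of a point mass and an exponential law, so multiplication by it preserves nonnegativity of Fourier
  transforms. This covers the Gamma, the beta and the Mittag-Leffler type quotients at once (\<open>posdef_Gamma_ratio\<close>).
  Damping by Gaussians (\<open>posdef\<close>) gives a meaning to these transforms before integrability is
  known.

  Mass and moments. If \<open>F\<close> is integrable along vertical lines, Fourier inversion at \<open>0\<close>
  (\<open>fourier_total_mass\<close>) on the line \<open>Re s = n + 1\<close> gives the \<open>n\<close>-th moment; this settles all kernels with \<open>\<mu> > 0\<close>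
  (\<open>positive_growth_FHdam\<close>). With beta factors alone \<open>F\<close> may fail to be integrable, but \<open>F(s)/s\<close> is. Its inverse
  transform \<open>h(x) = \<integral> f(u)/u du\<close>, taken over \<open>[x, 1]\<close>, is decreasing and has the same mass as \<open>f\<close>, and so transfers
  positivity and mass to \<open>f\<close> (\<open>balanced_growth_FHdam\<close>).

  The degenerate case is Fourier inversion at \<open>0\<close> for a test function in the variable \<open>ln x\<close> (\<open>point_mass_is_fox_H00\<close>).
\<close>

section \<open>Stirling's formula away from the negative half-axis\<close>

definition stirling_exp :: "complex \<Rightarrow> complex" where
  "stirling_exp z = (z - 1/2) * Ln z - z"

text \<open>
  The region in which the principal branch of the logarithm makes Stirling's formula uniform: the
  plane without a neighbourhood of the closed negative half-axis. Besides a right half-plane it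
  contains, for small \<open>d\<close>, the horizontal rays of the left loops.
\<close>

definition stirling_region :: "real \<Rightarrow> complex set" where
  "stirling_region d = {z. d \<le> \<bar>Im z\<bar> \<or> d \<le> Re z}"

lemma stirling_regionD:
  assumes "z \<in> stirling_region d" "d > 0"
  shows "z \<notin> \<real>\<^sub>\<le>\<^sub>0" "z \<noteq> 0" "d \<le> cmod z" "z \<notin> \<int>\<^sub>\<le>\<^sub>0"
proof -
  show 1: "z \<notin> \<real>\<^sub>\<le>\<^sub>0"
    using assms by (auto simp: stirling_region_def complex_nonpos_Reals_iff)
  then show "z \<noteq> 0" "z \<notin> \<int>\<^sub>\<le>\<^sub>0" using nonpos_Ints_subset_nonpos_Reals by auto
  show "d \<le> cmod z"
    using assms abs_Re_le_cmod[of z] abs_Im_le_cmod[of z] by (auto simp: stirling_region_def)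
qed

lemma stirling_region_add:
  assumes "z \<in> stirling_region d" "t \<ge> 0"
  shows "z + of_real t \<in> stirling_region d"
  using assms by (auto simp: stirling_region_def)

lemma stirling_region_norm_ge:
  assumes "z \<in> stirling_region d" "d > 0"
  shows "1 + (Re z)\<^sup>2 \<le> (1 + 1 / d\<^sup>2) * (cmod z)\<^sup>2"
proof -
  have "d\<^sup>2 \<le> (cmod z)\<^sup>2" using stirling_regionD(3)[OF assms] assms by (simp add: power_mono)
  then have "1 \<le> (cmod z)\<^sup>2 / d\<^sup>2" using assms by (simp add: field_simps)
  moreover have "(Re z)\<^sup>2 \<le> (cmod z)\<^sup>2" by (simp add: cmod_power2)
  ultimately show ?thesis by (simp add: algebra_simps)
qed

text \<open>
  The increments of \<open>arctan\<close> telescope, so comparing the error terms of Stirling's formula with them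
  bounds the sum of these terms uniformly in the starting point, however far to the left it lies.
\<close>

lemma arctan_increment_ge:
  fixes x t :: real
  assumes "0 \<le> t" "t \<le> 1"
  shows "1 / (1 + (x + t)\<^sup>2) \<le> 3 * (arctan (x + 1) - arctan x)"
proof -
  have "\<exists>z. x < z \<and> z < x + 1 \<and> arctan (x + 1) - arctan x = (x + 1 - x) * inverse (1 + z\<^sup>2)"
    by (rule MVT2) (auto intro!: DERIV_arctan)
  then obtain z where z: "x < z" "z < x + 1" "arctan (x + 1) - arctan x = inverse (1 + z\<^sup>2)" by auto
  define u where "u = x + t"
  have "\<bar>z - u\<bar> \<le> 1" unfolding u_def using z assms by (auto simp: abs_le_iff)
  then have 1: "(z - u)\<^sup>2 \<le> 1" by (simp add: abs_square_le_1)
  have "z\<^sup>2 \<le> 2 * u\<^sup>2 + 2 * (z - u)\<^sup>2"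
    using zero_le_power2[of "2 * u - z"] by (simp add: power2_eq_square algebra_simps)
  then have "1 + z\<^sup>2 \<le> 3 + 3 * u\<^sup>2"
    using 1 zero_le_power2[of u] by (smt (verit))
  then have "1 + z\<^sup>2 \<le> 3 * (1 + (x + t)\<^sup>2)" by (simp add: u_def)
  moreover have "0 < 1 + z\<^sup>2" "0 < 1 + (x + t)\<^sup>2" by (simp_all add: add_pos_nonneg)
  ultimately show ?thesis unfolding z(3) by (simp add: field_simps)
qed

text \<open>
  Along a unit step the error of Stirling's formula is \<open>\<integral> (1/2 - t)/(z + t) dt\<close> over \<open>[0, 1]\<close>. One
  integration by parts produces \<open>t(1 - t)/(2 (z + t)\<^sup>2)\<close>, which is of order \<open>1/|z|\<^sup>2\<close>; the function \<open>G\<close> in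
  the proof is the corresponding antiderivative.
\<close>

lemma stirling_increment_bound:
  assumes z: "z \<in> stirling_region d" and d: "d > 0"
  shows "cmod (stirling_exp (z + 1) - stirling_exp z - Ln z)
           \<le> 3 * (1 + 1 / d\<^sup>2) * (arctan (Re z + 1) - arctan (Re z))"
proof -
  let ?B = "3 * (1 + 1 / d\<^sup>2) * (arctan (Re z + 1) - arctan (Re z))"
  \<comment> \<open>The last term is what the integration by parts adds; it vanishes at both ends of \<open>[0, 1]\<close>.\<close>
  define G where "G = (\<lambda>t::real. (z + 1/2) * Ln (z + of_real t) - of_real t
                        - of_real (t * (1 - t) / 2) / (z + of_real t))"
  define G' where "G' = (\<lambda>t::real. of_real (t * (1 - t) / 2) / (z + of_real t)\<^sup>2)"
  have reg: "z + of_real t \<in> stirling_region d" if "t \<in> {0..1}" for t :: real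
    using stirling_region_add[OF z] that by simp
  have der: "(G has_vector_derivative G' t) (at t within {0..1})" if t: "t \<in> {0..1}" for t
  proof -
    note r = stirling_regionD[OF reg[OF t] d]
    have gen: "((\<lambda>w. (z + 1/2) * Ln (z + w) - w - (w * (1 - w) / 2) / (z + w)) has_field_derivative
        (u * (1 - u) / 2) / (z + u)\<^sup>2) (at u)" if u: "z + u \<notin> \<real>\<^sub>\<le>\<^sub>0" "z + u \<noteq> 0" for u :: complex
    proof -
      obtain v where v: "z = v - u" by (metis add_diff_cancel)
      show ?thesis using u unfolding v
        by (auto intro!: derivative_eq_intros) (simp add: power2_eq_square divide_simps)
    qed
    have "((\<lambda>w. (z + 1/2) * Ln (z + w) - w - (w * (1 - w) / 2) / (z + w)) has_field_derivative G' t) (at (of_real t))"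
      using gen[OF r(1,2)] by (simp add: G'_def)
    then have "((\<lambda>t::real. (z + 1/2) * Ln (z + of_real t) - of_real t - (of_real t * (1 - of_real t) / 2) / (z + of_real t))
       has_vector_derivative G' t) (at t within {0..1})"
      by (rule has_vector_derivative_real_field)
    then show ?thesis unfolding G_def by simp
  qed
  have bnd: "cmod (G' t) \<le> ?B" if t: "t \<in> {0..1}" for t
  proof -
    note r = stirling_regionD[OF reg[OF t] d]
    have "1 + (Re z + t)\<^sup>2 \<le> (1 + 1 / d\<^sup>2) * (cmod (z + of_real t))\<^sup>2"
      using stirling_region_norm_ge[OF reg[OF t] d] by simp
    moreover have "0 < 1 + (Re z + t)\<^sup>2" "0 < (cmod (z + of_real t))\<^sup>2" 
      using r by (auto simp: add_pos_nonneg)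
    ultimately have "1 / (cmod (z + of_real t))\<^sup>2 \<le> (1 + 1 / d\<^sup>2) * (1 / (1 + (Re z + t)\<^sup>2))"
      by (simp add: field_simps)
    also have "\<dots> \<le> (1 + 1 / d\<^sup>2) * (3 * (arctan (Re z + 1) - arctan (Re z)))"
      using t by (intro mult_left_mono arctan_increment_ge) auto
    finally have 1: "1 / (cmod (z + of_real t))\<^sup>2 \<le> ?B" by (simp only: mult.assoc mult.left_commute)
    have "0 \<le> t * (1 - t)" "t * (1 - t) \<le> 1" using t by (auto intro!: mult_le_one)
    then have "cmod (G' t) \<le> 1 / (cmod (z + of_real t))\<^sup>2"
      unfolding G'_def norm_divide norm_power norm_of_real
      by (intro divide_right_mono) auto
    with 1 show ?thesis by linarith
  qed
  have "norm (G 1 - G 0) \<le> ?B * norm (1 - 0 :: real)"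
  proof (rule differentiable_bound)
    show "convex {0..1::real}" by simp
    show "(G has_derivative (\<lambda>h. h *\<^sub>R G' t)) (at t within {0..1})" if "t \<in> {0..1}" for t
      using der[OF that] by (simp add: has_vector_derivative_def)
    show "onorm (\<lambda>h. h *\<^sub>R G' t) \<le> ?B" if "t \<in> {0..1}" for t
      using bnd[OF that] by (intro onorm_le) (simp add: mult.commute mult_left_mono)
  qed auto
  moreover have "G 1 - G 0 = stirling_exp (z + 1) - stirling_exp z - Ln z"
    by (simp add: G_def stirling_exp_def algebra_simps)
  ultimately show ?thesis by simp
qed

lemma arctan_telescope: "(\<Sum>n<N. arctan (x + real n + 1) - arctan (x + real n)) \<le> pi"
proof -
  have "(\<Sum>n<N. arctan (x + real n + 1) - arctan (x + real n)) = arctan (x + real N) - arctan x"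
    by (induction N) (auto simp: algebra_simps)
  then show ?thesis using arctan_bounded[of x] arctan_bounded[of "x + real N"] by linarith
qed

definition stirling_ratio :: "complex \<Rightarrow> complex" where
  "stirling_ratio z = Gamma z / exp (stirling_exp z)"

lemma stirling_ratio_shift:
  assumes z: "z \<in> stirling_region d" and d: "d > 0"
  shows "stirling_ratio z = stirling_ratio (z + of_nat N) *
     exp (\<Sum>n<N. stirling_exp (z + of_nat n + 1) - stirling_exp (z + of_nat n) - Ln (z + of_nat n))"
proof (induction N)
  case (Suc N)
  let ?w = "z + of_nat N"
  have w: "?w \<in> stirling_region d" using stirling_region_add[OF z, of "real N"] by simp
  note r = stirling_regionD[OF w d]
  have "Gamma (?w + 1) = ?w * Gamma ?w" using r(4) by (intro Gamma_plus1) auto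
  then have "stirling_ratio (?w + 1) * exp (stirling_exp (?w + 1) - stirling_exp ?w - Ln ?w) = stirling_ratio ?w"
    using r(2) by (simp add: stirling_ratio_def exp_diff)
  with Suc show ?case by (simp add: exp_add add_ac)
qed auto

lemma Gamma_shift_asymp:
  fixes z :: complex
  assumes z: "z \<notin> \<int>\<^sub>\<le>\<^sub>0" 
  shows "(\<lambda>n. Gamma (z + of_nat n) / (Gamma (of_nat n) * exp (z * of_real (ln (real n))))) \<longlonglongrightarrow> 1"
proof -
  have G: "Gamma z \<noteq> 0" using z by (simp add: Gamma_eq_zero_iff)
  have "(\<lambda>n. Gamma z / Gamma_series' z n) \<longlonglongrightarrow> Gamma z / Gamma z"
    using G by (intro tendsto_divide tendsto_const Gamma_series'_LIMSEQ) auto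
  then have lim: "(\<lambda>n. Gamma z / Gamma_series' z n) \<longlonglongrightarrow> 1" using G by simp
  show ?thesis
  proof (rule Lim_transform_eventually[OF lim])
    show "\<forall>\<^sub>F n in sequentially. Gamma z / Gamma_series' z n = Gamma (z + of_nat n) / (Gamma (of_nat n) * exp (z * of_real (ln (real n))))"
      using eventually_gt_at_top[of 0]
    proof eventually_elim
      case (elim n)
      then have "Gamma (of_nat n :: complex) = fact (n - 1)"
        using Gamma_fact[of "n-1", where ?'a=complex] by (simp add: of_nat_diff)
      then show ?case
        unfolding Gamma_series'_def pochhammer_Gamma[OF z, of n] using G by simp
    qed
  qed
qed

lemma stirling_exp_shift_asymp:
  "(\<lambda>n. stirling_exp (z + of_nat n) - stirling_exp (of_nat n) - z * of_real (ln (real n))) \<longlonglongrightarrow> 0"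
proof -
  have 0: "(\<lambda>n. z / of_nat n) \<longlonglongrightarrow> 0" by (rule tendsto_divide_0[OF tendsto_const]) (rule tendsto_of_nat)
  have L: "(\<lambda>n. of_nat n * Ln (1 + z / of_nat n)) \<longlonglongrightarrow> z"
  proof (cases "z = 0")
    case False
    have "((\<lambda>h. (Ln (1 + h) - Ln 1) / h) \<longlongrightarrow> 1) (at 0)"
      using has_field_derivative_Ln[of 1] unfolding DERIV_def by (simp add: complex_nonpos_Reals_iff)
    moreover have "filterlim (\<lambda>n. z / of_nat n) (at 0) sequentially"
      unfolding filterlim_at using 0 False by (auto simp: eventually_sequentially intro!: exI[of _ 1])
    ultimately have "(\<lambda>n. (Ln (1 + z / of_nat n) - Ln 1) / (z / of_nat n)) \<longlonglongrightarrow> 1"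
      by (rule filterlim_compose)
    from tendsto_mult[OF tendsto_const[of z] this] show ?thesis using False by (simp add: mult.commute)
  qed simp
  have L0: "(\<lambda>n. (z - 1/2) * Ln (1 + z / of_nat n)) \<longlonglongrightarrow> (z - 1/2) * Ln (1 + 0)"
    by (intro tendsto_intros 0) auto
  have lim: "(\<lambda>n. of_nat n * Ln (1 + z / of_nat n) + (z - 1/2) * Ln (1 + z / of_nat n) - z) \<longlonglongrightarrow> z + (z - 1/2) * Ln (1 + 0) - z"
    by (intro tendsto_intros L L0)
  have ev: "\<forall>\<^sub>F n in sequentially. cmod (z / of_nat n) < 1"
    using tendstoD[OF 0, of 1] by (simp add: dist_norm)
  show ?thesis
  proof (rule Lim_transform_eventually[OF lim[simplified]])
    show "\<forall>\<^sub>F n in sequentially. of_nat n * Ln (1 + z / of_nat n) + (z - 1/2) * Ln (1 + z / of_nat n) - z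
       = stirling_exp (z + of_nat n) - stirling_exp (of_nat n) - z * of_real (ln (real n))"
      using ev eventually_gt_at_top[of 0]
    proof eventually_elim
      case (elim n)
      have ne: "1 + z / of_nat n \<noteq> 0"
        using elim(1) by (metis add_eq_0_iff less_irrefl norm_minus_cancel norm_one)
      have "z + of_nat n = of_real (real n) * (1 + z / of_nat n)" using elim by (simp add: field_simps)
      then have "Ln (z + of_nat n) = of_real (ln (real n)) + Ln (1 + z / of_nat n)"
        using Ln_times_of_real[of "real n" "1 + z / of_nat n"] elim ne by simp
      moreover have "Ln (of_nat n) = of_real (ln (real n))"
        using Ln_of_real[of "real n"] elim by simp
      ultimately show ?case by (simp add: stirling_exp_def algebra_simps)
    qed
  qed
qed

text \<open>
  This is Gauss's product for \<open>\<Gamma>\<close>: along \<open>z + n\<close> the ratio to the Stirling expression forgets \<open>z\<close>, so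
  that \<open>stirling_ratio z\<close> can be compared with \<open>stirling_ratio 1\<close>.
\<close>

lemma stirling_ratio_shift_asymp:
  assumes z: "z \<notin> \<int>\<^sub>\<le>\<^sub>0"
  shows "(\<lambda>n. stirling_ratio (z + of_nat n) / stirling_ratio (of_nat n)) \<longlonglongrightarrow> 1"
proof -
  have "(\<lambda>n. Gamma (z + of_nat n) / (Gamma (of_nat n) * exp (z * of_real (ln (real n)))) *
      exp (- (stirling_exp (z + of_nat n) - stirling_exp (of_nat n) - z * of_real (ln (real n))))) \<longlonglongrightarrow> 1 * exp (- 0)"
    by (intro tendsto_intros Gamma_shift_asymp z stirling_exp_shift_asymp)
  moreover have "Gamma (z + of_nat n) / (Gamma (of_nat n) * e3) * (e2 * e3 / e1) =
      Gamma (z + of_nat n) / e1 / (Gamma (of_nat n) / e2)" if "e3 \<noteq> 0" for n and e1 e2 e3 :: complex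
    using that by simp
  ultimately show ?thesis
    by (simp add: stirling_ratio_def exp_diff exp_minus exp_add mult_ac)
qed

text \<open>
  Walking from \<open>z\<close> and from \<open>1\<close> to infinity in unit steps accumulates boundedly many errors, and at
  infinity the two ratios agree.
\<close>

lemma stirling_bounds:
  assumes d: "d > 0"
  obtains c C where "0 < c" "0 < C"
    "\<And>z. z \<in> stirling_region d \<Longrightarrow> c * cmod (exp (stirling_exp z)) \<le> cmod (Gamma z)"
    "\<And>z. z \<in> stirling_region d \<Longrightarrow> cmod (Gamma z) \<le> C * cmod (exp (stirling_exp z))"
proof -
  define D where "D = (\<lambda>w. stirling_exp (w + 1) - stirling_exp w - Ln w)"
  define d' where "d' = min d 1"
  define K where "K = 3 * (1 + 1 / d'\<^sup>2) * pi"
  have d': "d' > 0" "d' \<le> d" "d' \<le> 1" using d by (auto simp: d'_def)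
  have reg: "z \<in> stirling_region d'" if "z \<in> stirling_region d" for z
    using that d'(2) by (auto simp: stirling_region_def)
  have reg1: "1 \<in> stirling_region d'" using d' by (auto simp: stirling_region_def)
  have sumD: "cmod (\<Sum>n<N. D (z + of_nat n)) \<le> K" if z: "z \<in> stirling_region d'" for z N
  proof -
    have "cmod (\<Sum>n<N. D (z + of_nat n)) \<le> (\<Sum>n<N. 3 * (1 + 1 / d'\<^sup>2) * (arctan (Re z + real n + 1) - arctan (Re z + real n)))"
      unfolding D_def using stirling_increment_bound[OF stirling_region_add[OF z, of "real _"] d'(1)]
      by (intro sum_norm_le) simp
    also have "\<dots> = 3 * (1 + 1 / d'\<^sup>2) * (\<Sum>n<N. (arctan (Re z + real n + 1) - arctan (Re z + real n)))"
      by (simp add: sum_distrib_left)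
    also have "\<dots> \<le> K" unfolding K_def by (intro mult_left_mono arctan_telescope) auto
    finally show ?thesis .
  qed
  define R where "R = cmod (stirling_ratio 1)"
  have R: "R > 0" by (simp add: R_def stirling_ratio_def)
  have lower_upper: "exp (-2*K) * R \<le> cmod (stirling_ratio z) \<and> cmod (stirling_ratio z) \<le> exp (2*K) * R"
    if z: "z \<in> stirling_region d'" for z
  proof -
    note zr = stirling_regionD[OF z d'(1)]
    define q where "q = (\<lambda>n. stirling_ratio (z + of_nat n) / stirling_ratio (of_nat n) / (stirling_ratio (1 + of_nat n) / stirling_ratio (of_nat n)))"
    have "q \<longlonglongrightarrow> 1 / 1" unfolding q_def
      by (intro tendsto_divide stirling_ratio_shift_asymp zr) auto
    then have lim: "(\<lambda>n. cmod (q n)) \<longlonglongrightarrow> 1" using tendsto_norm by fastforce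
    have rne: "stirling_ratio (of_nat n) \<noteq> 0" if "n > 0" for n
      using that Gamma_fact[of "n - 1", where ?'a=complex] by (simp add: stirling_ratio_def of_nat_diff)
    have eq: "cmod (stirling_ratio z) = cmod (q n) * exp (Re (\<Sum>k<n. D (z + of_nat k)) - Re (\<Sum>k<n. D (1 + of_nat k))) * R"
      if n: "n > 0" for n
    proof -
      have "stirling_ratio (1 + of_nat n) \<noteq> 0" using rne[of "Suc n"] by simp
      then have "stirling_ratio z = q n * exp (\<Sum>k<n. D (z + of_nat k)) / exp (\<Sum>k<n. D (1 + of_nat k)) * stirling_ratio 1"
        using stirling_ratio_shift[OF z d'(1), of n] stirling_ratio_shift[OF reg1 d'(1), of n] rne[OF n]
        by (simp add: q_def D_def field_simps)
      then show ?thesis by (simp add: norm_mult norm_divide R_def exp_diff)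
    qed
    have ab: "\<bar>Re (\<Sum>k<n. D (z + of_nat k)) - Re (\<Sum>k<n. D (1 + of_nat k))\<bar> \<le> 2 * K" for n
      using order_trans[OF abs_Re_le_cmod sumD[OF z, of n]] order_trans[OF abs_Re_le_cmod sumD[OF reg1, of n]]
      by linarith
    have "cmod (stirling_ratio z) \<le> 1 * exp (2*K) * R"
    proof (rule tendsto_lowerbound)
      show "(\<lambda>n. cmod (q n) * exp (2*K) * R) \<longlonglongrightarrow> 1 * exp (2*K) * R"
        by (intro tendsto_intros lim)
      show "\<forall>\<^sub>F n in sequentially. cmod (stirling_ratio z) \<le> cmod (q n) * exp (2 * K) * R"
        using eventually_gt_at_top[of 0]
      proof eventually_elim
        case (elim n)
        then show ?case unfolding eq[OF elim] using ab[of n] R by (intro mult_right_mono mult_left_mono) auto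
      qed
    qed auto
    moreover have "1 * exp (-2*K) * R \<le> cmod (stirling_ratio z)"
    proof (rule tendsto_upperbound)
      show "(\<lambda>n. cmod (q n) * exp (-2*K) * R) \<longlonglongrightarrow> 1 * exp (-2*K) * R"
        by (intro tendsto_intros lim)
      show "\<forall>\<^sub>F n in sequentially. cmod (q n) * exp (-2 * K) * R \<le> cmod (stirling_ratio z)"
        using eventually_gt_at_top[of 0]
      proof eventually_elim
        case (elim n)
        then show ?case unfolding eq[OF elim] using ab[of n] R by (intro mult_right_mono mult_left_mono) auto
      qed
    qed auto
    ultimately show ?thesis by simp
  qed
  show thesis
  proof (rule that[of "exp (-2*K) * R" "exp (2*K) * R"])
    show "exp (-2*K) * R * cmod (exp (stirling_exp z)) \<le> cmod (Gamma z)" if "z \<in> stirling_region d" for z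
      using conjunct1[OF lower_upper[OF reg[OF that]]] unfolding stirling_ratio_def norm_divide
      by (subst (asm) pos_le_divide_eq) auto
    show "cmod (Gamma z) \<le> exp (2*K) * R * cmod (exp (stirling_exp z))" if "z \<in> stirling_region d" for z
      using conjunct2[OF lower_upper[OF reg[OF that]]] unfolding stirling_ratio_def norm_divide
      by (subst (asm) pos_divide_le_eq) auto
  qed (use R in auto)
qed

section \<open>Growth of products of Gamma factors\<close>

definition growth_exponent :: "real \<Rightarrow> real \<Rightarrow> real \<Rightarrow> complex \<Rightarrow> complex" where
  "growth_exponent \<mu> \<kappa> \<nu> s = of_real \<mu> * s * Ln s + of_real \<kappa> * s + of_real \<nu> * Ln s"

lemma growth_exponent_add:
  "growth_exponent (\<mu> + \<mu>') (\<kappa> + \<kappa>') (\<nu> + \<nu>') s = growth_exponent \<mu> \<kappa> \<nu> s + growth_exponent \<mu>' \<kappa>' \<nu>' s"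
  by (simp add: growth_exponent_def algebra_simps)

lemma growth_exponent_uminus:
  "growth_exponent (- \<mu>) (- \<kappa>) (- \<nu>) s = - growth_exponent \<mu> \<kappa> \<nu> s"
  by (simp add: growth_exponent_def algebra_simps)

text \<open>
  Stirling's formula for a whole kernel, in a form that is multiplicative: each \<open>\<Gamma>(B + bs)\<close> adds
  \<open>(b, b ln b - b, B - 1/2)\<close> to \<open>(\<mu>, \<kappa>, \<nu>)\<close> and each denominator subtracts it. The region contains the
  vertical line through \<open>1\<close>, where \<open>F\<close> is normalised, and all points away from the real axis.
\<close>

definition has_growth :: "(complex \<Rightarrow> complex) \<Rightarrow> real \<Rightarrow> real \<Rightarrow> real \<Rightarrow> bool" where
  "has_growth F \<mu> \<kappa> \<nu> \<longleftrightarrow> (\<forall>\<delta>>0. \<exists>C>0. \<forall>s. \<delta> \<le> \<bar>Im s\<bar> \<or> 1 \<le> Re s \<longrightarrow>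
     cmod (F s) \<le> C * exp (Re (growth_exponent \<mu> \<kappa> \<nu> s)))"

lemma has_growthD:
  assumes "has_growth F \<mu> \<kappa> \<nu>" "\<delta> > 0"
  obtains C where "C > 0" "\<And>s. \<delta> \<le> \<bar>Im s\<bar> \<or> 1 \<le> Re s \<Longrightarrow> cmod (F s) \<le> C * exp (Re (growth_exponent \<mu> \<kappa> \<nu> s))"
  using assms unfolding has_growth_def by blast

lemma has_growth_1: "has_growth (\<lambda>_. 1) 0 0 0"
  unfolding has_growth_def by (auto simp: growth_exponent_def intro!: exI[of _ 1])

lemma has_growth_mult:
  assumes "has_growth F \<mu> \<kappa> \<nu>" "has_growth G \<mu>' \<kappa>' \<nu>'"
  shows "has_growth (\<lambda>s. F s * G s) (\<mu> + \<mu>') (\<kappa> + \<kappa>') (\<nu> + \<nu>')"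
  unfolding has_growth_def
proof (intro allI impI)
  fix \<delta> :: real assume \<delta>: "\<delta> > 0"
  obtain C where C: "C > 0" "\<And>s. \<delta> \<le> \<bar>Im s\<bar> \<or> 1 \<le> Re s \<Longrightarrow> cmod (F s) \<le> C * exp (Re (growth_exponent \<mu> \<kappa> \<nu> s))"
    using has_growthD[OF assms(1) \<delta>] by metis
  obtain C' where C': "C' > 0" "\<And>s. \<delta> \<le> \<bar>Im s\<bar> \<or> 1 \<le> Re s \<Longrightarrow> cmod (G s) \<le> C' * exp (Re (growth_exponent \<mu>' \<kappa>' \<nu>' s))"
    using has_growthD[OF assms(2) \<delta>] by metis
  show "\<exists>C>0. \<forall>s. \<delta> \<le> \<bar>Im s\<bar> \<or> 1 \<le> Re s \<longrightarrow>
     cmod (F s * G s) \<le> C * exp (Re (growth_exponent (\<mu> + \<mu>') (\<kappa> + \<kappa>') (\<nu> + \<nu>') s))"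
  proof (intro exI[of _ "C * C'"] conjI allI impI)
    show "C * C' > 0" using C C' by simp
    fix s assume s: "\<delta> \<le> \<bar>Im s\<bar> \<or> 1 \<le> Re s"
    have "cmod (F s * G s) \<le> (C * exp (Re (growth_exponent \<mu> \<kappa> \<nu> s))) * (C' * exp (Re (growth_exponent \<mu>' \<kappa>' \<nu>' s)))"
      unfolding norm_mult using C C' s by (intro mult_mono) (auto intro: mult_nonneg_nonneg)
    then show "cmod (F s * G s) \<le> C * C' * exp (Re (growth_exponent (\<mu> + \<mu>') (\<kappa> + \<kappa>') (\<nu> + \<nu>') s))"
      by (simp add: growth_exponent_add exp_add mult_ac)
  qed
qed

text \<open>
  Replacing \<open>B + bs\<close> by \<open>bs\<close> inside the logarithm costs only a bounded amount, because
  \<open>(B + bs) (Ln (B + bs) - Ln (bs))\<close> is a mean of \<open>B (B + bs)/(bs + uB)\<close> over \<open>u\<close> in \<open>[0, 1]\<close>. The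
  condition \<open>B + b > 0\<close> keeps this segment inside the region where Stirling's formula holds.
\<close>

lemma stirling_exp_affine:
  fixes b B \<delta> :: real
  assumes b: "b > 0" "B + b > 0" and \<delta>: "\<delta> > 0"
  obtains K d where "d > 0" 
    "\<And>s. \<delta> \<le> \<bar>Im s\<bar> \<or> 1 \<le> Re s \<Longrightarrow> of_real B + s * of_real b \<in> stirling_region d"
    "\<And>s. \<delta> \<le> \<bar>Im s\<bar> \<or> 1 \<le> Re s \<Longrightarrow>
      cmod (stirling_exp (of_real B + s * of_real b) - growth_exponent b (b * ln b - b) (B - 1/2) s) \<le> K"
proof -
  define d where "d = min (b * \<delta>) (min b (B + b))"
  have d: "d > 0" using b \<delta> by (simp add: d_def)
  have reg: "s * of_real b + of_real u * of_real B \<in> stirling_region d"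
    if s: "\<delta> \<le> \<bar>Im s\<bar> \<or> 1 \<le> Re s" and u: "u \<in> {0..1}" for s u
    using s
  proof
    assume "\<delta> \<le> \<bar>Im s\<bar>"
    then have "b * \<delta> \<le> \<bar>Im s * b\<bar>" using b by (simp add: abs_mult)
    then show ?thesis by (auto simp: stirling_region_def d_def min_le_iff_disj)
  next
    assume s: "1 \<le> Re s"
    have "min b (B + b) \<le> (1 - u) * b + u * (B + b)"
    proof -
      have "min b (B + b) = (1 - u) * min b (B + b) + u * min b (B + b)" by (simp add: algebra_simps)
      also have "\<dots> \<le> (1 - u) * b + u * (B + b)"
        using u by (intro add_mono mult_left_mono) auto
      finally show ?thesis .
    qed
    also have "\<dots> = 1 * b + u * B" by (simp add: algebra_simps)
    also have "\<dots> \<le> Re s * b + u * B" using mult_right_mono[OF s, of b] b by simp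
    finally have "d \<le> Re s * b + u * B" by (simp add: d_def)
    then show ?thesis by (simp add: stirling_region_def)
  qed
  define M where "M = \<bar>B\<bar> * (1 + (\<bar>B\<bar> + 1/2) / d)"
  have diff: "cmod ((of_real B + s * of_real b - 1/2) * (Ln (s * of_real b + of_real B) - Ln (s * of_real b))) \<le> M"
    if s: "\<delta> \<le> \<bar>Im s\<bar> \<or> 1 \<le> Re s" for s
  proof -
    define a where "a = of_real B + s * of_real b - 1/2"
    define g where "g = (\<lambda>u::real. a * Ln (s * of_real b + of_real u * of_real B))"
    define g' where "g' = (\<lambda>u::real. a * of_real B / (s * of_real b + of_real u * of_real B))"
    have "norm (g 1 - g 0) \<le> M * norm (1 - 0 :: real)"
    proof (rule differentiable_bound)
      show "convex {0..1::real}" by simp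
      fix u :: real assume u: "u \<in> {0..1}"
      define w where "w = s * of_real b + of_real u * of_real B"
      note r = stirling_regionD[OF reg[OF s u] d]
      have "((\<lambda>v. a * Ln (s * of_real b + v * of_real B)) has_field_derivative g' u) (at (of_real u))"
        unfolding g'_def using r(1,2) by (auto intro!: derivative_eq_intros simp: field_simps)
      from has_vector_derivative_real_field[OF this]
      show "(g has_derivative (\<lambda>h. h *\<^sub>R g' u)) (at u within {0..1})"
        unfolding g_def has_vector_derivative_def .
      have w: "cmod w \<ge> d" "w \<noteq> 0" using r(2,3) by (simp_all add: w_def)
      have "a = w + (of_real ((1 - u) * B - 1/2))" by (simp add: a_def w_def algebra_simps)
      then have "cmod a \<le> cmod w + \<bar>(1 - u) * B - 1/2\<bar>"
        by (metis norm_triangle_ineq norm_of_real)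
      also have "\<bar>(1 - u) * B - 1/2\<bar> \<le> \<bar>B\<bar> + 1/2"
      proof -
        have "\<bar>(1 - u) * B\<bar> \<le> 1 * \<bar>B\<bar>" unfolding abs_mult using u by (intro mult_right_mono) auto
        then show ?thesis by linarith
      qed
      finally have "cmod a / cmod w \<le> (cmod w + (\<bar>B\<bar> + 1/2)) / cmod w"
        by (intro divide_right_mono) auto
      also have "\<dots> = 1 + (\<bar>B\<bar> + 1/2) / cmod w" using w by (simp add: add_divide_distrib)
      also have "\<dots> \<le> 1 + (\<bar>B\<bar> + 1/2) / d" using w d by (intro add_left_mono divide_left_mono) auto
      finally have "cmod a / cmod w * \<bar>B\<bar> \<le> (1 + (\<bar>B\<bar> + 1/2) / d) * \<bar>B\<bar>" by (intro mult_right_mono) auto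
      then have "cmod (g' u) \<le> M" by (simp add: g'_def w_def norm_mult norm_divide M_def mult_ac)
      then show "onorm (\<lambda>h. h *\<^sub>R g' u) \<le> M"
        by (intro onorm_le) (simp add: mult.commute[of M] mult_left_mono)
    qed auto
    then show ?thesis by (simp add: g_def a_def algebra_simps)
  qed
  define c :: complex where "c = of_real (B - 1/2) * of_real (ln b) - of_real B"
  show thesis
  proof (rule that[of d "M + cmod c"])
    show "d > 0" by fact
    show "of_real B + s * of_real b \<in> stirling_region d" if "\<delta> \<le> \<bar>Im s\<bar> \<or> 1 \<le> Re s" for s
      using reg[OF that, of 1] by (simp add: add.commute)
    fix s assume s: "\<delta> \<le> \<bar>Im s\<bar> \<or> 1 \<le> Re s"
    have "s \<noteq> 0" using s \<delta> by auto
    then have L: "Ln (s * of_real b) = of_real (ln b) + Ln s"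
      using Ln_times_of_real[OF b(1), of s] Ln_of_real[OF b(1)] by (simp add: mult.commute)
    have "stirling_exp (of_real B + s * of_real b) - growth_exponent b (b * ln b - b) (B - 1/2) s
      = (of_real B + s * of_real b - 1/2) * (Ln (s * of_real b + of_real B) - Ln (s * of_real b)) + c"
      unfolding L stirling_exp_def growth_exponent_def c_def
      by (simp add: algebra_simps)
    then show "cmod (stirling_exp (of_real B + s * of_real b) - growth_exponent b (b * ln b - b) (B - 1/2) s) \<le> M + cmod c"
      using norm_triangle_le[OF add_right_mono[OF diff[OF s]]] by simp
  qed
qed

lemma has_growth_Gamma:
  assumes b: "b > 0" "B + b > 0"
  shows "has_growth (\<lambda>s. Gamma (of_real B + s * of_real b)) b (b * ln b - b) (B - 1/2)"
    and "has_growth (\<lambda>s. inverse (Gamma (of_real B + s * of_real b))) (- b) (- (b * ln b - b)) (- (B - 1/2))"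
proof -
  have "(\<exists>C>0. \<forall>s. \<delta> \<le> \<bar>Im s\<bar> \<or> 1 \<le> Re s \<longrightarrow>
           cmod (Gamma (of_real B + s * of_real b)) \<le> C * exp (Re (growth_exponent b (b * ln b - b) (B - 1/2) s))) \<and>
        (\<exists>C>0. \<forall>s. \<delta> \<le> \<bar>Im s\<bar> \<or> 1 \<le> Re s \<longrightarrow>
           cmod (inverse (Gamma (of_real B + s * of_real b))) \<le> C * exp (Re (growth_exponent (-b) (- (b * ln b - b)) (- (B - 1/2)) s)))"
    if \<delta>: "\<delta> > 0" for \<delta> :: real
  proof -
    obtain K d where d: "d > 0" and K:
      "\<And>s. \<delta> \<le> \<bar>Im s\<bar> \<or> 1 \<le> Re s \<Longrightarrow> of_real B + s * of_real b \<in> stirling_region d"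
      "\<And>s. \<delta> \<le> \<bar>Im s\<bar> \<or> 1 \<le> Re s \<Longrightarrow>
        cmod (stirling_exp (of_real B + s * of_real b) - growth_exponent b (b * ln b - b) (B - 1/2) s) \<le> K"
      using stirling_exp_affine[OF b \<delta>] by metis
    obtain c C where cC: "0 < c" "0 < C"
      "\<And>z. z \<in> stirling_region d \<Longrightarrow> c * cmod (exp (stirling_exp z)) \<le> cmod (Gamma z)"
      "\<And>z. z \<in> stirling_region d \<Longrightarrow> cmod (Gamma z) \<le> C * cmod (exp (stirling_exp z))"
      using stirling_bounds[OF d] by metis
    have two: "Re (stirling_exp (of_real B + s * of_real b)) \<le> K + Re (growth_exponent b (b * ln b - b) (B - 1/2) s)"
      "- Re (stirling_exp (of_real B + s * of_real b)) \<le> K - Re (growth_exponent b (b * ln b - b) (B - 1/2) s)"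
      if "\<delta> \<le> \<bar>Im s\<bar> \<or> 1 \<le> Re s" for s
      using order_trans[OF abs_Re_le_cmod K(2)[OF that]] by auto
    have up: "cmod (Gamma (of_real B + s * of_real b)) \<le> C * exp K * exp (Re (growth_exponent b (b * ln b - b) (B - 1/2) s))"
      if s: "\<delta> \<le> \<bar>Im s\<bar> \<or> 1 \<le> Re s" for s
    proof -
      have "cmod (Gamma (of_real B + s * of_real b)) \<le> C * exp (Re (stirling_exp (of_real B + s * of_real b)))"
        using cC(4)[OF K(1)[OF s]] by simp
      also have "\<dots> \<le> C * exp (K + Re (growth_exponent b (b * ln b - b) (B - 1/2) s))"
        using two(1)[OF s] cC by simp
      finally show ?thesis by (simp add: exp_add)
    qed
    have lo: "cmod (inverse (Gamma (of_real B + s * of_real b)))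
        \<le> 1 / c * exp K * exp (Re (growth_exponent (-b) (- (b * ln b - b)) (- (B - 1/2)) s))"
      if s: "\<delta> \<le> \<bar>Im s\<bar> \<or> 1 \<le> Re s" for s
    proof -
      have pos: "0 < c * exp (Re (stirling_exp (of_real B + s * of_real b)))" using cC by simp
      have "inverse (cmod (Gamma (of_real B + s * of_real b))) \<le> inverse (c * exp (Re (stirling_exp (of_real B + s * of_real b))))"
        using cC(3)[OF K(1)[OF s]] pos by (intro le_imp_inverse_le) auto
      also have "\<dots> = 1 / c * exp (- Re (stirling_exp (of_real B + s * of_real b)))"
        by (simp add: exp_minus divide_inverse)
      also have "\<dots> \<le> 1 / c * exp (K - Re (growth_exponent b (b * ln b - b) (B - 1/2) s))"
        using two(2)[OF s] cC by (intro mult_left_mono) auto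
      also have "\<dots> = 1 / c * exp K * exp (Re (growth_exponent (-b) (- (b * ln b - b)) (- (B - 1/2)) s))"
      proof -
        have "K - Re (growth_exponent b (b * ln b - b) (B - 1/2) s) = K + Re (growth_exponent (-b) (- (b * ln b - b)) (- (B - 1/2)) s)"
          by (subst growth_exponent_uminus) simp
        then show ?thesis by (simp only: exp_add mult.assoc)
      qed
      finally show ?thesis by (simp add: norm_inverse)
    qed
    show ?thesis
    proof
      show "\<exists>C>0. \<forall>s. \<delta> \<le> \<bar>Im s\<bar> \<or> 1 \<le> Re s \<longrightarrow>
           cmod (Gamma (of_real B + s * of_real b)) \<le> C * exp (Re (growth_exponent b (b * ln b - b) (B - 1/2) s))"
        using up cC by (intro exI[of _ "C * exp K"]) auto
      show "\<exists>C>0. \<forall>s. \<delta> \<le> \<bar>Im s\<bar> \<or> 1 \<le> Re s \<longrightarrow>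
           cmod (inverse (Gamma (of_real B + s * of_real b))) \<le> C * exp (Re (growth_exponent (-b) (- (b * ln b - b)) (- (B - 1/2)) s))"
        using lo cC by (intro exI[of _ "1 / c * exp K"]) auto
    qed
  qed
  then show "has_growth (\<lambda>s. Gamma (of_real B + s * of_real b)) b (b * ln b - b) (B - 1/2)"
    "has_growth (\<lambda>s. inverse (Gamma (of_real B + s * of_real b))) (- b) (- (b * ln b - b)) (- (B - 1/2))"
    unfolding has_growth_def by blast+
qed


text \<open>
  What is needed of the integrand to push a contour to infinity in a left quarter plane: decay in
  \<open>|Im s|\<close>, however slow, and exponential decay towards the left.
\<close>

definition left_decay :: "(complex \<Rightarrow> complex) \<Rightarrow> real \<Rightarrow> real \<Rightarrow> bool" where
  "left_decay F r x \<longleftrightarrow> (\<forall>\<gamma> \<delta>. \<delta> > 0 \<longrightarrow> (\<exists>C>0. \<exists>\<epsilon>>0. \<forall>s. Re s \<le> \<gamma> \<longrightarrow> \<delta> \<le> \<bar>Im s\<bar> \<longrightarrow>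
     cmod (F s) * x powr (- Re s) \<le> C * \<bar>Im s\<bar> powr (- r) * exp (\<epsilon> * Re s)))"

lemma growth_exponent_Re:
  assumes "s \<noteq> 0"
  shows "Re (growth_exponent \<mu> \<kappa> \<nu> s) =
    \<mu> * (Re s * ln (cmod s)) - \<mu> * (Im s * Im (Ln s)) + \<kappa> * Re s + \<nu> * ln (cmod s)"
  using assms by (simp add: growth_exponent_def algebra_simps)

text \<open>
  The term \<open>- Im s Im (Ln s)\<close> of the growth exponent provides the decay in the vertical direction.
  For \<open>Re s \<le> 0\<close> the argument is at least \<open>\<pi>/2\<close> in absolute value; for \<open>Re s \<ge> 0\<close> it is at least its
  sine.
\<close>

lemma Im_Ln_product_ge:
  assumes s: "Im s \<noteq> 0" and \<gamma>: "Re s \<le> \<gamma>" "0 \<le> \<gamma>"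
  shows "Re s \<le> 0 \<Longrightarrow> \<bar>Im s\<bar> \<le> Im s * Im (Ln s)"
    and "0 \<le> Re s \<Longrightarrow> cmod s - \<gamma>\<^sup>2 / cmod s \<le> Im s * Im (Ln s)"
    and "0 \<le> Im s * Im (Ln s)"
proof -
  have s0: "s \<noteq> 0" using s by auto
  have prod: "Im s * Im (Ln s) = \<bar>Im s\<bar> * \<bar>Im (Ln s)\<bar>"
  proof (cases "Im s > 0")
    case True
    then show ?thesis using Im_Ln_pos_lt_imp[of s] by simp
  next
    case False
    then have "Im s < 0" using s by simp
    moreover have "Im (Ln s) < 0" using Im_Ln_pos_le[OF s0] Im_Ln_le_pi[OF s0] \<open>Im s < 0\<close> by linarith
    ultimately show ?thesis by (simp add: abs_of_neg)
  qed
  show "0 \<le> Im s * Im (Ln s)" unfolding prod by simp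
  show "\<bar>Im s\<bar> \<le> Im s * Im (Ln s)" if "Re s \<le> 0"
  proof -
    have "1 \<le> \<bar>Im (Ln s)\<bar>" using Re_Ln_pos_lt[OF s0] that pi_ge_two by linarith
    then show ?thesis unfolding prod using mult_left_mono[of 1 _ "\<bar>Im s\<bar>"] by simp
  qed
  show "cmod s - \<gamma>\<^sup>2 / cmod s \<le> Im s * Im (Ln s)" if re: "0 \<le> Re s"
  proof -
    have pos: "cmod s > 0" using s0 by simp
    have "Im s = cmod s * sin (Im (Ln s))"
      using Im_exp[of "Ln s"] s0 by simp
    then have "\<bar>Im s\<bar> \<le> cmod s * \<bar>Im (Ln s)\<bar>"
      using abs_sin_x_le_abs_x[of "Im (Ln s)"] by (metis abs_mult abs_norm_cancel mult_left_mono norm_ge_zero)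
    then have "\<bar>Im s\<bar> * \<bar>Im s\<bar> \<le> \<bar>Im s\<bar> * (cmod s * \<bar>Im (Ln s)\<bar>)" by (intro mult_left_mono) auto
    then have "(Im s)\<^sup>2 \<le> cmod s * (Im s * Im (Ln s))" unfolding prod by (simp add: power2_eq_square algebra_simps)
    moreover have "(Im s)\<^sup>2 = (cmod s)\<^sup>2 - (Re s)\<^sup>2" by (simp add: cmod_power2)
    moreover have "(Re s)\<^sup>2 \<le> \<gamma>\<^sup>2" using re \<gamma> by (intro power_mono) auto
    ultimately have "(cmod s)\<^sup>2 - \<gamma>\<^sup>2 \<le> cmod s * (Im s * Im (Ln s))" by linarith
    then show ?thesis using pos by (simp add: field_simps power2_eq_square)
  qed
qed

lemma log_minus_linear_bounded:
  fixes N \<mu> r :: real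
  assumes "N > 0" "\<mu> > 0" "r > 0"
  shows "N * ln r - \<mu> * r \<le> N * \<bar>ln (N / \<mu>)\<bar>"
proof -
  have "ln (r * \<mu> / N) \<le> r * \<mu> / N - 1" using assms by (intro ln_le_minus_one) simp
  moreover have "ln (r * \<mu> / N) = ln r - ln (N / \<mu>)" using assms by (simp add: ln_mult ln_div)
  ultimately have "ln r \<le> r * \<mu> / N + \<bar>ln (N / \<mu>)\<bar>" by linarith
  then have "N * ln r \<le> N * (r * \<mu> / N + \<bar>ln (N / \<mu>)\<bar>)" using assms by (intro mult_left_mono) auto
  then show ?thesis using assms by (simp add: algebra_simps)
qed

text \<open>
  The extra terms \<open>k Re s\<close> and \<open>2 ln |Im s|\<close> make room for the factor \<open>x\<^sup>-\<^sup>s\<close> and for the decay that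
  is to be gained. For large \<open>|s|\<close> the term \<open>\<mu> Re s ln |s|\<close> beats every multiple of \<open>Re s\<close> on the left,
  and \<open>- \<mu> Im s Im (Ln s)\<close> beats the logarithms; for bounded \<open>|s|\<close> everything is bounded.
\<close>

lemma growth_exponent_upper:
  fixes k :: real
  assumes \<mu>: "\<mu> > 0" and \<delta>: "\<delta> > 0"
  obtains M where "\<And>s. Re s \<le> \<gamma> \<Longrightarrow> \<delta> \<le> \<bar>Im s\<bar> \<Longrightarrow>
     Re (growth_exponent \<mu> \<kappa> \<nu> s) + k * Re s + 2 * ln \<bar>Im s\<bar> \<le> M"
proof -
  define g where "g = max \<gamma> 0"
  define j where "j = \<bar>\<kappa> + k\<bar>"
  define N where "N = \<bar>\<nu>\<bar> + 2"
  define N' where "N' = \<mu> * g + N"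
  \<comment> \<open>Beyond \<open>R\<close> the logarithm dominates the linear terms; the three parts of \<open>M\<close> below belong to
    large \<open>|s|\<close> on the left, large \<open>|s|\<close> on the right, and bounded \<open>|s|\<close>.\<close>
  define R where "R = exp ((j + \<mu>) / \<mu>)"
  define L where "L = max \<bar>ln \<delta>\<bar> \<bar>ln R\<bar>"
  define M where "M = N * \<bar>ln (N / \<mu>)\<bar> + (N' * \<bar>ln (N' / \<mu>)\<bar> + \<mu> * g\<^sup>2 + j * g) + (\<mu> * (R * L) + j * R + N * L)"
  have pos: "N > 0" "N' > 0" "g \<ge> 0" "j \<ge> 0" "R > 0" "L \<ge> 0"
    using \<mu> by (auto simp: N_def N'_def g_def j_def R_def L_def intro!: add_nonneg_pos)
  have nonneg: "0 \<le> N * \<bar>ln (N / \<mu>)\<bar>" "0 \<le> N' * \<bar>ln (N' / \<mu>)\<bar> + \<mu> * g\<^sup>2 + j * g" "0 \<le> \<mu> * (R * L) + j * R + N * L"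
    using pos \<mu> by auto
  have R1: "R \<ge> 1" unfolding R_def using pos \<mu> by simp
  show thesis
  proof (rule that[of M])
    fix s assume s: "Re s \<le> \<gamma>" "\<delta> \<le> \<bar>Im s\<bar>"
    define r where "r = cmod s"
    define E where "E = Re (growth_exponent \<mu> \<kappa> \<nu> s) + k * Re s + 2 * ln \<bar>Im s\<bar>"
    have s0: "s \<noteq> 0" "Im s \<noteq> 0" using s \<delta> by auto
    have r: "\<bar>Im s\<bar> \<le> r" "\<bar>Re s\<bar> \<le> r" "r \<le> \<bar>Re s\<bar> + \<bar>Im s\<bar>" "\<delta> \<le> r" "r > 0"
      using s s0 abs_Im_le_cmod[of s] abs_Re_le_cmod[of s] cmod_le[of s] by (auto simp: r_def)
    have g: "Re s \<le> g" using s by (simp add: g_def)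
    have lnt: "ln \<bar>Im s\<bar> \<le> ln r" using r s0 by simp
    have E: "E \<le> \<mu> * (Re s * ln r) - \<mu> * (Im s * Im (Ln s)) + j * \<bar>Re s\<bar> + (\<nu> + 2) * ln r"
    proof -
      have "(\<kappa> + k) * Re s \<le> j * \<bar>Re s\<bar>" unfolding j_def by (metis abs_ge_self abs_mult)
      then show ?thesis unfolding E_def growth_exponent_Re[OF s0(1)] using lnt
        by (simp add: algebra_simps r_def)
    qed
    have prod0: "0 \<le> \<mu> * (Im s * Im (Ln s))"
      using Im_Ln_product_ge(3)[OF s0(2) g pos(3)] \<mu> by simp
    have "E \<le> M"
    proof (cases "r \<ge> R")
      case True
      have lnr: "ln r \<ge> (j + \<mu>) / \<mu>" using True pos r by (simp add: R_def ln_ge_iff)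
      have lnr0: "ln r \<ge> 0" using True R1 by simp
      have nu: "(\<nu> + 2) * ln r \<le> N * ln r" using lnr0 by (intro mult_right_mono) (auto simp: N_def)
      show ?thesis
      proof (cases "Re s \<le> 0")
        case True
        have "j + \<mu> \<le> \<mu> * ln r" using lnr \<mu> by (simp add: field_simps)
        then have "\<bar>Re s\<bar> * (j + \<mu>) \<le> \<bar>Re s\<bar> * (\<mu> * ln r)" by (intro mult_left_mono) auto
        moreover have "\<mu> * \<bar>Im s\<bar> \<le> \<mu> * (Im s * Im (Ln s))"
          using Im_Ln_product_ge(1)[OF s0(2) g pos(3) True] \<mu> by simp
        moreover have "\<mu> * r \<le> \<mu> * (\<bar>Re s\<bar> + \<bar>Im s\<bar>)" using r \<mu> by simp
        moreover have "\<mu> * (Re s * ln r) = - (\<bar>Re s\<bar> * (\<mu> * ln r))" using True by simp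
        ultimately have "E \<le> N * ln r - \<mu> * r" using E nu by (simp add: algebra_simps)
        also have "\<dots> \<le> N * \<bar>ln (N / \<mu>)\<bar>" by (rule log_minus_linear_bounded) (use pos \<mu> r in auto)
        finally show ?thesis using nonneg by (simp add: M_def)
      next
        case False
        then have re: "0 \<le> Re s" by simp
        have "r - g\<^sup>2 / r \<le> Im s * Im (Ln s)"
          using Im_Ln_product_ge(2)[OF s0(2) g pos(3) re] by (simp add: r_def)
        moreover have "g\<^sup>2 / r \<le> g\<^sup>2 / 1" using True R1 by (intro divide_left_mono) auto
        ultimately have "\<mu> * (r - g\<^sup>2) \<le> \<mu> * (Im s * Im (Ln s))" using \<mu> by (intro mult_left_mono) auto
        moreover have "\<mu> * (Re s * ln r) \<le> \<mu> * (g * ln r)" using g lnr0 \<mu> by (intro mult_left_mono mult_right_mono) auto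
        moreover have "j * \<bar>Re s\<bar> \<le> j * g" using re g pos by (intro mult_left_mono) auto
        ultimately have "E \<le> (N' * ln r - \<mu> * r) + \<mu> * g\<^sup>2 + j * g"
          using E nu by (simp add: N'_def algebra_simps)
        moreover have "N' * ln r - \<mu> * r \<le> N' * \<bar>ln (N' / \<mu>)\<bar>" by (rule log_minus_linear_bounded) (use pos \<mu> r in auto)
        ultimately show ?thesis using nonneg by (simp add: M_def)
      qed
    next
      case False
      then have rR: "r \<le> R" by simp
      have "ln \<delta> \<le> ln r" "ln r \<le> ln R" using r rR \<delta> pos by auto
      then have lnr: "\<bar>ln r\<bar> \<le> L" unfolding L_def by linarith
      have "Re s * ln r \<le> R * L"
        using mult_mono[of "\<bar>Re s\<bar>" R "\<bar>ln r\<bar>" L] r rR lnr pos abs_ge_self[of "Re s * ln r"] by (simp add: abs_mult)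
      then have 1: "\<mu> * (Re s * ln r) \<le> \<mu> * (R * L)" using \<mu> by simp
      have 2: "j * \<bar>Re s\<bar> \<le> j * R" using r rR pos by (intro mult_left_mono) auto
      have "\<bar>\<nu> + 2\<bar> \<le> N" by (simp add: N_def)
      then have "(\<nu> + 2) * ln r \<le> N * L"
        using mult_mono[of "\<bar>\<nu> + 2\<bar>" N "\<bar>ln r\<bar>" L] lnr pos abs_ge_self[of "(\<nu> + 2) * ln r"] by (simp add: abs_mult)
      with 1 2 prod0 E have "E \<le> \<mu> * (R * L) + j * R + N * L" by linarith
      then show ?thesis using nonneg by (simp add: M_def)
    qed
    then show "Re (growth_exponent \<mu> \<kappa> \<nu> s) + k * Re s + 2 * ln \<bar>Im s\<bar> \<le> M" by (simp add: E_def)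
  qed
qed

text \<open>
  With \<open>\<mu> > 0\<close> the decay is faster than any power; the exponent \<open>2\<close> is enough for integrability along
  vertical lines.
\<close>

lemma left_decay_of_positive_growth:
  assumes F: "has_growth F \<mu> \<kappa> \<nu>" and \<mu>: "\<mu> > 0" and x: "x > 0"
  shows "left_decay F 2 x"
  unfolding left_decay_def
proof (intro allI impI)
  fix \<gamma> \<delta> :: real assume \<delta>: "\<delta> > 0"
  obtain C where C: "C > 0" "\<And>s. \<delta> \<le> \<bar>Im s\<bar> \<or> 1 \<le> Re s \<Longrightarrow> cmod (F s) \<le> C * exp (Re (growth_exponent \<mu> \<kappa> \<nu> s))"
    using has_growthD[OF F \<delta>] by metis
  obtain M where M: "\<And>s. Re s \<le> \<gamma> \<Longrightarrow> \<delta> \<le> \<bar>Im s\<bar> \<Longrightarrow>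
     Re (growth_exponent \<mu> \<kappa> \<nu> s) + (- ln x - 1) * Re s + 2 * ln \<bar>Im s\<bar> \<le> M"
    using growth_exponent_upper[OF \<mu> \<delta>] by metis
  have main: "cmod (F s) * x powr (- Re s) \<le> C * exp M * \<bar>Im s\<bar> powr (- 2) * exp (1 * Re s)"
    if s: "Re s \<le> \<gamma>" "\<delta> \<le> \<bar>Im s\<bar>" for s
  proof -
    have t: "Im s \<noteq> 0" using s \<delta> by auto
    have "cmod (F s) * x powr (- Re s) \<le> C * exp (Re (growth_exponent \<mu> \<kappa> \<nu> s)) * exp (- (Re s * ln x))"
      using C(2)[of s] s x by (simp add: powr_def)
    also have "\<dots> = C * exp (Re (growth_exponent \<mu> \<kappa> \<nu> s) + (- (Re s * ln x)))"
      by (simp only: exp_add mult.assoc)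
    also have "\<dots> \<le> C * exp (M + (-2) * ln \<bar>Im s\<bar> + 1 * Re s)"
      using M[OF s] C by (simp add: algebra_simps)
    also have "\<dots> = C * exp M * \<bar>Im s\<bar> powr (- 2) * exp (1 * Re s)"
      using t by (simp only: exp_add powr_def mult.assoc) simp
    finally show ?thesis .
  qed
  show "\<exists>C>0. \<exists>\<epsilon>>0. \<forall>s. Re s \<le> \<gamma> \<longrightarrow> \<delta> \<le> \<bar>Im s\<bar> \<longrightarrow>
     cmod (F s) * x powr (- Re s) \<le> C * \<bar>Im s\<bar> powr (- 2) * exp (\<epsilon> * Re s)"
    by (rule exI[of _ "C * exp M"], rule conjI, use C in simp, rule exI[of _ 1]) (use main in simp)
qed

text \<open>
  Here the Gamma factors cancel except for the power \<open>|s|\<^sup>\<nu>\<close>, and the exponential decay to the left comes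
  from \<open>x\<^sup>-\<^sup>s\<close> with \<open>x < 1\<close> alone. Uniformity in \<open>x\<close> on compact intervals will allow integration in \<open>x\<close>.
\<close>

lemma left_decay_of_balanced_growth_uniform:
  assumes F: "has_growth F 0 0 \<nu>" and \<nu>: "\<nu> < 0" and x: "0 < x1" "x1 \<le> x2" "x2 < 1" and \<delta>: "\<delta> > 0"
  obtains C where "C > 0" "\<And>x s. x1 \<le> x \<Longrightarrow> x \<le> x2 \<Longrightarrow> Re s \<le> \<gamma> \<Longrightarrow> \<delta> \<le> \<bar>Im s\<bar> \<Longrightarrow>
     cmod (F s) * x powr (- Re s) \<le> C * \<bar>Im s\<bar> powr \<nu> * exp (- ln x2 * Re s)"
proof -
  obtain C where C: "C > 0" "\<And>s. \<delta> \<le> \<bar>Im s\<bar> \<or> 1 \<le> Re s \<Longrightarrow> cmod (F s) \<le> C * exp (Re (growth_exponent 0 0 \<nu> s))"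
    using has_growthD[OF F \<delta>] by metis
  define g where "g = max \<gamma> 0"
  show thesis
  proof (rule that[of "C * exp (g * (ln x2 - ln x1))"])
    fix x s assume h: "x1 \<le> x" "x \<le> x2" "Re s \<le> \<gamma>" "\<delta> \<le> \<bar>Im s\<bar>"
    have t: "Im s \<noteq> 0" "s \<noteq> 0" using h \<delta> by auto
    have "\<bar>Im s\<bar> \<le> cmod s" by (rule abs_Im_le_cmod)
    then have "ln \<bar>Im s\<bar> \<le> ln (cmod s)" using t by simp
    then have "exp (Re (growth_exponent 0 0 \<nu> s)) \<le> exp (\<nu> * ln \<bar>Im s\<bar>)"
      using growth_exponent_Re[OF t(2), of 0 0 \<nu>] \<nu> by simp
    then have 1: "cmod (F s) \<le> C * \<bar>Im s\<bar> powr \<nu>"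
      using C(2)[of s] C(1) h t by (smt (verit) mult_left_mono powr_def)
    have "Re s * (ln x2 - ln x) \<le> g * (ln x2 - ln x1)"
    proof -
      have "ln x \<le> ln x2" "ln x1 \<le> ln x" using h x by auto
      have "Re s * (ln x2 - ln x) \<le> g * (ln x2 - ln x)" 
        using h \<open>ln x \<le> ln x2\<close> by (intro mult_right_mono) (auto simp: g_def)
      also have "\<dots> \<le> g * (ln x2 - ln x1)" 
        using \<open>ln x1 \<le> ln x\<close> by (intro mult_left_mono) (auto simp: g_def)
      finally show ?thesis .
    qed
    then have "x powr (- Re s) \<le> exp (g * (ln x2 - ln x1) + - ln x2 * Re s)"
      using h x by (simp add: powr_def algebra_simps)
    then have 2: "x powr (- Re s) \<le> exp (g * (ln x2 - ln x1)) * exp (- ln x2 * Re s)" by (simp only: exp_add)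
    have "cmod (F s) * x powr (- Re s) \<le> (C * \<bar>Im s\<bar> powr \<nu>) * (exp (g * (ln x2 - ln x1)) * exp (- ln x2 * Re s))"
      using C by (intro mult_mono 1 2) auto
    then show "cmod (F s) * x powr (- Re s) \<le> C * exp (g * (ln x2 - ln x1)) * \<bar>Im s\<bar> powr \<nu> * exp (- ln x2 * Re s)"
      by (simp only: mult_ac)
  qed (use C in auto)
qed

lemma left_decay_of_balanced_growth:
  assumes F: "has_growth F 0 0 \<nu>" and \<nu>: "\<nu> < 0" and x: "0 < x" "x < 1"
  shows "left_decay F (- \<nu>) x"
  unfolding left_decay_def
proof (intro allI impI)
  fix \<gamma> \<delta> :: real assume \<delta>: "\<delta> > 0"
  obtain C where "C > 0" "\<And>y s. x \<le> y \<Longrightarrow> y \<le> x \<Longrightarrow> Re s \<le> \<gamma> \<Longrightarrow> \<delta> \<le> \<bar>Im s\<bar> \<Longrightarrow>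
     cmod (F s) * y powr (- Re s) \<le> C * \<bar>Im s\<bar> powr \<nu> * exp (- ln x * Re s)"
    using left_decay_of_balanced_growth_uniform[OF F \<nu> x(1) order.refl x(2) \<delta>] by metis
  then show "\<exists>C>0. \<exists>\<epsilon>>0. \<forall>s. Re s \<le> \<gamma> \<longrightarrow> \<delta> \<le> \<bar>Im s\<bar> \<longrightarrow>
     cmod (F s) * x powr (- Re s) \<le> C * \<bar>Im s\<bar> powr (- (- \<nu>)) * exp (\<epsilon> * Re s)"
    using x by - (rule exI[of _ C], rule conjI, simp, rule exI[of _ "- ln x"], simp)
qed

section \<open>Contour integrals with decay in quarter planes\<close>

abbreviation seg_integral :: "complex \<Rightarrow> complex \<Rightarrow> (complex \<Rightarrow> complex) \<Rightarrow> complex" where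
  "seg_integral a b G \<equiv> contour_integral (linepath a b) G"

lemma seg_integrable:
  assumes "G holomorphic_on S" "convex S" "a \<in> S" "b \<in> S"
  shows "G contour_integrable_on linepath a b"
  using closed_segment_subset[OF assms(3,4,2)] assms(1)
  by (intro contour_integrable_continuous_linepath holomorphic_on_imp_continuous_on)
    (rule holomorphic_on_subset)

lemma Cauchy_quadrilateral:
  assumes G: "G holomorphic_on S" and S: "convex S" and abcd: "a \<in> S" "b \<in> S" "c \<in> S" "d \<in> S"
  shows "seg_integral a b G + seg_integral b c G + seg_integral c d G = seg_integral a d G"
proof -
  have tri: "seg_integral u v G + seg_integral v w G + seg_integral w u G = 0" if "u \<in> S" "v \<in> S" "w \<in> S" for u v w
  proof -
    have "(G has_contour_integral 0) (linepath u v +++ linepath v w +++ linepath w u)"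
      by (rule Cauchy_theorem_triangle, rule holomorphic_on_subset[OF G]) (use that S in \<open>simp add: hull_minimal\<close>)
    then have "contour_integral (linepath u v +++ linepath v w +++ linepath w u) G = 0"
      by (rule contour_integral_unique)
    then show ?thesis using that
      by (simp add: contour_integrable_join contour_integral_join seg_integrable[OF G S] add.assoc)
  qed
  have rev: "seg_integral u v G = - seg_integral v u G" if "u \<in> S" "v \<in> S" for u v
    by (rule contour_integral_reverse_linepath)
      (rule continuous_on_subset[OF holomorphic_on_imp_continuous_on[OF G] closed_segment_subset[OF that S]])
  show ?thesis using tri[OF abcd(1-3)] tri[OF abcd(1,3,4)] rev[OF abcd(4,1)] rev[OF abcd(3,1)]
    by (simp add: algebra_simps)
qed

lemma seg_integral_vertical_bound:
  assumes "G holomorphic_on S" "convex S" "Complex c u \<in> S" "Complex c v \<in> S" "0 \<le> B"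
    and "\<And>t. t \<in> closed_segment u v \<Longrightarrow> cmod (G (Complex c t)) \<le> B"
  shows "cmod (seg_integral (Complex c u) (Complex c v) G) \<le> B * \<bar>v - u\<bar>"
proof -
  have "cmod (seg_integral (Complex c u) (Complex c v) G) \<le> B * cmod (Complex c v - Complex c u)"
  proof (rule contour_integral_bound_linepath)
    show "G contour_integrable_on linepath (Complex c u) (Complex c v)"
      using assms by (intro seg_integrable)
    fix z assume "z \<in> closed_segment (Complex c u) (Complex c v)"
    then have "z = Complex c (Im z)" "Im z \<in> closed_segment u v"
      using closed_segment_same_Re[of "Complex c u" "Complex c v"] by (auto simp: complex_eq_iff)
    then show "cmod (G z) \<le> B" using assms(6)[of "Im z"] by metis
  qed (use assms in auto)
  also have "cmod (Complex c v - Complex c u) = \<bar>v - u\<bar>"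
    by (simp add: cmod_def)
  finally show ?thesis .
qed

lemma seg_integral_horizontal_exp_bound:
  assumes G: "G holomorphic_on S" "convex S" "Complex (- T) h \<in> S" "Complex \<gamma> h \<in> S"
    and T: "- T \<le> \<gamma>" and \<epsilon>: "\<epsilon> > 0" and B: "0 \<le> B"
    and bnd: "\<And>u. u \<le> \<gamma> \<Longrightarrow> cmod (G (Complex u h)) \<le> B * exp (\<epsilon> * u)"
  shows "cmod (seg_integral (Complex (- T) h) (Complex \<gamma> h) G) \<le> B * exp (\<epsilon> * \<gamma>) / \<epsilon>"
proof -
  let ?p = "linepath (Complex (- T) h) (Complex \<gamma> h)"
  define d where "d = \<gamma> + T"
  have d: "d \<ge> 0" using T by (simp add: d_def)
  have lp: "?p u = Complex (u * d - T) h" for u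
    by (simp add: linepath_def complex_eq_iff d_def algebra_simps)
  have len: "Complex \<gamma> h - Complex (- T) h = of_real d" by (simp add: complex_eq_iff d_def)
  have int: "((\<lambda>u. G (?p u) * of_real d) has_integral seg_integral (Complex (- T) h) (Complex \<gamma> h) G) {0..1}"
    using has_contour_integral_integral[OF seg_integrable[OF G]]
    unfolding has_contour_integral_linepath len by simp
  have exp: "((\<lambda>u. B * exp (\<epsilon> * (u * d - T)) * d) has_integral
      (B * exp (\<epsilon> * (1 * d - T)) / \<epsilon> - B * exp (\<epsilon> * (0 * d - T)) / \<epsilon>)) {0..1}"
    using \<epsilon> by (intro fundamental_theorem_of_calculus)
      (auto intro!: derivative_eq_intros simp flip: has_real_derivative_iff_has_vector_derivative)
  have "cmod (G (?p u) * of_real d) \<le> B * exp (\<epsilon> * (u * d - T)) * d" if u: "u \<in> {0..1}" for u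
  proof -
    have "u * d - T \<le> \<gamma>" using u d mult_right_mono[of u 1 d] by (simp add: d_def)
    then show ?thesis unfolding lp norm_mult using bnd d by (intro mult_mono) (auto intro: mult_nonneg_nonneg B)
  qed
  then have "cmod (seg_integral (Complex (- T) h) (Complex \<gamma> h) G) \<le>
      B * exp (\<epsilon> * (1 * d - T)) / \<epsilon> - B * exp (\<epsilon> * (0 * d - T)) / \<epsilon>"
    using integral_norm_bound_integral[OF has_integral_integrable[OF int] has_integral_integrable[OF exp]]
      integral_unique[OF int] integral_unique[OF exp] by simp
  also have "\<dots> \<le> B * exp (\<epsilon> * \<gamma>) / \<epsilon>" using B \<epsilon> by (simp add: d_def)
  finally show ?thesis .
qed

text \<open>
  Cauchy's theorem for the rectangle with corners \<open>\<gamma> + i\<sigma>\<delta>\<close>, \<open>\<gamma> + i\<sigma>N\<close>, \<open>-T + i\<sigma>N\<close>, \<open>-T + i\<sigma>\<delta>\<close>, where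
  \<open>\<sigma> = \<plusminus>1\<close> selects the upper or the lower quarter plane. The far horizontal side contributes
  \<open>O(N\<^sup>-\<^sup>r)\<close> uniformly in \<open>T\<close>, the far vertical side vanishes as \<open>T \<rightarrow> \<infinity>\<close>. This one estimate shows that the
  integrals along the vertical and along the horizontal ray both converge, to the same limit, even
  when the vertical one converges only conditionally.
\<close>

lemma quarter_plane_limit:
  fixes \<sigma> \<gamma> \<delta> r \<epsilon> C :: real
  assumes G: "G holomorphic_on {s. 0 < \<sigma> * Im s}" and \<sigma>: "\<sigma> = 1 \<or> \<sigma> = - 1"
    and pos: "\<delta> > 0" "r > 0" "\<epsilon> > 0" "C > 0"
    and bnd: "\<And>s. Re s \<le> \<gamma> \<Longrightarrow> \<delta> \<le> \<sigma> * Im s \<Longrightarrow> cmod (G s) \<le> C * (\<sigma> * Im s) powr (- r) * exp (\<epsilon> * Re s)"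
  defines "W \<equiv> (\<lambda>N. seg_integral (Complex \<gamma> (\<sigma> * \<delta>)) (Complex \<gamma> (\<sigma> * N)) G)"
    and "A \<equiv> (\<lambda>T. seg_integral (Complex \<gamma> (\<sigma> * \<delta>)) (Complex (- T) (\<sigma> * \<delta>)) G)"
    and "\<alpha> \<equiv> C * exp (\<epsilon> * \<gamma>) / \<epsilon>"
  obtains a where "(W \<longlongrightarrow> a) at_top" "(A \<longlongrightarrow> a) at_top" "\<And>N. \<delta> \<le> N \<Longrightarrow> cmod (W N - a) \<le> \<alpha> * N powr (- r)"
proof -
  let ?S = "{s. 0 < \<sigma> * Im s}"
  have \<sigma>2: "\<sigma> * (\<sigma> * u) = u" for u using \<sigma> by auto
  have conv: "convex ?S"
  proof (cases "\<sigma> = 1")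
    case True
    then show ?thesis using convex_halfspace_Im_gt[of 0] by simp
  next
    case False
    then have "\<sigma> = -1" using \<sigma> by simp
    then show ?thesis using convex_halfspace_Im_lt[of 0] by simp
  qed
  define \<beta> where "\<beta> = C * \<delta> powr (- r)"
  have mem: "Complex u (\<sigma> * v) \<in> ?S" if "\<delta> \<le> v" for u v
    using that pos by (simp add: \<sigma>2)
  have main: "cmod (W N - A T) \<le> \<alpha> * N powr (- r) + \<beta> * exp (- \<epsilon> * T) * N"
    if N: "\<delta> \<le> N" and T: "- T \<le> \<gamma>" for N T
  proof -
    have "W N + seg_integral (Complex \<gamma> (\<sigma> * N)) (Complex (-T) (\<sigma> * N)) G
       + seg_integral (Complex (-T) (\<sigma> * N)) (Complex (-T) (\<sigma> * \<delta>)) G = A T"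
      unfolding W_def A_def using N by (intro Cauchy_quadrilateral[OF G conv] mem) auto
    moreover have "seg_integral (Complex \<gamma> (\<sigma> * N)) (Complex (-T) (\<sigma> * N)) G = - seg_integral (Complex (-T) (\<sigma> * N)) (Complex \<gamma> (\<sigma> * N)) G"
      by (rule contour_integral_reverse_linepath)
        (rule continuous_on_subset[OF holomorphic_on_imp_continuous_on[OF G] closed_segment_subset[OF mem[OF N] mem[OF N] conv]])
    moreover have "cmod (seg_integral (Complex (-T) (\<sigma> * N)) (Complex \<gamma> (\<sigma> * N)) G) \<le> (C * N powr (- r)) * exp (\<epsilon> * \<gamma>) / \<epsilon>"
    proof (rule seg_integral_horizontal_exp_bound[OF G conv mem mem T pos(3)])
      fix u assume "u \<le> \<gamma>"
      then show "cmod (G (Complex u (\<sigma> * N))) \<le> C * N powr (- r) * exp (\<epsilon> * u)"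
        using bnd[of "Complex u (\<sigma> * N)"] N by (simp add: \<sigma>2)
    qed (use N pos in auto)
    moreover have "cmod (seg_integral (Complex (-T) (\<sigma> * N)) (Complex (-T) (\<sigma> * \<delta>)) G) \<le> (\<beta> * exp (- \<epsilon> * T)) * \<bar>\<sigma> * \<delta> - \<sigma> * N\<bar>"
    proof (rule seg_integral_vertical_bound[OF G conv mem mem])
      fix t assume t: "t \<in> closed_segment (\<sigma> * N) (\<sigma> * \<delta>)"
      have ge: "\<delta> \<le> \<sigma> * t" using t N \<sigma> by (auto simp: closed_segment_eq_real_ivl split: if_splits)
      have "cmod (G (Complex (-T) t)) \<le> C * (\<sigma> * t) powr (- r) * exp (\<epsilon> * (-T))"
        using bnd[of "Complex (-T) t"] ge T by simp
      also have "\<dots> \<le> C * \<delta> powr (- r) * exp (\<epsilon> * (-T))"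
        using ge pos by (intro mult_right_mono mult_left_mono powr_mono2') auto
      finally show "cmod (G (Complex (-T) t)) \<le> \<beta> * exp (- \<epsilon> * T)" by (simp add: \<beta>_def)
    qed (use N pos in \<open>auto simp: \<beta>_def\<close>)
    moreover have "(\<beta> * exp (- \<epsilon> * T)) * \<bar>\<sigma> * \<delta> - \<sigma> * N\<bar> \<le> (\<beta> * exp (- \<epsilon> * T)) * N"
      using \<sigma> N pos by (intro mult_left_mono) (auto simp: \<beta>_def)
    ultimately show ?thesis
      unfolding \<alpha>_def
      by (smt (verit, ccfv_threshold) add_diff_cancel_left' add_uminus_conv_diff diff_add_eq minus_diff_eq mult.assoc mult.commute norm_minus_cancel norm_triangle_ineq4 times_divide_eq_left)
  qed
  have ex0: "((\<lambda>T. \<beta> * exp (- \<epsilon> * T) * N) \<longlongrightarrow> 0) at_top" for N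
    using pos(3) by real_asymp
  have pw0: "((\<lambda>N. \<alpha> * N powr (- r)) \<longlongrightarrow> 0) at_top"
    using pos(2) by real_asymp
  have cau: "cmod (W N - W N') \<le> \<alpha> * N powr (- r) + \<alpha> * N' powr (- r)" if N: "\<delta> \<le> N" "\<delta> \<le> N'" for N N'
  proof (rule tendsto_lowerbound)
    show "((\<lambda>T. (\<alpha> * N powr (- r) + \<beta> * exp (- \<epsilon> * T) * N) + (\<alpha> * N' powr (- r) + \<beta> * exp (- \<epsilon> * T) * N'))
      \<longlongrightarrow> \<alpha> * N powr (- r) + \<alpha> * N' powr (- r)) at_top"
      using tendsto_add[OF tendsto_add[OF tendsto_const ex0] tendsto_add[OF tendsto_const ex0]] by simp
    show "\<forall>\<^sub>F T in at_top. cmod (W N - W N') \<le> (\<alpha> * N powr (- r) + \<beta> * exp (- \<epsilon> * T) * N) + (\<alpha> * N' powr (- r) + \<beta> * exp (- \<epsilon> * T) * N')"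
      using eventually_ge_at_top[of "- \<gamma>"]
    proof eventually_elim
      case (elim T)
      then have T: "- T \<le> \<gamma>" by simp
      have "cmod (W N - W N') \<le> cmod (W N - A T) + cmod (W N' - A T)"
        using norm_triangle_ineq4[of "W N - A T" "W N' - A T"] by simp
      then show ?case using main[OF N(1) T] main[OF N(2) T] by linarith
    qed
  qed auto
  have pw_seq: "(\<lambda>n. \<alpha> * (\<delta> + real n) powr (- r)) \<longlonglongrightarrow> 0"
    by (rule filterlim_compose[OF pw0]) real_asymp
  have "Cauchy (\<lambda>n. W (\<delta> + real n))"
  proof (rule CauchyI)
    fix e :: real assume e: "e > 0"
    have "\<forall>\<^sub>F n in sequentially. \<bar>\<alpha> * (\<delta> + real n) powr (- r)\<bar> < e / 2"
      using tendstoD[OF pw_seq, of "e / 2"] e by simp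
    then obtain M where M: "\<And>n. n \<ge> M \<Longrightarrow> \<bar>\<alpha> * (\<delta> + real n) powr (- r)\<bar> < e / 2"
      by (auto simp: eventually_sequentially)
    show "\<exists>M. \<forall>m\<ge>M. \<forall>n\<ge>M. cmod (W (\<delta> + real m) - W (\<delta> + real n)) < e"
    proof (intro exI[of _ M] allI impI)
      fix m n assume "m \<ge> M" "n \<ge> M"
      then show "cmod (W (\<delta> + real m) - W (\<delta> + real n)) < e"
        using M[of m] M[of n] cau[of "\<delta> + real m" "\<delta> + real n"] by linarith
    qed
  qed
  then obtain a where a: "(\<lambda>n. W (\<delta> + real n)) \<longlonglongrightarrow> a"
    using Cauchy_convergent_iff convergent_def by blast
  have rate: "cmod (W N - a) \<le> \<alpha> * N powr (- r)" if N: "\<delta> \<le> N" for N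
  proof (rule tendsto_le)
    show "(\<lambda>n. \<alpha> * N powr (- r) + \<alpha> * (\<delta> + real n) powr (- r)) \<longlonglongrightarrow> \<alpha> * N powr (- r)"
      using tendsto_add[OF tendsto_const pw_seq] by simp
    show "(\<lambda>n. cmod (W N - W (\<delta> + real n))) \<longlonglongrightarrow> cmod (W N - a)"
      by (intro tendsto_intros a)
    show "\<forall>\<^sub>F n in sequentially. cmod (W N - W (\<delta> + real n)) \<le> \<alpha> * N powr (- r) + \<alpha> * (\<delta> + real n) powr (- r)"
      using cau[OF N] by (intro always_eventually) auto
  qed auto
  have "(W \<longlongrightarrow> a) at_top"
  proof (rule Lim_transform_bound[where g="\<lambda>N. \<alpha> * N powr (- r)", THEN LIM_zero_cancel])
    show "\<forall>\<^sub>F N in at_top. norm (W N - a) \<le> norm (\<alpha> * N powr (- r))"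
      using eventually_ge_at_top[of \<delta>] by eventually_elim (use rate abs_ge_self order_trans in fastforce)
  qed (fact pw0)
  moreover have "(A \<longlongrightarrow> a) at_top"
  proof (rule Lim_transform_bound[where g="\<lambda>T. 2 * \<alpha> * exp (\<epsilon> * T / 2) powr (- r) + \<beta> * exp (- \<epsilon> * T) * exp (\<epsilon> * T / 2)", THEN LIM_zero_cancel])
    have "filterlim (\<lambda>T. exp (\<epsilon> * T / 2)) at_top at_top" using pos(3) by real_asymp
    then have ev: "\<forall>\<^sub>F T in at_top. \<delta> \<le> exp (\<epsilon> * T / 2)" by (auto simp: filterlim_at_top)
    show "\<forall>\<^sub>F T in at_top. norm (A T - a) \<le> norm (2 * \<alpha> * exp (\<epsilon> * T / 2) powr (- r) + \<beta> * exp (- \<epsilon> * T) * exp (\<epsilon> * T / 2))"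
      using ev eventually_ge_at_top[of "- \<gamma>"]
    proof eventually_elim
      case (elim T)
      \<comment> \<open>This choice of \<open>N\<close> makes both error terms of the rectangle estimate small at once.\<close>
      define N where "N = exp (\<epsilon> * T / 2)"
      have N: "\<delta> \<le> N" "- T \<le> \<gamma>" using elim by (auto simp: N_def)
      have "cmod (A T - a) \<le> cmod (W N - a) + cmod (W N - A T)"
        using norm_triangle_ineq4[of "W N - a" "W N - A T"] by simp
      also have "\<dots> \<le> 2 * \<alpha> * N powr (- r) + \<beta> * exp (- \<epsilon> * T) * N"
        using rate[OF N(1)] main[OF N] by linarith
      finally show ?case unfolding N_def real_norm_def by linarith
    qed
    have "((\<lambda>T. 2 * \<alpha> * exp (- (r * \<epsilon>) * T / 2) + \<beta> * exp (- \<epsilon> * T / 2)) \<longlongrightarrow> 0) at_top"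
    proof -
      have "((\<lambda>T. exp (- c * T / 2)) \<longlongrightarrow> 0) at_top" if "c > 0" for c :: real
        using that by real_asymp
      from tendsto_add[OF tendsto_mult_right_zero[OF this] tendsto_mult_right_zero[OF this]] pos
      show ?thesis by simp
    qed
    also have "(\<lambda>T. 2 * \<alpha> * exp (- (r * \<epsilon>) * T / 2) + \<beta> * exp (- \<epsilon> * T / 2)) =
        (\<lambda>T. 2 * \<alpha> * exp (\<epsilon> * T / 2) powr (- r) + \<beta> * exp (- \<epsilon> * T) * exp (\<epsilon> * T / 2))"
      by (auto simp: powr_def mult_exp_exp algebra_simps)
    finally show "((\<lambda>T. 2 * \<alpha> * exp (\<epsilon> * T / 2) powr (- r) + \<beta> * exp (- \<epsilon> * T) * exp (\<epsilon> * T / 2)) \<longlongrightarrow> 0) at_top" .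
  qed
  ultimately show thesis using rate that by blast
qed


text \<open>
  A vertical line and a left loop through the same abscissa share their middle segment; their ends
  are compared by the quarter plane estimate. The rate in the last conclusion depends on the integrand
  only through \<open>C\<close> and \<open>\<epsilon>\<close>, which gives uniform convergence for families of integrands.
\<close>

lemma contour_limit_at:
  fixes r \<gamma> p :: real
  assumes G: "G holomorphic_on {s. Im s \<noteq> 0 \<or> p < Re s}" and \<gamma>: "p < \<gamma>" and r: "r > 0"
    and dec: "\<And>\<delta>. \<delta> > 0 \<Longrightarrow> \<exists>C>0. \<exists>\<epsilon>>0. \<forall>s. Re s \<le> \<gamma> \<longrightarrow> \<delta> \<le> \<bar>Im s\<bar> \<longrightarrow>
                cmod (G s) \<le> C * \<bar>Im s\<bar> powr (- r) * exp (\<epsilon> * Re s)"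
  obtains v where
    "((\<lambda>(R, T). contour_integral (vertical_line \<gamma> R T) G) \<longlongrightarrow> v) (at_top \<times>\<^sub>F at_top)"
    "\<And>\<phi>1 \<phi>2. \<phi>1 < 0 \<Longrightarrow> 0 < \<phi>2 \<Longrightarrow>
       ((\<lambda>(R, T). contour_integral (left_loop \<gamma> \<phi>1 \<phi>2 R T) G) \<longlongrightarrow> v) (at_top \<times>\<^sub>F at_top)"
    "\<And>C \<epsilon> N. C > 0 \<Longrightarrow> \<epsilon> > 0 \<Longrightarrow> (\<And>s. Re s \<le> \<gamma> \<Longrightarrow> 1 \<le> \<bar>Im s\<bar> \<Longrightarrow>
         cmod (G s) \<le> C * \<bar>Im s\<bar> powr (- r) * exp (\<epsilon> * Re s)) \<Longrightarrow> 1 \<le> N \<Longrightarrow>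
       cmod (contour_integral (vertical_line \<gamma> N N) G - v) \<le> 2 * (C * exp (\<epsilon> * \<gamma>) / \<epsilon>) * N powr (- r)"
proof -
  let ?F = "at_top \<times>\<^sub>F at_top :: (real \<times> real) filter"
  let ?V = "\<lambda>R T. contour_integral (vertical_line \<gamma> R T) G"
  have up: "G holomorphic_on {s. 0 < 1 * Im s}" and lo: "G holomorphic_on {s. 0 < (- 1) * Im s}"
    and right: "G holomorphic_on {s. p < Re s}"
    by (rule holomorphic_on_subset[OF G]; auto)+
  note right_conv = convex_halfspace_Re_gt[of p]
  have ints: "G contour_integrable_on linepath (Complex u \<phi>) (Complex w \<phi>)" if "\<phi> \<noteq> 0" for u w \<phi> :: real
  proof (cases "\<phi> > 0")
    case True
    then show ?thesis using convex_halfspace_Im_gt[of 0] by (intro seg_integrable[OF up]) auto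
  next
    case False
    then show ?thesis using convex_halfspace_Im_lt[of 0] that by (intro seg_integrable[OF lo]) auto
  qed
  have core: "\<exists>v. ((\<lambda>(R, T). ?V R T) \<longlongrightarrow> v) ?F \<and>
      ((\<lambda>(R, T). contour_integral (left_loop \<gamma> \<phi>1 \<phi>2 R T) G) \<longlongrightarrow> v) ?F \<and>
      (\<forall>N. - \<phi>1 \<le> N \<longrightarrow> \<phi>2 \<le> N \<longrightarrow> cmod (?V N N - v) \<le> 2 * (C * exp (\<epsilon> * \<gamma>) / \<epsilon>) * N powr (- r))"
    if \<phi>: "\<phi>1 < 0" "0 < \<phi>2" and C: "C > 0" "\<epsilon> > 0" and
      bnd: "\<And>s. Re s \<le> \<gamma> \<Longrightarrow> min (- \<phi>1) \<phi>2 \<le> \<bar>Im s\<bar> \<Longrightarrow> cmod (G s) \<le> C * \<bar>Im s\<bar> powr (- r) * exp (\<epsilon> * Re s)"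
    for \<phi>1 \<phi>2 C \<epsilon> :: real
  proof -
    have \<phi>': "- \<phi>1 > 0" using \<phi> by simp
    define W1 where "W1 = (\<lambda>N. seg_integral (Complex \<gamma> \<phi>1) (Complex \<gamma> (- N)) G)"
    define A1 where "A1 = (\<lambda>N. seg_integral (Complex \<gamma> \<phi>1) (Complex (- N) \<phi>1) G)"
    define W2 where "W2 = (\<lambda>N. seg_integral (Complex \<gamma> \<phi>2) (Complex \<gamma> N) G)"
    define A2 where "A2 = (\<lambda>N. seg_integral (Complex \<gamma> \<phi>2) (Complex (- N) \<phi>2) G)"
    define M where "M = seg_integral (Complex \<gamma> \<phi>1) (Complex \<gamma> \<phi>2) G"
    obtain a1 where a1: "(W1 \<longlongrightarrow> a1) at_top" "(A1 \<longlongrightarrow> a1) at_top"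
      "\<And>N. - \<phi>1 \<le> N \<Longrightarrow> cmod (W1 N - a1) \<le> C * exp (\<epsilon> * \<gamma>) / \<epsilon> * N powr (- r)"
    proof (rule quarter_plane_limit[OF lo _ \<phi>' r C(2,1), of \<gamma>])
      fix s assume "Re s \<le> \<gamma>" "- \<phi>1 \<le> (- 1) * Im s"
      then show "cmod (G s) \<le> C * ((- 1) * Im s) powr (- r) * exp (\<epsilon> * Re s)"
        using bnd[of s] \<phi> by (auto simp: min_le_iff_disj)
    qed (auto simp: W1_def A1_def)
    obtain a2 where a2: "(W2 \<longlongrightarrow> a2) at_top" "(A2 \<longlongrightarrow> a2) at_top"
      "\<And>N. \<phi>2 \<le> N \<Longrightarrow> cmod (W2 N - a2) \<le> C * exp (\<epsilon> * \<gamma>) / \<epsilon> * N powr (- r)"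
    proof (rule quarter_plane_limit[OF up _ \<phi>(2) r C(2,1), of \<gamma>])
      fix s assume "Re s \<le> \<gamma>" "\<phi>2 \<le> 1 * Im s"
      then show "cmod (G s) \<le> C * (1 * Im s) powr (- r) * exp (\<epsilon> * Re s)"
        using bnd[of s] \<phi> by (auto simp: min_le_iff_disj)
    qed (auto simp: W2_def A2_def)
    define v where "v = - a1 + M + a2"
    have lim: "((\<lambda>(R, T). - X R + M + Y T) \<longlongrightarrow> v) ?F"
      if "(X \<longlongrightarrow> a1) at_top" "(Y \<longlongrightarrow> a2) at_top" for X Y
      unfolding v_def case_prod_unfold
      by (intro tendsto_intros filterlim_compose[OF that(1) filterlim_fst] filterlim_compose[OF that(2) filterlim_snd])
    have vert: "?V R T = - W1 R + M + W2 T" for R T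
    proof -
      have "seg_integral (Complex \<gamma> (- R)) (Complex \<gamma> \<phi>1) G + M + W2 T = ?V R T"
        unfolding vertical_line_def W2_def M_def
        using \<gamma> by (intro Cauchy_quadrilateral[OF right right_conv]) auto
      moreover have "seg_integral (Complex \<gamma> (- R)) (Complex \<gamma> \<phi>1) G = - W1 R"
        unfolding W1_def
        by (rule contour_integral_reverse_linepath, rule continuous_on_subset[OF holomorphic_on_imp_continuous_on[OF right]
          closed_segment_subset[OF _ _ right_conv]]) (use \<gamma> in auto)
      ultimately show ?thesis by simp
    qed
    have loop: "contour_integral (left_loop \<gamma> \<phi>1 \<phi>2 R T) G = - A1 R + M + A2 T" for R T
    proof -
      have i: "G contour_integrable_on linepath (Complex (- R) \<phi>1) (Complex \<gamma> \<phi>1)"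
        "G contour_integrable_on linepath (Complex \<gamma> \<phi>1) (Complex \<gamma> \<phi>2)"
        "G contour_integrable_on linepath (Complex \<gamma> \<phi>2) (Complex (- T) \<phi>2)"
        using \<phi> ints seg_integrable[OF right right_conv] \<gamma> by auto
      have "seg_integral (Complex (- R) \<phi>1) (Complex \<gamma> \<phi>1) G = - A1 R"
        unfolding A1_def
        by (rule contour_integral_reverse_linepath, rule continuous_on_subset[OF holomorphic_on_imp_continuous_on[OF lo]
          closed_segment_subset]) (use \<phi> convex_halfspace_Im_lt[of 0] in auto)
      then show ?thesis using i unfolding left_loop_def
        by (simp add: contour_integrable_join contour_integral_join A2_def M_def)
    qed
    have "cmod (?V N N - v) \<le> 2 * (C * exp (\<epsilon> * \<gamma>) / \<epsilon>) * N powr (- r)" if N: "- \<phi>1 \<le> N" "\<phi>2 \<le> N" for N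
    proof -
      have "?V N N - v = (W2 N - a2) - (W1 N - a1)" by (simp add: vert v_def)
      then have "cmod (?V N N - v) \<le> cmod (W2 N - a2) + cmod (W1 N - a1)" by (simp add: norm_triangle_ineq4)
      then show ?thesis using a1(3)[OF N(1)] a2(3)[OF N(2)] by linarith
    qed
    then show ?thesis unfolding vert loop using lim[OF a1(1) a2(1)] lim[OF a1(2) a2(2)] by blast
  qed
  have nonbot: "?F \<noteq> bot" by (simp add: prod_filter_eq_bot)
  have dec': "\<exists>C>0. \<exists>\<epsilon>>0. \<forall>s. Re s \<le> \<gamma> \<longrightarrow> min (- \<phi>1) \<phi>2 \<le> \<bar>Im s\<bar> \<longrightarrow>
                cmod (G s) \<le> C * \<bar>Im s\<bar> powr (- r) * exp (\<epsilon> * Re s)" if "\<phi>1 < 0" "0 < \<phi>2" for \<phi>1 \<phi>2 :: real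
    using dec[of "min (- \<phi>1) \<phi>2"] that by simp
  obtain v where v: "((\<lambda>(R, T). ?V R T) \<longlongrightarrow> v) ?F"
    using dec'[of "-1" 1] core[of "-1" 1] by (metis neg_less_0_iff_less zero_less_one)
  show thesis
  proof (rule that[OF v])
    fix \<phi>1 \<phi>2 :: real assume \<phi>: "\<phi>1 < 0" "0 < \<phi>2"
    obtain v' where "((\<lambda>(R, T). ?V R T) \<longlongrightarrow> v') ?F"
      "((\<lambda>(R, T). contour_integral (left_loop \<gamma> \<phi>1 \<phi>2 R T) G) \<longlongrightarrow> v') ?F"
      using dec'[OF \<phi>] core[OF \<phi>] by metis
    then show "((\<lambda>(R, T). contour_integral (left_loop \<gamma> \<phi>1 \<phi>2 R T) G) \<longlongrightarrow> v) ?F"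
      using tendsto_unique[OF nonbot v] by simp
  next
    fix C \<epsilon> N :: real
    assume h: "C > 0" "\<epsilon> > 0" "\<And>s. Re s \<le> \<gamma> \<Longrightarrow> 1 \<le> \<bar>Im s\<bar> \<Longrightarrow>
         cmod (G s) \<le> C * \<bar>Im s\<bar> powr (- r) * exp (\<epsilon> * Re s)" "1 \<le> N"
    obtain v' where "((\<lambda>(R, T). ?V R T) \<longlongrightarrow> v') ?F"
      "\<And>N. 1 \<le> N \<Longrightarrow> cmod (?V N N - v') \<le> 2 * (C * exp (\<epsilon> * \<gamma>) / \<epsilon>) * N powr (- r)"
      using core[of "-1" 1 C \<epsilon>] h by auto
    then show "cmod (?V N N - v) \<le> 2 * (C * exp (\<epsilon> * \<gamma>) / \<epsilon>) * N powr (- r)"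
      using tendsto_unique[OF nonbot v] h(4) by simp
  qed
qed

text \<open>
  The horizontal sides of the rectangle between the two lines vanish in the limit.
\<close>

lemma vertical_shift:
  fixes r \<gamma>1 \<gamma>2 p C :: real
  assumes G: "G holomorphic_on {s. p < Re s}" and \<gamma>: "p < \<gamma>1" "p < \<gamma>2" and r: "r > 0" and C: "C \<ge> 0"
    and bnd: "\<And>s. Re s \<in> closed_segment \<gamma>1 \<gamma>2 \<Longrightarrow> 1 \<le> \<bar>Im s\<bar> \<Longrightarrow> cmod (G s) \<le> C * \<bar>Im s\<bar> powr (- r)"
  shows "((\<lambda>(R, T). contour_integral (vertical_line \<gamma>1 R T) G - contour_integral (vertical_line \<gamma>2 R T) G) \<longlongrightarrow> 0)
           (at_top \<times>\<^sub>F at_top)"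
proof -
  let ?F = "at_top \<times>\<^sub>F at_top :: (real \<times> real) filter"
  note conv = convex_halfspace_Re_gt[of p]
  have hor: "cmod (seg_integral (Complex u h) (Complex w h) G) \<le> C * \<bar>h\<bar> powr (- r) * \<bar>\<gamma>2 - \<gamma>1\<bar>"
    if uw: "(u = \<gamma>1 \<and> w = \<gamma>2) \<or> (u = \<gamma>2 \<and> w = \<gamma>1)" and h: "1 \<le> \<bar>h\<bar>" for u w h
  proof -
    have "cmod (seg_integral (Complex u h) (Complex w h) G) \<le> (C * \<bar>h\<bar> powr (- r)) * cmod (Complex w h - Complex u h)"
    proof (rule contour_integral_bound_linepath)
      show "G contour_integrable_on linepath (Complex u h) (Complex w h)"
        using \<gamma> uw by (intro seg_integrable[OF G conv]) auto
      fix z assume "z \<in> closed_segment (Complex u h) (Complex w h)"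
      then have "Im z = h" "Re z \<in> closed_segment u w"
        using closed_segment_same_Im[of "Complex u h" "Complex w h"] by auto
      moreover have "closed_segment u w = closed_segment \<gamma>1 \<gamma>2" using uw closed_segment_commute by auto
      ultimately show "cmod (G z) \<le> C * \<bar>h\<bar> powr (- r)" using bnd[of z] h by auto
    qed (use C in auto)
    also have "cmod (Complex w h - Complex u h) = \<bar>\<gamma>2 - \<gamma>1\<bar>" using uw by (auto simp: cmod_def)
    finally show ?thesis .
  qed
  have est: "cmod (contour_integral (vertical_line \<gamma>1 R T) G - contour_integral (vertical_line \<gamma>2 R T) G)
      \<le> C * \<bar>\<gamma>2 - \<gamma>1\<bar> * (R powr (- r) + T powr (- r))" if "1 \<le> R" "1 \<le> T" for R T
  proof -
    have "seg_integral (Complex \<gamma>1 (- R)) (Complex \<gamma>2 (- R)) G + contour_integral (vertical_line \<gamma>2 R T) G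
      + seg_integral (Complex \<gamma>2 T) (Complex \<gamma>1 T) G = contour_integral (vertical_line \<gamma>1 R T) G"
      unfolding vertical_line_def using \<gamma> by (intro Cauchy_quadrilateral[OF G conv]) auto
    then have "contour_integral (vertical_line \<gamma>1 R T) G - contour_integral (vertical_line \<gamma>2 R T) G =
      seg_integral (Complex \<gamma>1 (- R)) (Complex \<gamma>2 (- R)) G + seg_integral (Complex \<gamma>2 T) (Complex \<gamma>1 T) G"
      by (simp add: algebra_simps)
    also have "cmod \<dots> \<le> C * \<bar>- R\<bar> powr (- r) * \<bar>\<gamma>2 - \<gamma>1\<bar> + C * \<bar>T\<bar> powr (- r) * \<bar>\<gamma>2 - \<gamma>1\<bar>"
      using that by (intro norm_triangle_mono hor) auto
    finally show ?thesis using that by (simp add: algebra_simps)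
  qed
  have pw: "((\<lambda>N. N powr (- r)) \<longlongrightarrow> 0) at_top" using r by real_asymp
  have lim: "((\<lambda>x. C * \<bar>\<gamma>2 - \<gamma>1\<bar> * (fst x powr (- r) + snd x powr (- r))) \<longlongrightarrow> C * \<bar>\<gamma>2 - \<gamma>1\<bar> * (0 + 0)) ?F"
    by (intro tendsto_intros filterlim_compose[OF pw filterlim_fst] filterlim_compose[OF pw filterlim_snd])
  show ?thesis
  proof (rule Lim_null_comparison)
    have "\<forall>\<^sub>F x in ?F. 1 \<le> fst x \<and> 1 \<le> snd x"
      by (intro eventually_conj filterlim_fst[THEN filterlim_iff[THEN iffD1], rule_format]
            filterlim_snd[THEN filterlim_iff[THEN iffD1], rule_format] eventually_ge_at_top)
    then show "\<forall>\<^sub>F x in ?F. norm (case x of (R, T) \<Rightarrow> contour_integral (vertical_line \<gamma>1 R T) G - contour_integral (vertical_line \<gamma>2 R T) G)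
        \<le> C * \<bar>\<gamma>2 - \<gamma>1\<bar> * (fst x powr (- r) + snd x powr (- r))"
      by eventually_elim (use est in \<open>auto simp: case_prod_unfold\<close>)
    show "((\<lambda>x. C * \<bar>\<gamma>2 - \<gamma>1\<bar> * (fst x powr (- r) + snd x powr (- r))) \<longlongrightarrow> 0) ?F"
      using lim by simp
  qed
qed

section \<open>Fox-H functions and their contours\<close>

text \<open>
  The condition \<open>B + b > 0\<close> places the poles of \<open>\<Gamma>(B + bs)\<close> to the left of \<open>1\<close>, the abscissa at which the
  Mellin transform of a density is normalised.
\<close>

definition valid_params :: "(real \<times> real) list \<Rightarrow> bool" where
  "valid_params Bs \<longleftrightarrow> (\<forall>(B, b)\<in>set Bs. 0 < b \<and> 0 < B + b)"

text \<open>
  The largest pole of the numerator: the poles with \<open>l = 0\<close> dominate.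
\<close>

definition fox_bound :: "(real \<times> real) list \<Rightarrow> real" where
  "fox_bound Bs = Max ((\<lambda>(B, b). - B / b) ` set Bs)"

lemma fox_bound_ge: "(B, b) \<in> set Bs \<Longrightarrow> - B / b \<le> fox_bound Bs"
  unfolding fox_bound_def by (rule Max_ge) (auto intro!: image_eqI[of _ _ "(B, b)"])

lemma fox_bound_less_iff:
  assumes "Bs \<noteq> []"
  shows "fox_bound Bs < \<gamma> \<longleftrightarrow> (\<forall>(B, b)\<in>set Bs. - B / b < \<gamma>)"
  using assms unfolding fox_bound_def by (subst Max_less_iff) auto

lemma fox_bound_less_1:
  assumes "Bs \<noteq> []" "valid_params Bs"
  shows "fox_bound Bs < 1"
  using assms(2) unfolding fox_bound_less_iff[OF assms(1)] valid_params_def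
  by (auto simp: field_simps)

lemma fox_poles_less_iff:
  assumes "Bs \<noteq> []" "valid_params Bs"
  shows "(\<forall>z\<in>fox_poles Bs. z < \<gamma>) \<longleftrightarrow> fox_bound Bs < \<gamma>"
proof
  assume L: "\<forall>z\<in>fox_poles Bs. z < \<gamma>"
  show "fox_bound Bs < \<gamma>" unfolding fox_bound_less_iff[OF assms(1)]
  proof safe
    fix B b assume "(B, b) \<in> set Bs"
    then have "- (B + real 0) / b \<in> fox_poles Bs" unfolding fox_poles_def by blast
    then show "- B / b < \<gamma>" using L by auto
  qed
next
  assume R: "fox_bound Bs < \<gamma>"
  show "\<forall>z\<in>fox_poles Bs. z < \<gamma>"
  proof
    fix z assume "z \<in> fox_poles Bs"
    then obtain B b l where z: "z = - (B + real l) / b" "(B, b) \<in> set Bs" unfolding fox_poles_def by blast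
    then have b: "b > 0" using assms(2) by (auto simp: valid_params_def)
    have "z \<le> - B / b" unfolding z using b by (intro divide_right_mono) auto
    also have "\<dots> < \<gamma>" using fox_bound_ge[OF z(2)] R by linarith
    finally show "z < \<gamma>" .
  qed
qed

lemma Gamma_affine_argument:
  assumes "(B, b) \<in> set Bs" "valid_params Bs" "Im s \<noteq> 0 \<or> fox_bound Bs < Re s"
  shows "of_real B + s * of_real b \<notin> \<int>\<^sub>\<le>\<^sub>0"
proof
  assume "of_real B + s * of_real b \<in> \<int>\<^sub>\<le>\<^sub>0"
  then have "of_real B + s * of_real b \<in> \<real>\<^sub>\<le>\<^sub>0" using nonpos_Ints_subset_nonpos_Reals by auto
  then have *: "Im s * b = 0" "B + Re s * b \<le> 0" by (auto simp: complex_nonpos_Reals_iff)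
  have b: "b > 0" using assms(1,2) by (auto simp: valid_params_def)
  then have "fox_bound Bs < Re s" using * assms(3) by auto
  then have "- B / b < Re s" using fox_bound_ge[OF assms(1)] by linarith
  then have "- B < Re s * b" using b by (simp only: pos_divide_less_eq)
  with * show False by simp
qed

lemma fox_kernel_rGamma:
  "fox_kernel As Bs s = (\<Prod>(B, b)\<leftarrow>Bs. Gamma (of_real B + s * of_real b)) *
      (\<Prod>(A, a)\<leftarrow>As. rGamma (of_real A + s * of_real a))"
proof -
  have "inverse (\<Prod>(A, a)\<leftarrow>As. Gamma (of_real A + s * of_real a)) = (\<Prod>(A, a)\<leftarrow>As. rGamma (of_real A + s * of_real a))"
    by (induction As) (auto simp: Gamma_def inverse_mult_distrib)
  then show ?thesis unfolding fox_kernel_def divide_inverse by simp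
qed

lemma fox_kernel_append:
  "fox_kernel (As @ As') (Bs @ Bs') s = fox_kernel As Bs s * fox_kernel As' Bs' s"
  by (simp add: fox_kernel_rGamma)

lemma fox_kernel_holomorphic:
  assumes "valid_params Bs"
  shows "fox_kernel As Bs holomorphic_on {s. Im s \<noteq> 0 \<or> fox_bound Bs < Re s}"
proof -
  let ?S = "{s. Im s \<noteq> 0 \<or> fox_bound Bs < Re s}"
  have num: "(\<lambda>s. \<Prod>(B, b)\<leftarrow>Cs. Gamma (of_real B + s * of_real b)) holomorphic_on ?S" if "set Cs \<subseteq> set Bs" for Cs
    using that
  proof (induction Cs)
    case (Cons c Cs)
    obtain B b where c: "c = (B, b)" by force
    have "(\<lambda>s. Gamma (of_real B + s * of_real b)) holomorphic_on ?S"
      using Cons.prems Gamma_affine_argument[OF _ assms] unfolding c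
      by (intro holomorphic_Gamma' holomorphic_intros) auto
    with Cons show ?case by (auto simp: c intro!: holomorphic_on_mult)
  qed simp
  have "(\<lambda>s. \<Prod>(A, a)\<leftarrow>As. rGamma (of_real A + s * of_real a)) holomorphic_on ?S"
    by (induction As) (auto intro!: holomorphic_intros)
  then show ?thesis unfolding fox_kernel_rGamma[abs_def] by (intro holomorphic_on_mult num) auto
qed

abbreviation mellin_integrand :: "(complex \<Rightarrow> complex) \<Rightarrow> real \<Rightarrow> complex \<Rightarrow> complex" where
  "mellin_integrand F x s \<equiv> F s * of_real x powr (- s)"

lemma norm_mellin_integrand:
  "x > 0 \<Longrightarrow> cmod (mellin_integrand F x s) = cmod (F s) * x powr (- Re s)"
  by (simp add: norm_mult norm_powr_real_powr)

lemma mellin_integrand_holomorphic: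
  assumes "F holomorphic_on S" "x > 0"
  shows "mellin_integrand F x holomorphic_on S"
  using assms by (auto intro!: holomorphic_intros)

text \<open>
  The part of the decay that does not depend on \<open>x\<close>: on a vertical strip the factor \<open>x\<^sup>-\<^sup>s\<close> is bounded.
\<close>

definition strip_decay :: "(complex \<Rightarrow> complex) \<Rightarrow> real \<Rightarrow> bool" where
  "strip_decay F r \<longleftrightarrow> (\<forall>\<gamma>1 \<gamma>2. \<exists>C>0. \<forall>s. Re s \<in> closed_segment \<gamma>1 \<gamma>2 \<longrightarrow> 1 \<le> \<bar>Im s\<bar> \<longrightarrow>
      cmod (F s) \<le> C * \<bar>Im s\<bar> powr (- r))"

lemma strip_decay_mellin_integrand:
  assumes F: "strip_decay F r" and x: "x > 0"
  shows "strip_decay (mellin_integrand F x) r"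
  unfolding strip_decay_def
proof (intro allI)
  fix \<gamma>1 \<gamma>2 :: real
  obtain C where C: "C > 0" "\<And>s. Re s \<in> closed_segment \<gamma>1 \<gamma>2 \<Longrightarrow> 1 \<le> \<bar>Im s\<bar> \<Longrightarrow> cmod (F s) \<le> C * \<bar>Im s\<bar> powr (- r)"
    using F unfolding strip_decay_def by metis
  have "compact ((\<lambda>u. x powr (- u)) ` closed_segment \<gamma>1 \<gamma>2)"
    using x by (intro compact_continuous_image continuous_intros) auto
  from compact_imp_bounded[OF this] obtain D where D: "\<And>u. u \<in> closed_segment \<gamma>1 \<gamma>2 \<Longrightarrow> x powr (- u) \<le> D"
    unfolding bounded_iff by (metis abs_ge_self imageI order_trans real_norm_def)
  have D0: "D > 0" using D[of \<gamma>1] x by (smt (verit) ends_in_segment(1) powr_gt_zero)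
  show "\<exists>C>0. \<forall>s. Re s \<in> closed_segment \<gamma>1 \<gamma>2 \<longrightarrow> 1 \<le> \<bar>Im s\<bar> \<longrightarrow> cmod (mellin_integrand F x s) \<le> C * \<bar>Im s\<bar> powr (- r)"
  proof (intro exI[of _ "C * D"] conjI allI impI)
    fix s assume s: "Re s \<in> closed_segment \<gamma>1 \<gamma>2" "1 \<le> \<bar>Im s\<bar>"
    have "cmod (mellin_integrand F x s) \<le> (C * \<bar>Im s\<bar> powr (- r)) * D"
      unfolding norm_mellin_integrand[OF x] using C s D D0 by (intro mult_mono) auto
    then show "cmod (mellin_integrand F x s) \<le> C * D * \<bar>Im s\<bar> powr (- r)" by (simp add: mult_ac)
  qed (use C D0 in auto)
qed

lemma strip_decay_of_left_decay:
  assumes F: "left_decay F r x" and x: "x > 0"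
  shows "strip_decay F r"
proof -
  have "strip_decay (mellin_integrand F x) r"
    unfolding strip_decay_def
  proof (intro allI)
    fix \<gamma>1 \<gamma>2 :: real
    define g where "g = max \<gamma>1 \<gamma>2"
    obtain C \<epsilon> where C: "C > 0" "\<epsilon> > 0" "\<And>s. Re s \<le> g \<Longrightarrow> 1 \<le> \<bar>Im s\<bar> \<Longrightarrow>
       cmod (F s) * x powr (- Re s) \<le> C * \<bar>Im s\<bar> powr (- r) * exp (\<epsilon> * Re s)"
      using F unfolding left_decay_def by (metis zero_less_one)
    show "\<exists>C>0. \<forall>s. Re s \<in> closed_segment \<gamma>1 \<gamma>2 \<longrightarrow> 1 \<le> \<bar>Im s\<bar> \<longrightarrow> cmod (mellin_integrand F x s) \<le> C * \<bar>Im s\<bar> powr (- r)"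
    proof (intro exI[of _ "C * exp (\<epsilon> * g)"] conjI allI impI)
      fix s assume s: "Re s \<in> closed_segment \<gamma>1 \<gamma>2" "1 \<le> \<bar>Im s\<bar>"
      then have g: "Re s \<le> g" by (auto simp: g_def closed_segment_eq_real_ivl split: if_splits)
      have "cmod (mellin_integrand F x s) \<le> C * \<bar>Im s\<bar> powr (- r) * exp (\<epsilon> * Re s)"
        unfolding norm_mellin_integrand[OF x] using C(3) g s by blast
      also have "\<dots> \<le> C * \<bar>Im s\<bar> powr (- r) * exp (\<epsilon> * g)" using C g by (intro mult_left_mono) auto
      finally show "cmod (mellin_integrand F x s) \<le> C * exp (\<epsilon> * g) * \<bar>Im s\<bar> powr (- r)" by (simp add: mult_ac)
    qed (use C in auto)
  qed
  from strip_decay_mellin_integrand[OF this, of "1 / x"] x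
  have "strip_decay (\<lambda>s. F s * of_real x powr (- s) * of_real (1 / x) powr (- s)) r" by simp
  moreover have "of_real x powr (- s) * of_real (1 / x) powr (- s) = 1" for s :: complex
  proof -
    have "Ln (of_real (1 / x)) = of_real (- ln x)" using Ln_of_real[of "1 / x"] x by (simp add: ln_div)
    then show ?thesis using x by (simp add: powr_def Ln_of_real mult_exp_exp del: of_real_divide)
  qed
  ultimately show ?thesis by (simp add: mult.assoc)
qed

definition vertical_integral :: "(complex \<Rightarrow> complex) \<Rightarrow> real \<Rightarrow> real \<Rightarrow> real \<Rightarrow> complex" where
  "vertical_integral F \<gamma> x N = 1 / (2 * of_real pi) * integral {- N..N} (\<lambda>t. mellin_integrand F x (Complex \<gamma> t))"

lemma contour_integral_vertical_line:
  assumes "N > 0"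
  shows "1 / (2 * of_real pi * \<i>) * contour_integral (vertical_line \<gamma> N N) (mellin_integrand F x) = vertical_integral F \<gamma> x N"
  using contour_integral_linepath_same_Re[of "Complex \<gamma> (- N)" \<gamma> "Complex \<gamma> N" "- N" N "mellin_integrand F x"] assms
  by (simp add: vertical_integral_def vertical_line_def)

text \<open>
  Every admissible contour has its own abscissa \<open>\<gamma>\<close>. At fixed \<open>\<gamma>\<close> all loops agree with the vertical
  line, and the vertical lines agree among each other, so that the value of the Fox-H function does not
  depend on the contour and is the limit of symmetric integrals along any vertical line.
\<close>

lemma fox_contours_common_value:
  assumes Bs: "Bs \<noteq> []" "valid_params Bs" and x: "x > 0" and r: "r > 0"
    and dec: "left_decay (fox_kernel As Bs) r x"
  obtains h where "\<exists>!h. has_fox_H As Bs x h" "has_fox_H As Bs x h"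
    "\<And>\<gamma>. fox_bound Bs < \<gamma> \<Longrightarrow> (\<lambda>n. vertical_integral (fox_kernel As Bs) \<gamma> x (real n)) \<longlonglongrightarrow> h"
    "\<And>\<gamma> C \<epsilon> N. fox_bound Bs < \<gamma> \<Longrightarrow> C > 0 \<Longrightarrow> \<epsilon> > 0 \<Longrightarrow> (\<And>s. Re s \<le> \<gamma> \<Longrightarrow> 1 \<le> \<bar>Im s\<bar> \<Longrightarrow>
         cmod (fox_kernel As Bs s) * x powr (- Re s) \<le> C * \<bar>Im s\<bar> powr (- r) * exp (\<epsilon> * Re s)) \<Longrightarrow> 1 \<le> N \<Longrightarrow>
       cmod (vertical_integral (fox_kernel As Bs) \<gamma> x N - h) \<le> C * exp (\<epsilon> * \<gamma>) / \<epsilon> * N powr (- r)"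
proof -
  let ?F = "at_top \<times>\<^sub>F at_top :: (real \<times> real) filter"
  let ?G = "mellin_integrand (fox_kernel As Bs) x"
  let ?k = "1 / (2 * of_real pi * \<i>) :: complex"
  have nonbot: "?F \<noteq> bot" by (simp add: prod_filter_eq_bot)
  have hol: "?G holomorphic_on {s. Im s \<noteq> 0 \<or> fox_bound Bs < Re s}"
    by (intro mellin_integrand_holomorphic fox_kernel_holomorphic Bs x)
  then have hol': "?G holomorphic_on {s. fox_bound Bs < Re s}" by (rule holomorphic_on_subset) auto
  have dec': "\<exists>C>0. \<exists>\<epsilon>>0. \<forall>s. Re s \<le> \<gamma> \<longrightarrow> \<delta> \<le> \<bar>Im s\<bar> \<longrightarrow>
                cmod (?G s) \<le> C * \<bar>Im s\<bar> powr (- r) * exp (\<epsilon> * Re s)" if "\<delta> > 0" for \<gamma> \<delta>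
    unfolding norm_mellin_integrand[OF x] using dec that unfolding left_decay_def by blast
  define P where "P = (\<lambda>\<gamma> v. ((\<lambda>(R, T). contour_integral (vertical_line \<gamma> R T) ?G) \<longlongrightarrow> v) ?F \<and>
    (\<forall>\<phi>1 \<phi>2. \<phi>1 < 0 \<longrightarrow> 0 < \<phi>2 \<longrightarrow> ((\<lambda>(R, T). contour_integral (left_loop \<gamma> \<phi>1 \<phi>2 R T) ?G) \<longlongrightarrow> v) ?F) \<and>
    (\<forall>C \<epsilon> N. C > 0 \<longrightarrow> \<epsilon> > 0 \<longrightarrow> (\<forall>s. Re s \<le> \<gamma> \<longrightarrow> 1 \<le> \<bar>Im s\<bar> \<longrightarrow>
         cmod (?G s) \<le> C * \<bar>Im s\<bar> powr (- r) * exp (\<epsilon> * Re s)) \<longrightarrow> 1 \<le> N \<longrightarrow>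
       cmod (contour_integral (vertical_line \<gamma> N N) ?G - v) \<le> 2 * (C * exp (\<epsilon> * \<gamma>) / \<epsilon>) * N powr (- r)))"
  have ex: "\<exists>v. P \<gamma> v" if "fox_bound Bs < \<gamma>" for \<gamma>
  proof (rule contour_limit_at[OF hol that r dec'[where \<gamma>=\<gamma>]], assumption, goal_cases)
    case (1 v)
    show ?case unfolding P_def
    proof (intro exI[of _ v] conjI allI impI)
      fix C \<epsilon> N :: real
      assume "C > 0" "\<epsilon> > 0" "\<forall>s. Re s \<le> \<gamma> \<longrightarrow> 1 \<le> \<bar>Im s\<bar> \<longrightarrow>
         cmod (?G s) \<le> C * \<bar>Im s\<bar> powr (- r) * exp (\<epsilon> * Re s)" "1 \<le> N"
      then show "cmod (contour_integral (vertical_line \<gamma> N N) ?G - v) \<le> 2 * (C * exp (\<epsilon> * \<gamma>) / \<epsilon>) * N powr (- r)"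
        by (intro 1(3)) auto
    qed (use 1(1,2) in auto)
  qed
  define V where "V = (\<lambda>\<gamma>. SOME v. P \<gamma> v)"
  have PV: "P \<gamma> (V \<gamma>)" if "fox_bound Bs < \<gamma>" for \<gamma>
    unfolding V_def using ex[OF that] by (rule someI_ex)
  have V: 
    "((\<lambda>(R, T). contour_integral (vertical_line \<gamma> R T) ?G) \<longlongrightarrow> V \<gamma>) ?F"
    "\<phi>1 < 0 \<Longrightarrow> 0 < \<phi>2 \<Longrightarrow> ((\<lambda>(R, T). contour_integral (left_loop \<gamma> \<phi>1 \<phi>2 R T) ?G) \<longlongrightarrow> V \<gamma>) ?F"
    "C > 0 \<Longrightarrow> \<epsilon> > 0 \<Longrightarrow> (\<And>s. Re s \<le> \<gamma> \<Longrightarrow> 1 \<le> \<bar>Im s\<bar> \<Longrightarrow>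
         cmod (?G s) \<le> C * \<bar>Im s\<bar> powr (- r) * exp (\<epsilon> * Re s)) \<Longrightarrow> 1 \<le> N \<Longrightarrow>
       cmod (contour_integral (vertical_line \<gamma> N N) ?G - V \<gamma>) \<le> 2 * (C * exp (\<epsilon> * \<gamma>) / \<epsilon>) * N powr (- r)"
    if "fox_bound Bs < \<gamma>" for \<gamma> \<phi>1 \<phi>2 C \<epsilon> N
    using PV[OF that] unfolding P_def by blast+
  obtain \<gamma>0 where \<gamma>0: "fox_bound Bs < \<gamma>0" using gt_ex by blast
  have V_const: "V \<gamma> = V \<gamma>0" if \<gamma>: "fox_bound Bs < \<gamma>" for \<gamma>
  proof -
    obtain C where C: "C > 0" "\<And>s. Re s \<in> closed_segment \<gamma> \<gamma>0 \<Longrightarrow> 1 \<le> \<bar>Im s\<bar> \<Longrightarrow> cmod (?G s) \<le> C * \<bar>Im s\<bar> powr (- r)"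
      using strip_decay_mellin_integrand[OF strip_decay_of_left_decay[OF dec x] x] unfolding strip_decay_def by metis
    have "((\<lambda>(R, T). contour_integral (vertical_line \<gamma> R T) ?G - contour_integral (vertical_line \<gamma>0 R T) ?G) \<longlongrightarrow> 0) ?F"
      by (rule vertical_shift[OF hol' \<gamma> \<gamma>0 r less_imp_le[OF C(1)] C(2)])
    moreover have "((\<lambda>(R, T). contour_integral (vertical_line \<gamma> R T) ?G - contour_integral (vertical_line \<gamma>0 R T) ?G) \<longlongrightarrow> V \<gamma> - V \<gamma>0) ?F"
      using tendsto_diff[OF V(1)[OF \<gamma>] V(1)[OF \<gamma>0]] by (simp add: case_prod_unfold)
    ultimately show ?thesis using tendsto_unique[OF nonbot] by fastforce
  qed
  define h where "h = ?k * V \<gamma>0"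
  have all: "((\<lambda>(R, T). ?k * contour_integral (L R T) ?G) \<longlongrightarrow> h) ?F" if L: "L \<in> fox_contours Bs" for L
  proof -
    have "((\<lambda>(R, T). contour_integral (L R T) ?G) \<longlongrightarrow> V \<gamma>0) ?F"
      using L V(1,2) V_const unfolding fox_contours_def fox_poles_less_iff[OF Bs] by auto
    from tendsto_mult_left[OF this, of ?k] show ?thesis by (simp add: h_def case_prod_unfold)
  qed
  have "vertical_line \<gamma>0 \<in> fox_contours Bs"
    using \<gamma>0 fox_poles_less_iff[OF Bs] by (auto simp: fox_contours_def)
  then have has: "has_fox_H As Bs x h" unfolding has_fox_H_def using all by blast
  have uniq: "h' = h" if "has_fox_H As Bs x h'" for h'
    using that all tendsto_unique[OF nonbot] unfolding has_fox_H_def by blast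
  show thesis
  proof (rule that)
    show "\<exists>!h. has_fox_H As Bs x h" using has uniq by blast
    show "has_fox_H As Bs x h" by fact
    fix \<gamma> assume \<gamma>: "fox_bound Bs < \<gamma>"
    have "vertical_line \<gamma> \<in> fox_contours Bs"
      using \<gamma> fox_poles_less_iff[OF Bs] by (auto simp: fox_contours_def)
    from all[OF this] have "((\<lambda>(R, T). ?k * contour_integral (vertical_line \<gamma> R T) ?G) \<longlongrightarrow> h) ?F" .
    moreover have "filterlim (\<lambda>n. (real n, real n)) ?F sequentially"
      by (intro filterlim_Pair filterlim_real_sequentially)
    ultimately have "(\<lambda>n. ?k * contour_integral (vertical_line \<gamma> (real n) (real n)) ?G) \<longlonglongrightarrow> h"
      by (auto dest: filterlim_compose)
    then show "(\<lambda>n. vertical_integral (fox_kernel As Bs) \<gamma> x (real n)) \<longlonglongrightarrow> h"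
      by (rule Lim_transform_eventually)
        (use eventually_gt_at_top[of 0] in eventually_elim, simp only: contour_integral_vertical_line of_nat_0_less_iff)
  next
    fix \<gamma> C \<epsilon> N :: real
    assume a: "fox_bound Bs < \<gamma>" "C > 0" "\<epsilon> > 0" "\<And>s. Re s \<le> \<gamma> \<Longrightarrow> 1 \<le> \<bar>Im s\<bar> \<Longrightarrow>
         cmod (fox_kernel As Bs s) * x powr (- Re s) \<le> C * \<bar>Im s\<bar> powr (- r) * exp (\<epsilon> * Re s)" and N: "1 \<le> N"
    have "cmod (contour_integral (vertical_line \<gamma> N N) ?G - V \<gamma>0) \<le> 2 * (C * exp (\<epsilon> * \<gamma>) / \<epsilon>) * N powr (- r)"
      using V(3)[OF a(1) a(2) a(3) a(4)[unfolded norm_mellin_integrand[OF x, symmetric]] N] V_const[OF a(1)] by simp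
    then have "cmod (?k * (contour_integral (vertical_line \<gamma> N N) ?G - V \<gamma>0)) \<le> 1 / (2 * pi) * (2 * (C * exp (\<epsilon> * \<gamma>) / \<epsilon>) * N powr (- r))"
      unfolding norm_mult by (intro mult_mono) (auto simp: norm_divide norm_mult)
    also have "\<dots> \<le> C * exp (\<epsilon> * \<gamma>) / \<epsilon> * N powr (- r)"
    proof -
      have "1 / pi * (C * exp (\<epsilon> * \<gamma>) / \<epsilon> * N powr (- r)) \<le> 1 * (C * exp (\<epsilon> * \<gamma>) / \<epsilon> * N powr (- r))"
        using a pi_ge_two by (intro mult_right_mono) auto
      then show ?thesis by simp
    qed
    finally show "cmod (vertical_integral (fox_kernel As Bs) \<gamma> x N - h) \<le> C * exp (\<epsilon> * \<gamma>) / \<epsilon> * N powr (- r)"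
      unfolding h_def right_diff_distrib using contour_integral_vertical_line[of N] N by simp
  qed
qed

section \<open>Functions with nonnegative damped Fourier transform\<close>

definition fourier :: "(real \<Rightarrow> complex) \<Rightarrow> real \<Rightarrow> complex" where
  "fourier \<phi> y = (LINT t|lborel. \<phi> t * cis (- (t * y)))"

text \<open>
  The Gaussian is used twice: as a damping factor that makes bounded functions integrable, and as a
  summability kernel in Fourier inversion.
\<close>

definition gauss :: "real \<Rightarrow> real \<Rightarrow> real" where
  "gauss k t = exp (- ((t / k)\<^sup>2) / 2)"

lemma cis_measurable [measurable]: "cis \<in> borel_measurable borel"
  by (intro borel_measurable_continuous_onI continuous_intros)

lemma gauss_measurable [measurable]: "gauss k \<in> borel_measurable borel"
  unfolding gauss_def[abs_def] by measurable

lemma gauss_pos [simp]: "gauss k t > 0" and gauss_le_1: "gauss k t \<le> 1"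
  by (simp_all add: gauss_def)

lemma gauss_nonneg [simp]: "0 \<le> gauss k t" by (simp add: less_imp_le)

lemma integrable_gauss:
  assumes "k > 0"
  shows "integrable lborel (gauss k)"
proof -
  have "integrable lborel (\<lambda>t. sqrt (2 * pi) * std_normal_density (0 + (1 / k) * t))"
    using assms by (intro integrable_mult_right lborel_integrable_real_affine integrable_normal_density) auto
  then show ?thesis by (simp add: std_normal_density_def gauss_def[abs_def])
qed

lemma integrable_bounded_mult:
  fixes f g :: "real \<Rightarrow> complex"
  assumes "integrable lborel f" "g \<in> borel_measurable borel" "\<And>t. cmod (g t) \<le> M"
  shows "integrable lborel (\<lambda>t. g t * f t)"
proof (rule Bochner_Integration.integrable_bound)
  show "integrable lborel (\<lambda>t. M * norm (f t))" using assms by auto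
  show "AE t in lborel. norm (g t * f t) \<le> norm (M * norm (f t))"
  proof (intro AE_I2)
    fix t
    have "norm (g t * f t) \<le> M * norm (f t)" unfolding norm_mult using assms by (intro mult_right_mono) auto
    then show "norm (g t * f t) \<le> norm (M * norm (f t))" by (metis abs_ge_self order_trans real_norm_def)
  qed
qed (use assms in measurable)

lemma integrable_cis_mult:
  assumes "integrable lborel f"
  shows "integrable lborel (\<lambda>t. f t * cis (- (t * y)))"
  using integrable_bounded_mult[OF assms, of "\<lambda>t. cis (- (t * y))" 1] by (simp add: mult.commute)

lemma fourier_gauss:
  assumes k: "k > 0"
  shows "fourier (\<lambda>t. of_real (gauss k t)) y = of_real (k * sqrt (2 * pi) * gauss 1 (k * y))"
proof -
  have "char std_normal_distribution u = (LINT x|lborel. std_normal_density x *\<^sub>R iexp (u * x))" for u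
    unfolding char_def by (subst integral_density) (auto simp: normal_density_nonneg)
  then have c: "(LINT x|lborel. std_normal_density x *\<^sub>R iexp (u * x)) = of_real (exp (- (u\<^sup>2) / 2))" for u
    by (simp add: char_std_normal_distribution)
  have "fourier (\<lambda>t. of_real (gauss k t)) y = k *\<^sub>R (LINT t|lborel. of_real (gauss k (0 + k * t)) * cis (- ((0 + k * t) * y)))"
    unfolding fourier_def using k by (subst lborel_integral_real_affine[where c=k and t=0]) auto
  also have "(LINT t|lborel. of_real (gauss k (0 + k * t)) * cis (- ((0 + k * t) * y)))
      = (LINT t|lborel. of_real (sqrt (2 * pi)) * (std_normal_density t *\<^sub>R iexp ((- (k * y)) * t)))"
    using k by (intro Bochner_Integration.integral_cong refl)
      (simp add: gauss_def std_normal_density_def cis_conv_exp scaleR_conv_of_real mult_ac)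
  also have "\<dots> = of_real (sqrt (2 * pi)) * of_real (exp (- ((- (k * y))\<^sup>2) / 2))"
    by (subst integral_mult_right_zero) (simp only: c)
  finally show ?thesis by (simp add: gauss_def scaleR_conv_of_real mult_ac)
qed

lemma integral_nonneg_Reals:
  fixes f :: "'a \<Rightarrow> complex"
  assumes "\<And>x. f x \<in> \<real>\<^sub>\<ge>\<^sub>0"
  shows "integral\<^sup>L M f \<in> \<real>\<^sub>\<ge>\<^sub>0"
proof -
  have "f = (\<lambda>x. of_real (Re (f x)))" using assms by (auto simp: complex_nonneg_Reals_iff complex_eq_iff)
  then have "integral\<^sup>L M f = of_real (integral\<^sup>L M (\<lambda>x. Re (f x)))"
    by (metis integral_complex_of_real)
  moreover have "0 \<le> integral\<^sup>L M (\<lambda>x. Re (f x))"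
    using assms by (intro integral_nonneg_AE) (auto simp: complex_nonneg_Reals_iff)
  ultimately show ?thesis by simp
qed

text \<open>
  An analytic form of being the characteristic function of a measure of mass at most \<open>M\<close>: up to a
  constant, the damped transform is the density of the convolution of that measure with a Gaussian.
  In this form stability under pointwise limits is dominated convergence.
\<close>

definition posdef :: "real \<Rightarrow> (real \<Rightarrow> complex) \<Rightarrow> bool" where
  "posdef M \<phi> \<longleftrightarrow> \<phi> \<in> borel_measurable borel \<and> (\<forall>t. cmod (\<phi> t) \<le> M) \<and>
     (\<forall>k>0. \<forall>y. fourier (\<lambda>t. \<phi> t * of_real (gauss k t)) y \<in> \<real>\<^sub>\<ge>\<^sub>0)"

lemma posdefD:
  assumes "posdef M \<phi>"
  shows "\<phi> \<in> borel_measurable borel" "cmod (\<phi> t) \<le> M" "k > 0 \<Longrightarrow> fourier (\<lambda>t. \<phi> t * of_real (gauss k t)) y \<in> \<real>\<^sub>\<ge>\<^sub>0"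
    "0 \<le> M"
  using assms order_trans[OF norm_ge_zero, of "\<phi> 0" M] unfolding posdef_def by auto

lemma posdef_integrable:
  assumes "posdef M \<phi>" "k > 0"
  shows "integrable lborel (\<lambda>t. \<phi> t * of_real (gauss k t))"
  using posdefD[OF assms(1)] integrable_gauss[OF assms(2)] by (intro integrable_bounded_mult[where M=M]) auto

lemma posdef_one: "posdef 1 (\<lambda>_. 1)"
  unfolding posdef_def by (auto simp: fourier_gauss)

lemma posdef_cis:
  assumes "posdef M \<phi>"
  shows "posdef M (\<lambda>t. \<phi> t * cis (t * c))"
  unfolding posdef_def
proof (intro conjI allI impI)
  show "(\<lambda>t. \<phi> t * cis (t * c)) \<in> borel_measurable borel" using posdefD(1)[OF assms] by measurable
  show "cmod (\<phi> t * cis (t * c)) \<le> M" for t using posdefD(2)[OF assms, of t] by (simp add: norm_mult)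
  fix k y :: real assume k: "k > 0"
  have "fourier (\<lambda>t. \<phi> t * cis (t * c) * of_real (gauss k t)) y = fourier (\<lambda>t. \<phi> t * of_real (gauss k t)) (y - c)"
    unfolding fourier_def by (intro Bochner_Integration.integral_cong refl) (simp add: mult_ac cis_mult algebra_simps)
  then show "fourier (\<lambda>t. \<phi> t * cis (t * c) * of_real (gauss k t)) y \<in> \<real>\<^sub>\<ge>\<^sub>0"
    using posdefD(3)[OF assms k] by simp
qed

lemma posdef_convex:
  assumes "posdef M \<phi>" "posdef M \<psi>" "0 \<le> p" "p \<le> 1"
  shows "posdef M (\<lambda>t. of_real p * \<phi> t + of_real (1 - p) * \<psi> t)"
  unfolding posdef_def
proof (intro conjI allI impI)
  show "(\<lambda>t. of_real p * \<phi> t + of_real (1 - p) * \<psi> t) \<in> borel_measurable borel"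
    using posdefD(1)[OF assms(1)] posdefD(1)[OF assms(2)] by measurable
  fix t
  have "cmod (of_real p * \<phi> t + of_real (1 - p) * \<psi> t) \<le> p * cmod (\<phi> t) + (1 - p) * cmod (\<psi> t)"
    using assms by (intro norm_triangle_le) (simp add: norm_mult del: of_real_diff)
  also have "\<dots> \<le> p * M + (1 - p) * M"
    using assms posdefD(2)[OF assms(1)] posdefD(2)[OF assms(2)] by (intro add_mono mult_left_mono) auto
  finally show "cmod (of_real p * \<phi> t + of_real (1 - p) * \<psi> t) \<le> M" by (simp add: algebra_simps)
next
  fix k y :: real assume k: "k > 0"
  have "fourier (\<lambda>t. (of_real p * \<phi> t + of_real (1 - p) * \<psi> t) * of_real (gauss k t)) y
    = (LINT t|lborel. of_real p * (\<phi> t * of_real (gauss k t) * cis (- (t * y))) + of_real (1 - p) * (\<psi> t * of_real (gauss k t) * cis (- (t * y))))"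
    unfolding fourier_def by (intro Bochner_Integration.integral_cong refl) (simp add: algebra_simps)
  also have "\<dots> = of_real p * fourier (\<lambda>t. \<phi> t * of_real (gauss k t)) y + of_real (1 - p) * fourier (\<lambda>t. \<psi> t * of_real (gauss k t)) y"
    unfolding fourier_def
      Bochner_Integration.integral_add[OF integrable_mult_right[OF integrable_cis_mult[OF posdef_integrable[OF assms(1) k]]]
        integrable_mult_right[OF integrable_cis_mult[OF posdef_integrable[OF assms(2) k]]]]
    by (simp only: integral_mult_right_zero)
  finally show "fourier (\<lambda>t. (of_real p * \<phi> t + of_real (1 - p) * \<psi> t) * of_real (gauss k t)) y \<in> \<real>\<^sub>\<ge>\<^sub>0"
    using posdefD(3)[OF assms(1) k, of y] posdefD(3)[OF assms(2) k, of y] assms(3,4)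
    by (simp del: of_real_diff)
qed

lemma posdef_limit:
  assumes "\<And>n. posdef M (\<phi> n)" "\<And>t. (\<lambda>n. \<phi> n t) \<longlonglongrightarrow> \<psi> t"
  shows "posdef M \<psi>"
  unfolding posdef_def
proof (intro conjI allI impI)
  show meas: "\<psi> \<in> borel_measurable borel"
    by (rule borel_measurable_LIMSEQ_metric[OF posdefD(1)[OF assms(1)] assms(2)])
  show "cmod (\<psi> t) \<le> M" for t
    by (rule tendsto_upperbound[OF tendsto_norm[OF assms(2)] always_eventually]) (simp_all add: posdefD(2)[OF assms(1)])
  fix k y :: real assume k: "k > 0"
  have "(\<lambda>n. fourier (\<lambda>t. \<phi> n t * of_real (gauss k t)) y) \<longlonglongrightarrow> fourier (\<lambda>t. \<psi> t * of_real (gauss k t)) y"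
    unfolding fourier_def
  proof (rule integral_dominated_convergence[where w="\<lambda>t. M * gauss k t"])
    show "(\<lambda>t. \<psi> t * of_real (gauss k t) * cis (- (t * y))) \<in> borel_measurable lborel" using meas by measurable
    show "(\<lambda>t. \<phi> n t * of_real (gauss k t) * cis (- (t * y))) \<in> borel_measurable lborel" for n
      using posdefD(1)[OF assms(1)] by measurable
    show "integrable lborel (\<lambda>t. M * gauss k t)" using integrable_gauss[OF k] by simp
    show "AE t in lborel. (\<lambda>n. \<phi> n t * of_real (gauss k t) * cis (- (t * y))) \<longlonglongrightarrow> \<psi> t * of_real (gauss k t) * cis (- (t * y))"
      by (intro AE_I2 tendsto_intros assms)
    show "AE t in lborel. cmod (\<phi> n t * of_real (gauss k t) * cis (- (t * y))) \<le> M * gauss k t" for n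
      using posdefD(2)[OF assms(1)] by (intro AE_I2) (simp add: norm_mult mult_right_mono)
  qed
  then show "fourier (\<lambda>t. \<psi> t * of_real (gauss k t)) y \<in> \<real>\<^sub>\<ge>\<^sub>0"
    by (rule closed_sequentially[OF closed_nonneg_Reals_complex posdefD(3)[OF assms(1) k]])
qed

text \<open>
  Multiplication by the transform of a nonnegative weight \<open>w\<close> averages the damped transforms over
  translates with weights \<open>w\<close>.
\<close>

lemma posdef_mix:
  fixes w :: "real \<Rightarrow> real"
  assumes \<phi>: "posdef M \<phi>" and w: "integrable lborel w" "\<And>v. 0 \<le> w v"
  shows "posdef (M * integral\<^sup>L lborel w) (\<lambda>t. \<phi> t * fourier (\<lambda>v. of_real (w v)) t)"
proof -
  have wm[measurable]: "w \<in> borel_measurable borel" using w(1) by auto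
  note m[measurable] = posdefD(1)[OF \<phi>]
  have wc: "integrable lborel (\<lambda>v. complex_of_real (w v))" using w by auto
  have fm[measurable]: "fourier (\<lambda>v. of_real (w v)) \<in> borel_measurable borel"
    unfolding fourier_def[abs_def] by measurable
  have bnd: "cmod (fourier (\<lambda>v. of_real (w v)) t) \<le> integral\<^sup>L lborel w" for t
  proof -
    have "cmod (fourier (\<lambda>v. of_real (w v)) t) \<le> (LINT v|lborel. cmod (of_real (w v) * cis (- (v * t))))"
      unfolding fourier_def by (rule integral_norm_bound)
    then show ?thesis using w by (simp add: norm_mult)
  qed
  show ?thesis unfolding posdef_def
  proof (intro conjI allI impI)
    show "(\<lambda>t. \<phi> t * fourier (\<lambda>v. of_real (w v)) t) \<in> borel_measurable borel" by measurable
    show "cmod (\<phi> t * fourier (\<lambda>v. of_real (w v)) t) \<le> M * integral\<^sup>L lborel w" for t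
      unfolding norm_mult by (intro mult_mono posdefD[OF \<phi>] bnd) auto
    fix k y :: real assume k: "k > 0"
    define f where "f = (\<lambda>t. \<phi> t * of_real (gauss k t))"
    have f: "integrable lborel f" unfolding f_def by (rule posdef_integrable[OF \<phi> k])
    note fmeas[measurable] = borel_measurable_integrable[OF f]
    have int: "integrable (lborel \<Otimes>\<^sub>M lborel) (\<lambda>(t, v). f t * of_real (w v) * cis (- (t * (y + v))))"
    proof (rule lborel_pair.Fubini_integrable)
      show "(\<lambda>(t, v). f t * of_real (w v) * cis (- (t * (y + v)))) \<in> borel_measurable (lborel \<Otimes>\<^sub>M lborel)" by measurable
      show "integrable lborel (\<lambda>t. LINT v|lborel. norm (case (t, v) of (t, v) \<Rightarrow> f t * of_real (w v) * cis (- (t * (y + v)))))"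
        using f w by (simp add: norm_mult)
      show "AE t in lborel. integrable lborel (\<lambda>v. case (t, v) of (t, v) \<Rightarrow> f t * of_real (w v) * cis (- (t * (y + v))))"
      proof (intro AE_I2, simp only: prod.case)
        fix t
        have "integrable lborel (\<lambda>v. (f t * cis (- (t * (y + v)))) * of_real (w v))"
          by (rule integrable_bounded_mult[OF wc, of _ "cmod (f t)"]) (auto simp: norm_mult)
        then show "integrable lborel (\<lambda>v. f t * of_real (w v) * cis (- (t * (y + v))))" by (simp add: mult_ac)
      qed
    qed
    have "fourier (\<lambda>t. \<phi> t * fourier (\<lambda>v. of_real (w v)) t * of_real (gauss k t)) y
       = (LINT t|lborel. LINT v|lborel. f t * of_real (w v) * cis (- (t * (y + v))))"
      unfolding fourier_def
    proof (intro Bochner_Integration.integral_cong refl)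
      fix t
      have "(LINT v|lborel. f t * of_real (w v) * cis (- (t * (y + v)))) = (LINT v|lborel. (f t * cis (- (t * y))) * (of_real (w v) * cis (- (v * t))))"
      proof (intro Bochner_Integration.integral_cong refl)
        fix v
        have "cis (- (t * (y + v))) = cis (- (t * y)) * cis (- (v * t))" by (simp add: cis_mult algebra_simps)
        then show "f t * of_real (w v) * cis (- (t * (y + v))) = (f t * cis (- (t * y))) * (of_real (w v) * cis (- (v * t)))"
          by (simp add: mult_ac)
      qed
      also have "\<dots> = (f t * cis (- (t * y))) * (LINT v|lborel. of_real (w v) * cis (- (v * t)))"
        by (rule integral_mult_right_zero)
      finally have eq: "(LINT v|lborel. f t * of_real (w v) * cis (- (t * (y + v)))) = \<dots>" .
      show "\<phi> t * (LINT v|lborel. of_real (w v) * cis (- (v * t))) * of_real (gauss k t) * cis (- (t * y))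
          = (LINT v|lborel. f t * of_real (w v) * cis (- (t * (y + v))))"
        unfolding eq by (simp add: f_def mult_ac)
    qed
    also have "\<dots> = (LINT v|lborel. LINT t|lborel. f t * of_real (w v) * cis (- (t * (y + v))))"
      using lborel_pair.Fubini_integral[OF int] by simp
    also have "\<dots> = (LINT v|lborel. of_real (w v) * fourier f (y + v))"
      unfolding fourier_def
    proof (intro Bochner_Integration.integral_cong refl)
      fix v
      have "(LINT t|lborel. f t * of_real (w v) * cis (- (t * (y + v)))) = (LINT t|lborel. of_real (w v) * (f t * cis (- (t * (y + v)))))"
        by (simp add: mult_ac)
      then show "(LINT t|lborel. f t * of_real (w v) * cis (- (t * (y + v)))) = of_real (w v) * (LINT t|lborel. f t * cis (- (t * (y + v))))"
        by simp
    qed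
    also have "\<dots> \<in> \<real>\<^sub>\<ge>\<^sub>0"
      using posdefD(3)[OF \<phi> k] w(2) by (intro integral_nonneg_Reals nonneg_Reals_mult_I) (auto simp: f_def)
    finally show "fourier (\<lambda>t. \<phi> t * fourier (\<lambda>v. of_real (w v)) t * of_real (gauss k t)) y \<in> \<real>\<^sub>\<ge>\<^sub>0" .
  qed
qed

lemma gauss_tendsto_1: "(\<lambda>n. gauss (real (Suc n)) t) \<longlonglongrightarrow> 1"
proof -
  have "(\<lambda>n. exp (- ((t * inverse (real (Suc n)))\<^sup>2) / 2)) \<longlonglongrightarrow> exp (- ((t * 0)\<^sup>2) / 2)"
    by (intro tendsto_intros LIMSEQ_inverse_real_of_nat) simp
  moreover have "gauss (real (Suc n)) t = exp (- ((t * inverse (real (Suc n)))\<^sup>2) / 2)" for n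
    by (simp only: gauss_def divide_inverse)
  moreover have "exp (- ((t * 0)\<^sup>2) / 2) = 1" by simp
  ultimately show ?thesis by (simp only:)
qed

lemma posdef_fourier_nonneg:
  assumes \<phi>: "posdef M \<phi>" and int: "integrable lborel \<phi>"
  shows "fourier \<phi> y \<in> \<real>\<^sub>\<ge>\<^sub>0"
proof -
  have "(\<lambda>n. fourier (\<lambda>t. \<phi> t * of_real (gauss (real (Suc n)) t)) y) \<longlonglongrightarrow> fourier \<phi> y"
    unfolding fourier_def
  proof (rule integral_dominated_convergence[where w="\<lambda>t. cmod (\<phi> t)"])
    note posdefD(1)[OF \<phi>, measurable]
    show "(\<lambda>t. \<phi> t * cis (- (t * y))) \<in> borel_measurable lborel" by measurable
    show "(\<lambda>t. \<phi> t * of_real (gauss (real (Suc n)) t) * cis (- (t * y))) \<in> borel_measurable lborel" for n by measurable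
    show "integrable lborel (\<lambda>t. cmod (\<phi> t))" using int by auto
    show "AE t in lborel. (\<lambda>n. \<phi> t * of_real (gauss (real (Suc n)) t) * cis (- (t * y))) \<longlonglongrightarrow> \<phi> t * cis (- (t * y))"
    proof (intro AE_I2)
      fix t :: real
      have "(\<lambda>n. \<phi> t * of_real (gauss (real (Suc n)) t) * cis (- (t * y))) \<longlonglongrightarrow> \<phi> t * of_real 1 * cis (- (t * y))"
        by (intro tendsto_intros gauss_tendsto_1)
      then show "(\<lambda>n. \<phi> t * of_real (gauss (real (Suc n)) t) * cis (- (t * y))) \<longlonglongrightarrow> \<phi> t * cis (- (t * y))" by simp
    qed
    show "AE t in lborel. cmod (\<phi> t * of_real (gauss (real (Suc n)) t) * cis (- (t * y))) \<le> cmod (\<phi> t)" for n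
      using gauss_le_1 by (intro AE_I2) (simp add: norm_mult mult_left_le)
  qed
  from closed_sequentially[OF closed_nonneg_Reals_complex _ this] posdefD(3)[OF \<phi>]
  show ?thesis by (metis of_nat_0_less_iff zero_less_Suc)
qed

definition exponential_weight :: "real \<Rightarrow> real \<Rightarrow> real" where
  "exponential_weight a v = indicator {0<..} v * (a * exp (- (v * a)))"

lemma exponential_weight:
  assumes a: "a > 0"
  shows "integrable lborel (exponential_weight a)" "0 \<le> exponential_weight a v"
    "integral\<^sup>L lborel (exponential_weight a) = 1"
    "fourier (\<lambda>v. of_real (exponential_weight a v)) t = of_real a / (of_real a + \<i> * of_real t)"
proof -
  show nonneg: "0 \<le> exponential_weight a v" for v using a by (simp add: exponential_weight_def)
  have int: "set_integrable lborel {0<..} (\<lambda>v. a * exp (- (v * a)))"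
    using integrable_I0i_exp_mscale[OF a] by (intro set_integrable_mult_right)
  then show i: "integrable lborel (exponential_weight a)"
    by (simp add: set_integrable_def exponential_weight_def[abs_def])
  have fou: "fourier (\<lambda>v. of_real (exponential_weight a v)) t = of_real a / (of_real a + \<i> * of_real t)" for t
  proof -
    let ?c = "of_real a + \<i> * of_real t :: complex"
    have c0: "?c \<noteq> 0" using a by (auto simp: complex_eq_iff)
    define f where "f = (\<lambda>v::real. of_real a * exp (- (of_real v * ?c)))"
    define F where "F = (\<lambda>v::real. - of_real a / ?c * exp (- (of_real v * ?c)))"
    have normexp: "cmod (exp (- (of_real v * ?c))) = exp (- (v * a))" for v :: real by simp
    have "(LBINT v=0..\<infinity>. f v) = 0 - (- of_real a / ?c)"
    proof (rule interval_integral_FTC_integrable)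
      show "(F has_vector_derivative f v) (at v)" for v
      proof -
        have D: "((\<lambda>u. - of_real a / c * exp (- (u * c))) has_field_derivative of_real a * exp (- (of_real v * c))) (at (of_real v))"
          if "c \<noteq> 0" for c :: complex
          using that by (auto intro!: derivative_eq_intros)
        show ?thesis unfolding F_def f_def by (rule has_vector_derivative_real_field[OF D[OF c0]])
      qed
      show "isCont f v" for v unfolding f_def by (intro continuous_intros)
      show "set_integrable lborel (einterval 0 \<infinity>) f"
      proof -
        have "set_integrable lborel {0<..} f"
          by (rule set_integrable_bound[OF int]) (auto simp: f_def set_borel_measurable_def norm_mult normexp)
        then show ?thesis by (simp add: zero_ereal_def)
      qed
      have "(F \<longlongrightarrow> F 0) (at_right 0)" unfolding F_def by (intro tendsto_intros)
      then show "((F \<circ> real_of_ereal) \<longlongrightarrow> - of_real a / ?c) (at_right 0)"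
        by (simp add: zero_ereal_def ereal_tendsto_simps F_def)
      have "((\<lambda>v. cmod (of_real a / ?c) * exp (- (v * a))) \<longlongrightarrow> cmod (of_real a / ?c) * 0) at_top"
      proof -
        have "((\<lambda>v. exp (- (v * a))) \<longlongrightarrow> 0) at_top" using a by real_asymp
        then show ?thesis by (intro tendsto_intros)
      qed
      then have "((\<lambda>v. norm (F v)) \<longlongrightarrow> 0) at_top"
        by (simp add: F_def norm_mult norm_divide normexp)
      then show "((F \<circ> real_of_ereal) \<longlongrightarrow> 0) (at_left \<infinity>)"
        by (simp add: ereal_tendsto_simps tendsto_norm_zero_iff)
    qed auto
    moreover have "(LBINT v=0..\<infinity>. f v) = fourier (\<lambda>v. of_real (exponential_weight a v)) t"
      unfolding zero_ereal_def interval_integral_to_infinity_eq fourier_def set_lebesgue_integral_def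
      by (intro Bochner_Integration.integral_cong refl)
        (auto simp: exponential_weight_def f_def indicator_def cis_conv_exp mult_exp_exp exp_of_real[symmetric] algebra_simps)
    ultimately show ?thesis by simp
  qed
  then show "fourier (\<lambda>v. of_real (exponential_weight a v)) t = of_real a / (of_real a + \<i> * of_real t)" .
  have "complex_of_real (integral\<^sup>L lborel (exponential_weight a)) = fourier (\<lambda>v. of_real (exponential_weight a v)) 0"
    by (simp add: fourier_def)
  then have "complex_of_real (integral\<^sup>L lborel (exponential_weight a)) = 1" using a by (simp add: fou)
  then show "integral\<^sup>L lborel (exponential_weight a) = 1" by (simp only: of_real_eq_1_iff)
qed

lemma posdef_exponential_mixture:
  assumes \<phi>: "posdef M \<phi>" and a: "a > 0" and p: "0 \<le> p" "p \<le> 1"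
  shows "posdef M (\<lambda>t. \<phi> t * (of_real p + of_real (1 - p) * (of_real a / (of_real a + \<i> * of_real t))))"
  using posdef_convex[OF \<phi> posdef_mix[OF \<phi> exponential_weight(1,2)[OF a], simplified exponential_weight(3)[OF a] mult_1_right] p]
  by (simp add: exponential_weight(4)[OF a] algebra_simps del: of_real_diff)

text \<open>
  The elementary factor: \<open>z/(z + i\<eta>t) \<cdot> (w + i\<zeta>t)/w = p + (1 - p) z/(z + i\<eta>t)\<close> with
  \<open>p = \<zeta>z/(\<eta>w)\<close>. It is the transform of a mixture of a point mass and an exponential law
  exactly when \<open>p\<close> lies in \<open>[0, 1]\<close>.
\<close>

lemma posdef_linear_ratio:
  assumes \<phi>: "posdef M \<phi>" and z: "z > 0" and w: "w > 0" and \<eta>: "\<eta> > 0" and \<zeta>: "0 \<le> \<zeta>" "\<zeta> * z \<le> \<eta> * w"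
  shows "posdef M (\<lambda>t. \<phi> t * (of_real z / (of_real z + \<i> * of_real (\<eta> * t)) * ((of_real w + \<i> * of_real (\<zeta> * t)) / of_real w)))"
proof -
  \<comment> \<open>The weight of the point mass.\<close>
  define p where "p = \<zeta> * z / (\<eta> * w)"
  have p: "0 \<le> p" "p \<le> 1" using assms by (auto simp: p_def)
  have "of_real p + of_real (1 - p) * (of_real (z / \<eta>) / (of_real (z / \<eta>) + \<i> * of_real t))
    = of_real z / (of_real z + \<i> * of_real (\<eta> * t)) * ((of_real w + \<i> * of_real (\<zeta> * t)) / of_real w)" for t :: real
  proof -
    have nz: "of_real z + \<i> * of_real (\<eta> * t) \<noteq> 0" using z by (auto simp: complex_eq_iff)
    have 1: "of_real (z / \<eta>) / (of_real (z / \<eta>) + \<i> * of_real t) = of_real z / (of_real z + \<i> * of_real (\<eta> * t))"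
      using \<eta> by (simp add: divide_simps) (simp add: algebra_simps)?
    have 2: "of_real p * (of_real \<eta> * of_real w) = (of_real \<zeta> * of_real z :: complex)"
      using \<eta> w by (simp add: p_def)
    have "of_real w * of_real p * (of_real z + \<i> * of_real (\<eta> * t)) + of_real w * of_real (1 - p) * of_real z
        = of_real z * of_real w + \<i> * of_real t * (of_real p * (of_real \<eta> * of_real w))"
      by (simp add: algebra_simps)
    also have "\<dots> = of_real z * (of_real w + \<i> * of_real (\<zeta> * t))"
      unfolding 2 by (simp add: algebra_simps)
    finally have 3: "of_real w * of_real p * (of_real z + \<i> * of_real (\<eta> * t)) + of_real w * of_real (1 - p) * of_real z
        = of_real z * (of_real w + \<i> * of_real (\<zeta> * t))" .
    have "of_real p + of_real (1 - p) * (of_real z / (of_real z + \<i> * of_real (\<eta> * t)))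
        = (of_real w * of_real p * (of_real z + \<i> * of_real (\<eta> * t)) + of_real w * of_real (1 - p) * of_real z) /
          (of_real w * (of_real z + \<i> * of_real (\<eta> * t)))"
      using nz w by (simp add: add_divide_distrib del: of_real_diff of_real_mult)
    then show ?thesis unfolding 1 3 by (simp add: mult_ac)
  qed
  then show ?thesis using posdef_exponential_mixture[OF \<phi> _ p, of "z / \<eta>"] z \<eta> by simp
qed

text \<open>
  Gauss's product writes the quotient as a limit of elementary factors with parameters \<open>z + k\<close>, \<open>w + k\<close>,
  times a character \<open>n\<^sup>i\<^sup>(\<^sup>\<eta>\<^sup>-\<^sup>\<zeta>\<^sup>)\<^sup>t\<close> that only translates. The conditions on \<open>\<zeta>\<close> place all
  the weights \<open>p\<close> in \<open>[0, 1]\<close>. The case \<open>\<zeta> = 0\<close> is a power of a gamma variable, \<open>\<zeta> = \<eta>\<close> a power of a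
  beta variable, and \<open>\<zeta> = \<beta>\<eta>\<close>, \<open>w = 1 - \<beta> + \<beta>z\<close> a power of a variable with
  density proportional to \<open>y\<^sup>z\<^sup>-\<^sup>1 M\<^sub>\<beta>(y)\<close>, where \<open>M\<^sub>\<beta>\<close> is the M-Wright function.
\<close>

lemma posdef_Gamma_ratio:
  assumes \<phi>: "posdef M \<phi>" and z: "z > 0" and w: "w > 0" and \<eta>: "\<eta> > 0" and \<zeta>: "0 \<le> \<zeta>" "\<zeta> \<le> \<eta>" "\<zeta> * z \<le> \<eta> * w"
  shows "posdef M (\<lambda>t. \<phi> t * (Gamma (of_real z + \<i> * of_real (\<eta> * t)) / Gamma (of_real z) *
            (Gamma (of_real w) / Gamma (of_real w + \<i> * of_real (\<zeta> * t)))))"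
proof (rule posdef_limit)
  \<comment> \<open>The \<open>k\<close>-th factor of Gauss's product.\<close>
  define q where "q = (\<lambda>k t. of_real (z + real k) / (of_real (z + real k) + \<i> * of_real (\<eta> * t)) *
     ((of_real (w + real k) + \<i> * of_real (\<zeta> * t)) / of_real (w + real k)))"
  have "posdef M (\<lambda>t. \<phi> t * (\<Prod>k<n. q k t))" for n
  proof (induction n)
    case (Suc n)
    have le: "\<zeta> * (z + real n) \<le> \<eta> * (w + real n)"
      using \<zeta> mult_right_mono[of \<zeta> \<eta> "real n"] by (simp add: algebra_simps)
    show ?case using posdef_linear_ratio[OF Suc, of "z + real n" "w + real n" \<eta> \<zeta>] z w \<eta> \<zeta>(1) le
      by (simp add: q_def mult_ac del: of_real_mult of_real_add)
  qed (use \<phi> in simp)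
  then show "posdef M (\<lambda>t. \<phi> t * (\<Prod>k<Suc n. q k t) * cis (t * ((\<eta> - \<zeta>) * ln (real n))))" for n
    by (rule posdef_cis)
  fix t :: real
  let ?Z = "of_real z + \<i> * of_real (\<eta> * t) :: complex" and ?W = "of_real w + \<i> * of_real (\<zeta> * t) :: complex"
  have nonpos: "u \<notin> \<int>\<^sub>\<le>\<^sub>0" if "Re u > 0" for u :: complex using that by (auto elim!: nonpos_Ints_cases)
  have nz: "Gamma (of_real z :: complex) \<noteq> 0" "Gamma ?W \<noteq> 0" 
    using z w nonpos[of "of_real z"] nonpos[of ?W] by (simp_all add: Gamma_eq_zero_iff)
  have "(\<lambda>n. \<phi> t * (Gamma_series ?Z n / Gamma_series (of_real z) n * (Gamma_series (of_real w) n / Gamma_series ?W n)))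
     \<longlonglongrightarrow> \<phi> t * (Gamma ?Z / Gamma (of_real z) * (Gamma (of_real w) / Gamma ?W))"
    by (intro tendsto_intros Gamma_series_LIMSEQ nz)
  moreover have "\<phi> t * (Gamma_series ?Z n / Gamma_series (of_real z) n * (Gamma_series (of_real w) n / Gamma_series ?W n)) =
      \<phi> t * (\<Prod>k<Suc n. q k t) * cis (t * ((\<eta> - \<zeta>) * ln (real n)))" for n
  proof -
    have poch: "pochhammer u (n + 1) = (\<Prod>k<Suc n. u + of_nat k)" for u :: complex
      by (simp add: pochhammer_prod lessThan_atLeast0)
    have pnz: "pochhammer u (n + 1) \<noteq> 0" if "Re u > 0" for u :: complex
      using nonpos[OF that] pochhammer_eq_0_imp_nonpos_Int by blast
    let ?L = "of_real (ln (real n)) :: complex"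
    have "Gamma_series ?Z n / Gamma_series (of_real z) n * (Gamma_series (of_real w) n / Gamma_series ?W n)
      = (exp (?Z * ?L) / exp (of_real z * ?L) * (exp (of_real w * ?L) / exp (?W * ?L))) *
        (pochhammer (of_real z) (n + 1) / pochhammer ?Z (n + 1) * (pochhammer ?W (n + 1) / pochhammer (of_real w) (n + 1)))"
      using pnz[of ?Z] pnz[of ?W] pnz[of "of_real z"] pnz[of "of_real w"] z w unfolding Gamma_series_def by (simp add: mult_ac)
    also have "exp (?Z * ?L) / exp (of_real z * ?L) * (exp (of_real w * ?L) / exp (?W * ?L)) = cis (t * ((\<eta> - \<zeta>) * ln (real n)))"
      by (simp add: cis_conv_exp exp_diff[symmetric] mult_exp_exp algebra_simps)
    also have "pochhammer (of_real z) (n + 1) / pochhammer ?Z (n + 1) * (pochhammer ?W (n + 1) / pochhammer (of_real w) (n + 1)) = (\<Prod>k<Suc n. q k t)"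
      unfolding poch q_def prod_dividef[symmetric] prod.distrib[symmetric]
      by (intro prod.cong refl) (simp add: add_ac)
    finally show ?thesis by (simp add: mult_ac)
  qed
  ultimately show "(\<lambda>n. \<phi> t * (\<Prod>k<Suc n. q k t) * cis (t * ((\<eta> - \<zeta>) * ln (real n))))
     \<longlonglongrightarrow> \<phi> t * (Gamma ?Z / Gamma (of_real z) * (Gamma (of_real w) / Gamma ?W))" by simp
qed

section \<open>Fourier inversion at the origin and moments\<close>

lemma SUP_nn_integral_incseq:
  fixes f :: "'a \<Rightarrow> ennreal"
  assumes f: "f \<in> borel_measurable M" and A: "\<And>n. A n \<in> sets M" "incseq A"
  shows "(SUP n::nat. \<integral>\<^sup>+x. f x * indicator (A n) x \<partial>M) = (\<integral>\<^sup>+x. f x * indicator (\<Union>n. A n) x \<partial>M)"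
proof -
  have "(SUP n. emeasure (density M f) (A n)) = emeasure (density M f) (\<Union>n. A n)"
    using A by (intro SUP_emeasure_incseq) auto
  moreover have "emeasure (density M f) B = (\<integral>\<^sup>+x. f x * indicator B x \<partial>M)" if "B \<in> sets M" for B
    using f that by (rule emeasure_density)
  ultimately show ?thesis using A(1) by simp
qed

lemma nn_integral_exp_substitution:
  fixes f :: "real \<Rightarrow> ennreal"
  assumes f[measurable]: "f \<in> borel_measurable borel"
  shows "(\<integral>\<^sup>+x. f x * indicator {0<..} x \<partial>lborel) = (\<integral>\<^sup>+y. f (exp y) * ennreal (exp y) \<partial>lborel)"
proof -
  define N where "N = (\<lambda>n::nat. real (Suc n))"
  have U1: "(\<Union>n. {exp (- N n)..exp (N n)}) = {0<..}"
  proof safe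
    fix x :: real assume x: "0 < x"
    obtain n where "\<bar>ln x\<bar> \<le> real n" using real_arch_simple by blast
    then have "- N n \<le> ln x" "ln x \<le> N n" by (auto simp: N_def)
    then have "exp (- N n) \<le> exp (ln x)" "exp (ln x) \<le> exp (N n)" by (simp_all only: exp_le_cancel_iff)
    then show "x \<in> (\<Union>n. {exp (- N n)..exp (N n)})" using x by auto
  qed (auto intro: less_le_trans[OF exp_gt_zero])
  have U2: "(\<Union>n. {- N n..N n}) = UNIV"
  proof safe
    fix x :: real
    obtain n where "\<bar>x\<bar> \<le> real n" using real_arch_simple by blast
    then have "x \<in> {- N n..N n}" by (auto simp: N_def)
    then show "x \<in> (\<Union>n. {- N n..N n})" by blast
  qed auto
  have "(\<integral>\<^sup>+x. f x * indicator {0<..} x \<partial>lborel) = (SUP n. \<integral>\<^sup>+x. f x * indicator {exp (- N n)..exp (N n)} x \<partial>lborel)"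
    unfolding U1[symmetric] by (rule SUP_nn_integral_incseq[symmetric]) (auto simp: N_def incseq_def)
  also have "\<dots> = (SUP n. \<integral>\<^sup>+y. f (exp y) * ennreal (exp y) * indicator {- N n..N n} y \<partial>lborel)"
  proof (intro SUP_cong refl)
    fix n
    show "(\<integral>\<^sup>+x. f x * indicator {exp (- N n)..exp (N n)} x \<partial>lborel) = (\<integral>\<^sup>+y. f (exp y) * ennreal (exp y) * indicator {- N n..N n} y \<partial>lborel)"
      by (rule nn_integral_substitution_aux) (auto intro!: derivative_eq_intros continuous_intros simp: N_def)
  qed
  also have "\<dots> = (\<integral>\<^sup>+y. f (exp y) * ennreal (exp y) * indicator UNIV y \<partial>lborel)"
    unfolding U2[symmetric] by (rule SUP_nn_integral_incseq) (auto simp: N_def incseq_def)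
  finally show ?thesis by simp
qed

lemma fourier_measurable:
  assumes [measurable]: "f \<in> borel_measurable borel"
  shows "fourier f \<in> borel_measurable borel"
  unfolding fourier_def[abs_def] by measurable

lemma norm_fourier_le: "cmod (fourier f y) \<le> (LINT t|lborel. cmod (f t))"
proof -
  have "cmod (fourier f y) \<le> (LINT t|lborel. cmod (f t * cis (- (t * y))))"
    unfolding fourier_def by (rule integral_norm_bound)
  then show ?thesis by (simp add: norm_mult)
qed

lemma fourier_exchange:
  assumes f: "integrable lborel f" and g: "integrable lborel g"
  shows "(LINT y|lborel. g y * fourier f y) = (LINT t|lborel. f t * fourier g t)"
proof -
  have [measurable]: "f \<in> borel_measurable borel" "g \<in> borel_measurable borel" using f g by auto
  have int: "integrable (lborel \<Otimes>\<^sub>M lborel) (\<lambda>(t, y). f t * (g y * cis (- (t * y))))"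
  proof (rule lborel_pair.Fubini_integrable)
    show "(\<lambda>(t, y). f t * (g y * cis (- (t * y)))) \<in> borel_measurable (lborel \<Otimes>\<^sub>M lborel)" by measurable
    show "integrable lborel (\<lambda>t. LINT y|lborel. norm (case (t, y) of (t, y) \<Rightarrow> f t * (g y * cis (- (t * y)))))"
      using f g by (simp add: norm_mult)
    show "AE t in lborel. integrable lborel (\<lambda>y. case (t, y) of (t, y) \<Rightarrow> f t * (g y * cis (- (t * y))))"
      using integrable_cis_mult[OF g] by (intro AE_I2) (simp add: mult.commute)
  qed
  have "(LINT y|lborel. g y * fourier f y) = (LINT y|lborel. LINT t|lborel. f t * (g y * cis (- (t * y))))"
  proof (intro Bochner_Integration.integral_cong refl)
    fix y
    have "(LINT t|lborel. f t * (g y * cis (- (t * y)))) = (LINT t|lborel. g y * (f t * cis (- (t * y))))"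
      by (simp only: mult.left_commute)
    then show "g y * fourier f y = (LINT t|lborel. f t * (g y * cis (- (t * y))))"
      unfolding fourier_def by simp
  qed
  also have "\<dots> = (LINT t|lborel. LINT y|lborel. f t * (g y * cis (- (t * y))))"
    using lborel_pair.Fubini_integral[OF int] by simp
  also have "\<dots> = (LINT t|lborel. f t * fourier g t)"
    unfolding fourier_def by (simp add: mult.commute)
  finally show ?thesis .
qed

text \<open>
  Fubini moves the transform to the Gaussian, which turns into an approximate identity.
\<close>

lemma fourier_gauss_approximation:
  assumes \<phi>: "integrable lborel \<phi>" "isCont \<phi> 0" "\<And>t. cmod (\<phi> t) \<le> B"
  shows "(\<lambda>n. LINT y|lborel. of_real (gauss (real (Suc n)) y) * fourier \<phi> y) \<longlonglongrightarrow> of_real (2 * pi) * \<phi> 0"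
proof -
  have [measurable]: "\<phi> \<in> borel_measurable borel" using \<phi>(1) by auto
  have "(LINT y|lborel. of_real (gauss (real (Suc n)) y) * fourier \<phi> y)
    = of_real (sqrt (2 * pi)) * (LINT \<tau>|lborel. \<phi> (\<tau> * inverse (real (Suc n))) * of_real (gauss 1 \<tau>))" for n
  proof -
    define k where "k = real (Suc n)"
    have k: "k > 0" by (simp add: k_def)
    have gi: "integrable lborel (\<lambda>y. complex_of_real (gauss k y))" using integrable_gauss[OF k] by auto
    have "(LINT y|lborel. of_real (gauss k y) * fourier \<phi> y) = (LINT t|lborel. \<phi> t * of_real (k * sqrt (2 * pi) * gauss 1 (k * t)))"
      using fourier_exchange[OF \<phi>(1) gi] by (simp add: fourier_gauss[OF k])
    also have "\<dots> = \<bar>1 / k\<bar> *\<^sub>R (LINT t|lborel. \<phi> (0 + 1 / k * t) * of_real (k * sqrt (2 * pi) * gauss 1 (k * (0 + 1 / k * t))))"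
      using k by (intro lborel_integral_real_affine) simp
    also have "\<dots> = of_real (1 / k) * (LINT t|lborel. of_real (k * sqrt (2 * pi)) * (\<phi> (t * inverse k) * of_real (gauss 1 t)))"
      using k by (simp add: scaleR_conv_of_real divide_inverse mult_ac)
    also have "\<dots> = of_real (sqrt (2 * pi)) * (LINT t|lborel. \<phi> (t * inverse k) * of_real (gauss 1 t))"
      unfolding integral_mult_right_zero using k by simp
    finally show ?thesis by (simp add: k_def)
  qed
  moreover have "(\<lambda>n. LINT \<tau>|lborel. \<phi> (\<tau> * inverse (real (Suc n))) * of_real (gauss 1 \<tau>)) \<longlonglongrightarrow> (LINT \<tau>|lborel. \<phi> 0 * of_real (gauss 1 \<tau>))"
  proof (rule integral_dominated_convergence[where w="\<lambda>t. B * gauss 1 t"])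
    show "integrable lborel (\<lambda>t. B * gauss 1 t)" using integrable_gauss[of 1] by simp
    show "AE t in lborel. (\<lambda>n. \<phi> (t * inverse (real (Suc n))) * of_real (gauss 1 t)) \<longlonglongrightarrow> \<phi> 0 * of_real (gauss 1 t)"
    proof (intro AE_I2)
      fix t :: real
      have "(\<lambda>n. t * inverse (real (Suc n))) \<longlonglongrightarrow> t * 0" by (intro tendsto_intros LIMSEQ_inverse_real_of_nat)
      then have "(\<lambda>n. \<phi> (t * inverse (real (Suc n)))) \<longlonglongrightarrow> \<phi> 0"
        using isCont_tendsto_compose[OF \<phi>(2)] by simp
      then show "(\<lambda>n. \<phi> (t * inverse (real (Suc n))) * of_real (gauss 1 t)) \<longlonglongrightarrow> \<phi> 0 * of_real (gauss 1 t)"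
        by (intro tendsto_intros)
    qed
    show "AE t in lborel. cmod (\<phi> (t * inverse (real (Suc n))) * of_real (gauss 1 t)) \<le> B * gauss 1 t" for n
      using \<phi>(3) by (intro AE_I2) (simp add: norm_mult mult_right_mono)
  qed measurable
  moreover have "(LINT \<tau>|lborel. \<phi> 0 * of_real (gauss 1 \<tau>)) = \<phi> 0 * of_real (sqrt (2 * pi))"
    using fourier_gauss[of 1 0] by (simp add: fourier_def gauss_def)
  ultimately have "(\<lambda>n. LINT y|lborel. of_real (gauss (real (Suc n)) y) * fourier \<phi> y) \<longlonglongrightarrow>
      of_real (sqrt (2 * pi)) * (\<phi> 0 * of_real (sqrt (2 * pi)))"
    by (simp only: tendsto_mult_left)
  then show ?thesis by (simp add: mult_ac flip: of_real_mult)
qed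

text \<open>
  Fourier inversion at \<open>0\<close>. As the transform is nonnegative, its Gaussian means increase to its
  integral, which yields integrability of the transform along the way.
\<close>

lemma fourier_total_mass:
  assumes \<phi>: "integrable lborel \<phi>" "isCont \<phi> 0" "\<And>t. cmod (\<phi> t) \<le> B"
    and nonneg: "\<And>y. fourier \<phi> y \<in> \<real>\<^sub>\<ge>\<^sub>0"
  shows "(\<integral>\<^sup>+y. ennreal (Re (fourier \<phi> y) / (2 * pi)) \<partial>lborel) = ennreal (Re (\<phi> 0))"
proof -
  have [measurable]: "\<phi> \<in> borel_measurable borel" using \<phi>(1) by auto
  note fourier_measurable[measurable]
  define u where "u = (\<lambda>y. Re (fourier \<phi> y) / (2 * pi))"
  have um[measurable]: "u \<in> borel_measurable borel" unfolding u_def by measurable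
  have u: "fourier \<phi> y = of_real (2 * pi * u y)" "0 \<le> u y" for y
    using nonneg[of y] by (auto simp: u_def complex_nonneg_Reals_iff complex_eq_iff)
  define G where "G = (\<lambda>n y. gauss (real (Suc n)) y * u y)"
  have ub: "u y \<le> (LINT t|lborel. cmod (\<phi> t)) / (2 * pi)" for y
    using norm_fourier_le[of \<phi> y] unfolding u_def
    by (intro divide_right_mono order_trans[OF complex_Re_le_cmod]) auto
  have Gint: "integrable lborel (G n)" for n
  proof (rule Bochner_Integration.integrable_bound)
    show "integrable lborel (\<lambda>y. (LINT t|lborel. cmod (\<phi> t)) / (2 * pi) * gauss (real (Suc n)) y)"
      by (intro integrable_mult_right integrable_gauss) simp
    show "G n \<in> borel_measurable lborel" unfolding G_def by measurable
    show "AE y in lborel. norm (G n y) \<le> norm ((LINT t|lborel. cmod (\<phi> t)) / (2 * pi) * gauss (real (Suc n)) y)"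
    proof (intro AE_I2)
      fix y
      have "G n y \<le> (LINT t|lborel. cmod (\<phi> t)) / (2 * pi) * gauss (real (Suc n)) y"
        unfolding G_def mult.commute[of _ "u y"] by (intro mult_right_mono ub) simp
      moreover have "0 \<le> G n y" using u(2) by (simp add: G_def)
      ultimately show "norm (G n y) \<le> norm ((LINT t|lborel. cmod (\<phi> t)) / (2 * pi) * gauss (real (Suc n)) y)"
        unfolding real_norm_def by linarith
    qed
  qed
  have G0: "0 \<le> G n y" for n y using u(2) by (simp add: G_def)
  have lim: "(\<lambda>n. integral\<^sup>L lborel (G n)) \<longlonglongrightarrow> Re (\<phi> 0)"
  proof -
    have "(LINT y|lborel. of_real (gauss (real (Suc n)) y) * fourier \<phi> y) = of_real (2 * pi * integral\<^sup>L lborel (G n))" for n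
    proof -
      have "(LINT y|lborel. of_real (gauss (real (Suc n)) y) * fourier \<phi> y) = (LINT y|lborel. of_real (2 * pi * G n y))"
        by (intro Bochner_Integration.integral_cong refl) (simp add: u(1) G_def mult_ac)
      then show ?thesis by (simp only: integral_complex_of_real integral_mult_right_zero)
    qed
    from fourier_gauss_approximation[OF \<phi>, unfolded this]
    have "(\<lambda>n. Re (of_real (2 * pi * integral\<^sup>L lborel (G n)))) \<longlonglongrightarrow> Re (of_real (2 * pi) * \<phi> 0)"
      by (rule tendsto_Re)
    then have "(\<lambda>n. 2 * pi * integral\<^sup>L lborel (G n)) \<longlonglongrightarrow> 2 * pi * Re (\<phi> 0)" by simp
    from tendsto_divide[OF this tendsto_const[of "2 * pi"]] show ?thesis by simp
  qed
  have G_mono: "G m y \<le> G n y" if "m \<le> n" for m n y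
  proof -
    have "\<bar>y / real (Suc n)\<bar> \<le> \<bar>y / real (Suc m)\<bar>"
      unfolding abs_divide using that by (intro divide_left_mono) auto
    then have "(y / real (Suc n))\<^sup>2 \<le> (y / real (Suc m))\<^sup>2" by (simp only: abs_le_square_iff)
    then show ?thesis unfolding G_def gauss_def using u(2) by (intro mult_right_mono) auto
  qed
  have G_lim: "(\<lambda>n. G n y) \<longlonglongrightarrow> u y" for y
  proof -
    have "(\<lambda>n. G n y) \<longlonglongrightarrow> 1 * u y" unfolding G_def by (intro tendsto_intros gauss_tendsto_1)
    then show ?thesis by simp
  qed
  have sup: "(SUP n. ennreal (G n y)) = ennreal (u y)" for y
    by (intro LIMSEQ_unique[OF LIMSEQ_SUP tendsto_ennrealI[OF G_lim]]) (auto simp: incseq_def intro!: ennreal_leI G_mono)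
  have "(\<integral>\<^sup>+y. ennreal (u y) \<partial>lborel) = (\<integral>\<^sup>+y. (SUP n. ennreal (G n y)) \<partial>lborel)" by (simp only: sup)
  also have "\<dots> = (SUP n. \<integral>\<^sup>+y. ennreal (G n y) \<partial>lborel)"
    by (rule nn_integral_monotone_convergence_SUP)
      (auto simp: incseq_def le_fun_def intro!: ennreal_leI G_mono, unfold G_def, measurable)
  also have "\<dots> = (SUP n. ennreal (integral\<^sup>L lborel (G n)))"
    by (intro SUP_cong refl nn_integral_eq_integral Gint AE_I2 G0)
  also have "\<dots> = ennreal (Re (\<phi> 0))"
    by (intro LIMSEQ_unique[OF LIMSEQ_SUP tendsto_ennrealI[OF lim]])
      (auto simp: incseq_def intro!: ennreal_leI integral_mono Gint G_mono)
  finally show ?thesis by (simp add: u_def)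
qed


lemma integrable_abs_powr_tail:
  assumes r: "r > 1"
  shows "integrable lborel (\<lambda>t::real. indicator {t. 1 \<le> \<bar>t\<bar>} t * \<bar>t\<bar> powr (- r))"
proof -
  define g where "g = (\<lambda>t::real. indicator {1..} t * t powr (- r))"
  have "((\<lambda>t::real. t powr (- r)) has_integral - (1 powr (- r + 1)) / (- r + 1)) {1..}"
    using r by (intro has_integral_powr_to_inf) auto
  then have "((\<lambda>t. if t \<in> {1..} then t powr (- r) else 0) has_integral - (1 powr (- r + 1)) / (- r + 1)) UNIV"
    by (simp only: has_integral_restrict_UNIV)
  moreover have "(\<lambda>t. if t \<in> {1..} then t powr (- r) else 0) = g" by (auto simp: g_def)
  ultimately have I: "(g has_integral - (1 powr (- r + 1)) / (- r + 1)) UNIV" by simp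
  have [measurable]: "g \<in> borel_measurable borel" unfolding g_def by measurable
  have "integrable lborel g"
  proof (rule integrableI_bounded)
    have "(\<integral>\<^sup>+t. ennreal (norm (g t)) \<partial>lborel) = (\<integral>\<^sup>+t. ennreal (g t) \<partial>lborel)" by (simp add: g_def)
    also have "\<dots> < \<infinity>" using nn_integral_has_integral_lborel[OF _ _ I] by (simp add: g_def)
    finally show "(\<integral>\<^sup>+t. ennreal (norm (g t)) \<partial>lborel) < \<infinity>" .
  qed measurable
  then have "integrable lborel (\<lambda>t. g t + g (0 + (- 1) * t))"
    by (intro Bochner_Integration.integrable_add lborel_integrable_real_affine) auto
  moreover have "(\<lambda>t. g t + g (0 + (- 1) * t)) = (\<lambda>t. indicator {t. 1 \<le> \<bar>t\<bar>} t * \<bar>t\<bar> powr (- r))"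
    by (auto simp: g_def fun_eq_iff indicator_def)
  ultimately show ?thesis by simp
qed

lemma continuous_tail_integrable:
  fixes \<phi> :: "real \<Rightarrow> complex"
  assumes cont: "continuous_on UNIV \<phi>" and r: "r > 1" and C: "\<And>t. 1 \<le> \<bar>t\<bar> \<Longrightarrow> cmod (\<phi> t) \<le> C * \<bar>t\<bar> powr (- r)"
  shows "integrable lborel \<phi>" "\<exists>B. \<forall>t. cmod (\<phi> t) \<le> B"
proof -
  have "compact (\<phi> ` {- 1..1})" by (intro compact_continuous_image continuous_on_subset[OF cont]) auto
  from compact_imp_bounded[OF this] obtain D where D: "\<And>t. t \<in> {- 1..1} \<Longrightarrow> cmod (\<phi> t) \<le> D"
    unfolding bounded_iff by blast
  have C0: "C \<ge> 0" using order_trans[OF norm_ge_zero C[of 1]] by simp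
  have D0: "D \<ge> 0" using order_trans[OF norm_ge_zero D[of 0]] by simp
  have bnd: "cmod (\<phi> t) \<le> D * indicator {- 1..1} t + C * (indicator {t. 1 \<le> \<bar>t\<bar>} t * \<bar>t\<bar> powr (- r))" for t
    using D[of t] C[of t] C0 D0 by (cases "1 \<le> \<bar>t\<bar>") (auto simp: indicator_def)
  show "integrable lborel \<phi>"
  proof (rule Bochner_Integration.integrable_bound)
    show "integrable lborel (\<lambda>t. D * indicator {- 1..1} t + C * (indicator {t. 1 \<le> \<bar>t\<bar>} t * \<bar>t\<bar> powr (- r)))"
      by (intro Bochner_Integration.integrable_add integrable_mult_right integrable_abs_powr_tail r) (auto simp: integrable_indicator_iff)
    show "\<phi> \<in> borel_measurable lborel" using borel_measurable_continuous_onI[OF cont] by simp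
    show "AE t in lborel. norm (\<phi> t) \<le> norm (D * indicator {- 1..1} t + C * (indicator {t. 1 \<le> \<bar>t\<bar>} t * \<bar>t\<bar> powr (- r)))"
      by (intro AE_I2 order_trans[OF bnd]) simp
  qed
  have "cmod (\<phi> t) \<le> D + C" for t
  proof (cases "1 \<le> \<bar>t\<bar>")
    case True
    then have "\<bar>t\<bar> powr (- r) \<le> 1 powr (- r)" using r by (intro powr_mono2') auto
    then have "C * \<bar>t\<bar> powr (- r) \<le> C * 1" using C0 by (intro mult_left_mono) auto
    then show ?thesis using C[OF True] D0 by simp
  next
    case False
    then have "t \<in> {- 1..1}" by auto
    then show ?thesis using D[of t] C0 by linarith
  qed
  then show "\<exists>B. \<forall>t. cmod (\<phi> t) \<le> B" by blast
qed

text \<open>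
  The absolutely convergent form of the inverse Mellin integral along \<open>Re s = \<gamma>\<close>. At \<open>x = e\<^sup>y\<close> it is,
  up to the factor \<open>e\<^sup>-\<^sup>\<gamma>\<^sup>y/2\<pi>\<close>, the Fourier integral of \<open>F\<close> along that line.
\<close>

definition mellin_inverse :: "(complex \<Rightarrow> complex) \<Rightarrow> real \<Rightarrow> real \<Rightarrow> complex" where
  "mellin_inverse F \<gamma> x = 1 / (2 * of_real pi) * (LINT t|lborel. mellin_integrand F x (Complex \<gamma> t))"

lemma mellin_integrand_line:
  assumes "x > 0"
  shows "mellin_integrand F x (Complex \<gamma> t) = of_real (x powr (- \<gamma>)) * (F (Complex \<gamma> t) * cis (- (t * ln x)))"
proof -
  have "- Complex \<gamma> t * of_real (ln x) = of_real (- \<gamma> * ln x) + \<i> * of_real (- (t * ln x))"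
    by (simp add: complex_eq_iff)
  then have "of_real x powr (- Complex \<gamma> t) = exp (of_real (- \<gamma> * ln x)) * cis (- (t * ln x))"
    using assms by (simp only: powr_def Ln_of_real exp_add cis_conv_exp) simp
  then show ?thesis using assms by (simp add: powr_def exp_of_real mult_ac flip: of_real_minus of_real_mult)
qed

lemma mellin_inverse_fourier:
  assumes "x > 0"
  shows "mellin_inverse F \<gamma> x = of_real (x powr (- \<gamma>) / (2 * pi)) * fourier (\<lambda>t. F (Complex \<gamma> t)) (ln x)"
  unfolding mellin_inverse_def mellin_integrand_line[OF assms] integral_mult_right_zero fourier_def[symmetric]
  by simp

lemma line_continuous:
  assumes "F holomorphic_on {s. p < Re s}" "p < \<gamma>"
  shows "continuous_on UNIV (\<lambda>t. F (Complex \<gamma> t))"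
proof -
  have "continuous_on {s. p < Re s} F" using assms(1) by (rule holomorphic_on_imp_continuous_on)
  moreover have "continuous_on UNIV (\<lambda>t. Complex \<gamma> t)"
    unfolding Complex_eq by (intro continuous_intros)
  ultimately show ?thesis
    by (rule continuous_on_compose2) (use assms(2) in auto)
qed

lemma strip_decay_line:
  assumes "strip_decay F r"
  obtains C where "\<And>t. 1 \<le> \<bar>t\<bar> \<Longrightarrow> cmod (F (Complex \<gamma> t)) \<le> C * \<bar>t\<bar> powr (- r)"
proof -
  obtain C where C: "\<And>s. Re s \<in> closed_segment \<gamma> \<gamma> \<Longrightarrow> 1 \<le> \<bar>Im s\<bar> \<Longrightarrow> cmod (F s) \<le> C * \<bar>Im s\<bar> powr (- r)"
    using assms unfolding strip_decay_def by metis
  show thesis using C[of "Complex \<gamma> _"] by (intro that[of C]) simp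
qed

lemma vertical_integral_tendsto:
  assumes hol: "F holomorphic_on {s. p < Re s}" and \<gamma>: "p < \<gamma>" and dec: "strip_decay F r" "r > 1" and x: "x > 0"
  shows "(\<lambda>n. vertical_integral F \<gamma> x (real n)) \<longlonglongrightarrow> mellin_inverse F \<gamma> x"
proof -
  let ?g = "\<lambda>t. mellin_integrand F x (Complex \<gamma> t)"
  have hol': "mellin_integrand F x holomorphic_on {s. p < Re s}" by (intro mellin_integrand_holomorphic hol x)
  have cont: "continuous_on UNIV ?g" by (rule line_continuous[OF hol' \<gamma>])
  obtain C where C: "\<And>t. 1 \<le> \<bar>t\<bar> \<Longrightarrow> cmod (?g t) \<le> C * \<bar>t\<bar> powr (- r)"
    using strip_decay_line[OF strip_decay_mellin_integrand[OF dec(1) x]] by metis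
  note int = continuous_tail_integrable(1)[OF cont dec(2) C]
  have [measurable]: "?g \<in> borel_measurable borel" using borel_measurable_continuous_onI[OF cont] .
  have eq: "integral {- real n..real n} ?g = (LINT t|lborel. indicator {- real n..real n} t *\<^sub>R ?g t)" for n
    using set_borel_integral_eq_integral(2)[OF borel_integrable_atLeastAtMost'[OF continuous_on_subset[OF cont]], of "- real n" "real n"]
    by (simp add: set_lebesgue_integral_def)
  have "(\<lambda>n. LINT t|lborel. indicator {- real n..real n} t *\<^sub>R ?g t) \<longlonglongrightarrow> (LINT t|lborel. ?g t)"
  proof (rule integral_dominated_convergence[where w="\<lambda>t. cmod (?g t)"])
    show "AE t in lborel. (\<lambda>n. indicator {- real n..real n} t *\<^sub>R ?g t) \<longlonglongrightarrow> ?g t"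
    proof (intro AE_I2)
      fix t
      obtain m where m: "\<bar>t\<bar> \<le> real m" using real_arch_simple by blast
      have "\<forall>\<^sub>F n in sequentially. indicator {- real n..real n} t *\<^sub>R ?g t = ?g t"
        using eventually_ge_at_top[of m] by eventually_elim (use m in \<open>auto simp: indicator_def\<close>)
      then show "(\<lambda>n. indicator {- real n..real n} t *\<^sub>R ?g t) \<longlonglongrightarrow> ?g t" by (rule tendsto_eventually)
    qed
    show "AE t in lborel. norm (indicator {- real n..real n} t *\<^sub>R ?g t) \<le> cmod (?g t)" for n
      by (intro AE_I2) (auto simp: indicator_def)
    show "integrable lborel (\<lambda>t. cmod (?g t))" using int by (rule integrable_norm)
  qed measurable
  then show ?thesis unfolding vertical_integral_def mellin_inverse_def eq by (intro tendsto_intros)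
qed

lemma mellin_inverse_shift:
  assumes hol: "F holomorphic_on {s. p < Re s}" and \<gamma>: "p < \<gamma>1" "p < \<gamma>2" and dec: "strip_decay F r" "r > 1" and x: "x > 0"
  shows "mellin_inverse F \<gamma>1 x = mellin_inverse F \<gamma>2 x"
proof -
  let ?G = "mellin_integrand F x"
  have hol': "?G holomorphic_on {s. p < Re s}" by (intro mellin_integrand_holomorphic hol x)
  obtain C where C: "C > 0" "\<And>s. Re s \<in> closed_segment \<gamma>1 \<gamma>2 \<Longrightarrow> 1 \<le> \<bar>Im s\<bar> \<Longrightarrow> cmod (?G s) \<le> C * \<bar>Im s\<bar> powr (- r)"
    using strip_decay_mellin_integrand[OF dec(1) x] unfolding strip_decay_def by metis
  have "((\<lambda>(R, T). contour_integral (vertical_line \<gamma>1 R T) ?G - contour_integral (vertical_line \<gamma>2 R T) ?G) \<longlongrightarrow> 0) (at_top \<times>\<^sub>F at_top)"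
    using dec(2) by (intro vertical_shift[OF hol' \<gamma> _ less_imp_le[OF C(1)] C(2)]) auto
  moreover have "filterlim (\<lambda>n. (real n, real n)) (at_top \<times>\<^sub>F at_top) sequentially"
    by (intro filterlim_Pair filterlim_real_sequentially)
  ultimately have "(\<lambda>n. contour_integral (vertical_line \<gamma>1 (real n) (real n)) ?G - contour_integral (vertical_line \<gamma>2 (real n) (real n)) ?G) \<longlonglongrightarrow> 0"
    by (auto dest: filterlim_compose)
  from tendsto_mult_right_zero[OF this, of "1 / (2 * of_real pi * \<i>)"]
  have "(\<lambda>n. vertical_integral F \<gamma>1 x (real n) - vertical_integral F \<gamma>2 x (real n)) \<longlonglongrightarrow> 0"
    by (rule Lim_transform_eventually)
      (use eventually_gt_at_top[of 0] in eventually_elim, simp only: right_diff_distrib contour_integral_vertical_line of_nat_0_less_iff)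
  moreover have "(\<lambda>n. vertical_integral F \<gamma>1 x (real n) - vertical_integral F \<gamma>2 x (real n)) \<longlonglongrightarrow> mellin_inverse F \<gamma>1 x - mellin_inverse F \<gamma>2 x"
    by (intro tendsto_diff vertical_integral_tendsto[OF hol _ dec x] \<gamma>)
  ultimately show ?thesis using LIMSEQ_unique by fastforce
qed

lemma mellin_inverse_measurable:
  assumes "F holomorphic_on {s. p < Re s}" "p < \<gamma>"
  shows "(\<lambda>x. indicator {0<..} x *\<^sub>R mellin_inverse F \<gamma> x) \<in> borel_measurable borel"
proof -
  have [measurable]: "(\<lambda>t. F (Complex \<gamma> t)) \<in> borel_measurable borel"
    by (rule borel_measurable_continuous_onI[OF line_continuous[OF assms]])
  note fourier_measurable[measurable]
  have "(\<lambda>x. indicator {0<..} x *\<^sub>R mellin_inverse F \<gamma> x) = (\<lambda>x. indicator {0<..} x *\<^sub>R (of_real (x powr (- \<gamma>) / (2 * pi)) * fourier (\<lambda>t. F (Complex \<gamma> t)) (ln x)))"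
    by (auto simp: fun_eq_iff indicator_def mellin_inverse_fourier)
  also have "\<dots> \<in> borel_measurable borel" by measurable
  finally show ?thesis .
qed

text \<open>
  Moments are total masses: multiplying the density by \<open>x\<^sup>n\<close> amounts to moving the line from
  \<open>Re s = 1\<close> to \<open>Re s = n + 1\<close>, so inversion at \<open>0\<close> yields \<open>F(n + 1)\<close>. Positivity on the new line is
  inherited from the old one.
\<close>

lemma mellin_inverse_density:
  assumes hol: "F holomorphic_on {s. p < Re s}" and p: "p < 1" and dec: "strip_decay F r" "r > 1"
    and pd: "posdef M (\<lambda>t. F (Complex 1 t))"
  shows "x > 0 \<Longrightarrow> mellin_inverse F 1 x \<in> \<real>\<^sub>\<ge>\<^sub>0"
    and "(\<integral>\<^sup>+x. ennreal (x ^ n * Re (mellin_inverse F 1 x)) * indicator {0<..} x \<partial>lborel) = ennreal (Re (F (of_nat (n + 1))))"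
proof -
  have line: "integrable lborel (\<lambda>t. F (Complex \<gamma> t))" "\<exists>B. \<forall>t. cmod (F (Complex \<gamma> t)) \<le> B" if "p < \<gamma>" for \<gamma>
  proof -
    obtain C where C: "\<And>t. 1 \<le> \<bar>t\<bar> \<Longrightarrow> cmod (F (Complex \<gamma> t)) \<le> C * \<bar>t\<bar> powr (- r)"
      using strip_decay_line[OF dec(1)] by metis
    show "integrable lborel (\<lambda>t. F (Complex \<gamma> t))" "\<exists>B. \<forall>t. cmod (F (Complex \<gamma> t)) \<le> B"
      using continuous_tail_integrable[OF line_continuous[OF hol that] dec(2) C] by auto
  qed
  show nonneg: "mellin_inverse F 1 x \<in> \<real>\<^sub>\<ge>\<^sub>0" if "x > 0" for x
    unfolding mellin_inverse_fourier[OF that] 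
    by (intro nonneg_Reals_mult_I posdef_fourier_nonneg[OF pd line(1)[OF p]]) simp
  define \<gamma> where "\<gamma> = real (n + 1)"
  have \<gamma>: "p < \<gamma>" using p by (simp add: \<gamma>_def)
  define \<phi> where "\<phi> = (\<lambda>t. F (Complex \<gamma> t))"
  have four: "fourier \<phi> y = of_real (2 * pi * exp (\<gamma> * y)) * mellin_inverse F 1 (exp y)" for y
  proof -
    have "mellin_inverse F 1 (exp y) = mellin_inverse F \<gamma> (exp y)" by (rule mellin_inverse_shift[OF hol p \<gamma> dec exp_gt_zero])
    also have "\<dots> = of_real (exp (- (\<gamma> * y)) / (2 * pi)) * fourier \<phi> y"
      by (simp add: mellin_inverse_fourier \<phi>_def powr_def)
    finally have "of_real (2 * pi * exp (\<gamma> * y)) * mellin_inverse F 1 (exp y)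
      = of_real (2 * pi * exp (\<gamma> * y) * (exp (- (\<gamma> * y)) / (2 * pi))) * fourier \<phi> y" by (simp only: of_real_mult mult.assoc)
    also have "2 * pi * exp (\<gamma> * y) * (exp (- (\<gamma> * y)) / (2 * pi)) = 1" by (simp add: exp_minus)
    finally show ?thesis by simp
  qed
  have four0: "fourier \<phi> y \<in> \<real>\<^sub>\<ge>\<^sub>0" for y
    unfolding four by (intro nonneg_Reals_mult_I nonneg exp_gt_zero) simp
  obtain B where B: "\<And>t. cmod (\<phi> t) \<le> B" using line(2)[OF \<gamma>] unfolding \<phi>_def by blast
  have cont: "isCont \<phi> 0" unfolding \<phi>_def using line_continuous[OF hol \<gamma>] by (simp add: continuous_on_eq_continuous_at)
  have [measurable]: "(\<lambda>x. Re (indicator {0<..} x *\<^sub>R mellin_inverse F 1 x)) \<in> borel_measurable borel"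
    using mellin_inverse_measurable[OF hol p] by measurable
  have "(\<integral>\<^sup>+x. ennreal (x ^ n * Re (mellin_inverse F 1 x)) * indicator {0<..} x \<partial>lborel)
    = (\<integral>\<^sup>+x. ennreal (x ^ n * Re (indicator {0<..} x *\<^sub>R mellin_inverse F 1 x)) * indicator {0<..} x \<partial>lborel)"
    by (intro nn_integral_cong) (auto simp: indicator_def)
  also have "\<dots> = (\<integral>\<^sup>+y. ennreal (exp y ^ n * Re (indicator {0<..} (exp y) *\<^sub>R mellin_inverse F 1 (exp y))) * ennreal (exp y) \<partial>lborel)"
    by (rule nn_integral_exp_substitution) measurable
  also have "\<dots> = (\<integral>\<^sup>+y. ennreal (Re (fourier \<phi> y) / (2 * pi)) \<partial>lborel)"
  proof (intro nn_integral_cong)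
    fix y :: real
    have "exp (\<gamma> * y) = exp y ^ n * exp y"
      by (simp add: \<gamma>_def exp_of_nat_mult[symmetric] exp_add[symmetric] algebra_simps)
    moreover have "0 \<le> Re (mellin_inverse F 1 (exp y))" using nonneg[OF exp_gt_zero] by (simp add: complex_nonneg_Reals_iff)
    ultimately show "ennreal (exp y ^ n * Re (indicator {0<..} (exp y) *\<^sub>R mellin_inverse F 1 (exp y))) * ennreal (exp y)
        = ennreal (Re (fourier \<phi> y) / (2 * pi))"
      unfolding four by (simp add: mult_ac flip: ennreal_mult')
  qed
  also have "\<dots> = ennreal (Re (\<phi> 0))"
    using line(1)[OF \<gamma>] by (intro fourier_total_mass[OF _ cont B four0]) (simp add: \<phi>_def)
  also have "\<phi> 0 = F (of_nat (n + 1))"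
    unfolding \<phi>_def by (rule arg_cong[of _ _ F]) (simp add: \<gamma>_def complex_eq_iff)
  finally show "(\<integral>\<^sup>+x. ennreal (x ^ n * Re (mellin_inverse F 1 x)) * indicator {0<..} x \<partial>lborel) = ennreal (Re (F (of_nat (n + 1))))" .
qed

section \<open>Densities from kernels of positive growth\<close>

lemma law_with_all_moments_density:
  fixes \<rho> :: "real \<Rightarrow> real"
  assumes meas: "\<rho> \<in> borel_measurable borel" and nonneg: "\<And>x. 0 \<le> \<rho> x" and zero: "\<And>x. x \<le> 0 \<Longrightarrow> \<rho> x = 0"
    and mass: "(\<integral>\<^sup>+x. ennreal (\<rho> x) \<partial>lborel) = 1"
    and moments: "\<And>n. (\<integral>\<^sup>+x. ennreal (x ^ n * \<rho> x) \<partial>lborel) < \<infinity>"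
  shows "law_with_all_moments (density lborel (\<lambda>x. ennreal (\<rho> x)))"
  unfolding law_with_all_moments_def
proof (intro conjI allI)
  note meas[measurable]
  show "prob_space (density lborel (\<lambda>x. ennreal (\<rho> x)))"
    by (rule prob_spaceI) (simp add: emeasure_density mass)
  show "sets (density lborel (\<lambda>x. ennreal (\<rho> x))) = sets borel" by simp
  show "AE x in density lborel (\<lambda>x. ennreal (\<rho> x)). 0 < x"
    by (subst AE_density) (use zero in \<open>auto intro!: AE_I2 simp: not_less\<close>, metis less_irrefl not_le zero)
  fix n :: nat
  show "integrable (density lborel (\<lambda>x. ennreal (\<rho> x))) (\<lambda>x. x ^ n)"
  proof (rule integrableI_bounded)
    have "(\<integral>\<^sup>+x. ennreal (norm (x ^ n)) \<partial>density lborel (\<lambda>x. ennreal (\<rho> x))) = (\<integral>\<^sup>+x. ennreal (\<rho> x) * ennreal (norm (x ^ n)) \<partial>lborel)"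
      by (rule nn_integral_density) measurable
    also have "\<dots> = (\<integral>\<^sup>+x. ennreal (x ^ n * \<rho> x) \<partial>lborel)"
    proof (intro nn_integral_cong)
      fix x :: real
      show "ennreal (\<rho> x) * ennreal (norm (x ^ n)) = ennreal (x ^ n * \<rho> x)"
        using nonneg[of x] zero[of x] by (cases "x \<le> 0") (simp_all add: mult.commute flip: ennreal_mult)
    qed
    finally show "(\<integral>\<^sup>+x. ennreal (norm (x ^ n)) \<partial>density lborel (\<lambda>x. ennreal (\<rho> x))) < \<infinity>" using moments by simp
  qed measurable
qed

text \<open>
  The properties of a kernel from which everything follows, all of them multiplicative: growth,
  normalisation \<open>F(1) = K\<close>, and positivity as a multiplier.
\<close>

definition density_kernel :: "(complex \<Rightarrow> complex) \<Rightarrow> real \<Rightarrow> real \<Rightarrow> real \<Rightarrow> real \<Rightarrow> bool" where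
  "density_kernel F K \<mu> \<kappa> \<nu> \<longleftrightarrow> has_growth F \<mu> \<kappa> \<nu> \<and> K > 0 \<and> F 1 = of_real K \<and>
     (\<forall>M \<phi>. posdef M \<phi> \<longrightarrow> posdef M (\<lambda>t. \<phi> t * (F (Complex 1 t) / of_real K)))"

lemma density_kernel_1: "density_kernel (\<lambda>_. 1) 1 0 0 0"
  by (simp add: density_kernel_def has_growth_1)

lemma density_kernel_mult:
  assumes F: "density_kernel F K \<mu> \<kappa> \<nu>" and G: "density_kernel G L \<mu>' \<kappa>' \<nu>'"
  shows "density_kernel (\<lambda>s. F s * G s) (K * L) (\<mu> + \<mu>') (\<kappa> + \<kappa>') (\<nu> + \<nu>')"
proof -
  have "posdef M (\<lambda>t. \<phi> t * (F (Complex 1 t) * G (Complex 1 t) / of_real (K * L)))" if "posdef M \<phi>" for M \<phi>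
  proof -
    have "posdef M (\<lambda>t. \<phi> t * (F (Complex 1 t) / of_real K) * (G (Complex 1 t) / of_real L))"
      using F G that unfolding density_kernel_def by blast
    then show ?thesis by (simp add: mult_ac)
  qed
  then show ?thesis using F G has_growth_mult unfolding density_kernel_def by (auto simp: mult_ac)
qed

lemma posdef_scale:
  assumes \<phi>: "posdef M \<phi>" and c: "0 \<le> c"
  shows "posdef (c * M) (\<lambda>t. of_real c * \<phi> t)"
  unfolding posdef_def
proof (intro conjI allI impI)
  show "(\<lambda>t. of_real c * \<phi> t) \<in> borel_measurable borel" using posdefD(1)[OF \<phi>] by measurable
  show "cmod (of_real c * \<phi> t) \<le> c * M" for t
    using posdefD(2)[OF \<phi>, of t] c by (simp add: norm_mult mult_left_mono)
  fix k y :: real assume k: "k > 0"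
  have "fourier (\<lambda>t. of_real c * \<phi> t * of_real (gauss k t)) y = of_real c * fourier (\<lambda>t. \<phi> t * of_real (gauss k t)) y"
    unfolding fourier_def by (simp add: mult.assoc)
  then show "fourier (\<lambda>t. of_real c * \<phi> t * of_real (gauss k t)) y \<in> \<real>\<^sub>\<ge>\<^sub>0"
    using posdefD(3)[OF \<phi> k] c by simp
qed

lemma density_kernel_posdef:
  assumes "density_kernel F K \<mu> \<kappa> \<nu>"
  shows "posdef K (\<lambda>t. F (Complex 1 t))"
proof -
  have K: "K > 0" using assms by (simp add: density_kernel_def)
  have "posdef 1 (\<lambda>t. 1 * (F (Complex 1 t) / of_real K))"
    using assms posdef_one unfolding density_kernel_def by blast
  from posdef_scale[OF this, of K] K show ?thesis by simp
qed

lemma holomorphic_right_half: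
  assumes "valid_params Bs"
  shows "fox_kernel As Bs holomorphic_on {s. fox_bound Bs < Re s}"
  by (rule holomorphic_on_subset[OF fox_kernel_holomorphic[OF assms]]) auto

lemma positive_growth_FHdam:
  assumes Bs: "Bs \<noteq> []" "valid_params Bs" and As: "\<forall>(A, a)\<in>set As. 0 < a"
    and F: "density_kernel (fox_kernel As Bs) K \<mu> \<kappa> \<nu>" and \<mu>: "\<mu> > 0"
    and \<rho>: "\<rho> = scaled_fox_H K {0<..} As Bs"
  shows "is_scaled_fox_H K {0<..} As Bs \<rho> \<and> Density_fun \<rho> \<in> FHdam"
proof -
  let ?F = "fox_kernel As Bs"
  note hol = holomorphic_right_half[OF Bs(2), of As]
  note p = fox_bound_less_1[OF Bs]
  have K: "K > 0" and F1: "?F 1 = of_real K" and gr: "has_growth ?F \<mu> \<kappa> \<nu>" using F by (auto simp: density_kernel_def)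
  have dec: "left_decay ?F 2 x" if "x > 0" for x by (rule left_decay_of_positive_growth[OF gr \<mu> that])
  have sd: "strip_decay ?F 2" by (rule strip_decay_of_left_decay[OF dec[of 1]]) auto
  have val: "(\<exists>!h. has_fox_H As Bs x h) \<and> fox_H As Bs x = mellin_inverse ?F 1 x" if x: "x > 0" for x
  proof -
    obtain h where h: "\<exists>!h. has_fox_H As Bs x h" "has_fox_H As Bs x h"
      "\<And>\<gamma>. fox_bound Bs < \<gamma> \<Longrightarrow> (\<lambda>n. vertical_integral ?F \<gamma> x (real n)) \<longlonglongrightarrow> h"
      by (rule fox_contours_common_value[OF Bs x _ dec[OF x]]) auto
    have "h = mellin_inverse ?F 1 x"
      by (rule LIMSEQ_unique[OF h(3)[OF p] vertical_integral_tendsto[OF hol p sd _ x]]) simp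
    moreover have "fox_H As Bs x = h" unfolding fox_H_def using h by (intro the1_equality)
    ultimately show ?thesis using h(1) by simp
  qed
  note dens = mellin_inverse_density[OF hol p sd _ density_kernel_posdef[OF F]]
  have nn: "mellin_inverse ?F 1 x \<in> \<real>\<^sub>\<ge>\<^sub>0" if "x > 0" for x using dens(1) that by simp
  have \<rho>_eq: "\<rho> x = Re (indicator {0<..} x *\<^sub>R mellin_inverse ?F 1 x) / K" for x
    using val by (simp add: \<rho> scaled_fox_H_def indicator_def)
  have scaled: "is_scaled_fox_H K {0<..} As Bs \<rho>"
    unfolding is_scaled_fox_H_def
  proof (intro conjI ballI allI impI)
    fix x :: real assume "x \<in> {0<..}"
    then have x: "x > 0" by simp
    show "\<exists>!h. has_fox_H As Bs x h" using val[OF x] by blast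
    show "of_real (\<rho> x) = fox_H As Bs x / of_real K"
      using nn[OF x] val[OF x] x by (simp add: \<rho>_eq complex_nonneg_Reals_iff complex_eq_iff)
  qed (simp add: \<rho>_eq indicator_def)
  have nonneg: "0 \<le> \<rho> x" for x
    using nn[of x] K by (auto simp: \<rho>_eq indicator_def complex_nonneg_Reals_iff)
  have meas[measurable]: "\<rho> \<in> borel_measurable borel"
    unfolding \<rho>_eq[abs_def] using mellin_inverse_measurable[OF hol p] by measurable
  have mom: "(\<integral>\<^sup>+x. ennreal (x ^ n * \<rho> x) \<partial>lborel) = ennreal (Re (?F (of_nat (n + 1))) / K)" for n
  proof -
    have "(\<integral>\<^sup>+x. ennreal (x ^ n * \<rho> x) \<partial>lborel) = (\<integral>\<^sup>+x. ennreal (1 / K) * (ennreal (x ^ n * Re (mellin_inverse ?F 1 x)) * indicator {0<..} x) \<partial>lborel)"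
    proof (intro nn_integral_cong)
      fix x :: real
      show "ennreal (x ^ n * \<rho> x) = ennreal (1 / K) * (ennreal (x ^ n * Re (mellin_inverse ?F 1 x)) * indicator {0<..} x)"
        using nn[of x] K by (auto simp: \<rho>_eq indicator_def complex_nonneg_Reals_iff ennreal_mult'[symmetric])
    qed
    also have "\<dots> = ennreal (1 / K) * (\<integral>\<^sup>+x. ennreal (x ^ n * Re (mellin_inverse ?F 1 x)) * indicator {0<..} x \<partial>lborel)"
    proof (rule nn_integral_cmult)
      have "(\<lambda>x. ennreal (x ^ n * (K * \<rho> x)) * indicator {0<..} x) \<in> borel_measurable lborel" by measurable
      also have "(\<lambda>x. ennreal (x ^ n * (K * \<rho> x)) * indicator {0<..} x) = (\<lambda>x. ennreal (x ^ n * Re (mellin_inverse ?F 1 x)) * indicator {0<..} x)"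
        using K by (auto simp: fun_eq_iff \<rho>_eq indicator_def)
      finally show "(\<lambda>x. ennreal (x ^ n * Re (mellin_inverse ?F 1 x)) * indicator {0<..} x) \<in> borel_measurable lborel" .
    qed
    also have "\<dots> = ennreal (1 / K) * ennreal (Re (?F (of_nat (n + 1))))" using dens(2)[of n] by simp
    also have "\<dots> = ennreal (Re (?F (of_nat (n + 1))) / K)" using K by (simp flip: ennreal_mult')
    finally show ?thesis .
  qed
  have "law_with_all_moments (density lborel (\<lambda>x. ennreal (\<rho> x)))"
  proof (rule law_with_all_moments_density[OF meas nonneg])
    show "\<rho> x = 0" if "x \<le> 0" for x using that by (simp add: \<rho>_eq)
    show "(\<integral>\<^sup>+x. ennreal (\<rho> x) \<partial>lborel) = 1" using mom[of 0] F1 K by simp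
    show "(\<integral>\<^sup>+x. ennreal (x ^ n * \<rho> x) \<partial>lborel) < \<infinity>" for n unfolding mom by simp
  qed
  moreover have "\<forall>(B, b)\<in>set Bs. 0 < b" using Bs(2) by (auto simp: valid_params_def)
  ultimately show ?thesis using scaled As K meas nonneg unfolding FHdam_def
    by (intro conjI UnI1 CollectI exI[of _ \<rho>] exI[of _ K] exI[of _ "{0<..}"] exI[of _ As] exI[of _ Bs] refl) auto
qed

section \<open>Densities on the unit interval from kernels of balanced growth\<close>

lemma fourier_isCont:
  assumes f: "integrable lborel f"
  shows "isCont (fourier f) y"
proof (rule continuous_at_sequentiallyI)
  fix u assume u: "u \<longlonglongrightarrow> y"
  have [measurable]: "f \<in> borel_measurable borel" using f by auto
  show "(\<lambda>n. fourier f (u n)) \<longlonglongrightarrow> fourier f y"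
    unfolding fourier_def
  proof (rule integral_dominated_convergence[where w="\<lambda>t. cmod (f t)"])
    show "integrable lborel (\<lambda>t. cmod (f t))" using f by (rule integrable_norm)
    show "AE t in lborel. (\<lambda>n. f t * cis (- (t * u n))) \<longlonglongrightarrow> f t * cis (- (t * y))"
      unfolding cis_conv_exp by (intro AE_I2 tendsto_intros u)
    show "AE t in lborel. cmod (f t * cis (- (t * u n))) \<le> cmod (f t)" for n
      by (intro AE_I2) (simp add: norm_mult)
  qed measurable
qed

text \<open>
  The identity behind \<open>F(s)/s\<close>: the inverse Mellin transform of \<open>F(s)/s\<close> is \<open>\<integral> f(u)/u du\<close> over \<open>[x, \<infinity>)\<close>.
\<close>

lemma powr_has_integral:
  fixes s :: complex
  assumes s: "s \<noteq> 0" and x: "0 < x1" "x1 \<le> x2"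
  shows "((\<lambda>u. of_real u powr (- s) / of_real u) has_integral (of_real x1 powr (- s) - of_real x2 powr (- s)) / s) {x1..x2}"
proof -
  have "((\<lambda>u. of_real u powr (- s) / of_real u) has_integral
      (of_real x2 powr (- s) / (- s) - of_real x1 powr (- s) / (- s))) {x1..x2}"
  proof (rule fundamental_theorem_of_calculus[OF x(2)])
    fix u assume u: "u \<in> {x1..x2}"
    have nz: "complex_of_real u \<notin> \<real>\<^sub>\<le>\<^sub>0" "complex_of_real u \<noteq> 0" using u x by auto
    have "((\<lambda>z. z powr (- s) / (- s)) has_field_derivative (- s * of_real u powr (- s - 1)) / (- s)) (at (of_real u))"
      using nz by (intro DERIV_cdivide has_field_derivative_powr)
    also have "(- s * of_real u powr (- s - 1)) / (- s) = of_real u powr (- s) / of_real u"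
      using s nz by (simp add: powr_diff)
    finally show "((\<lambda>u. of_real u powr (- s) / (- s)) has_vector_derivative of_real u powr (- s) / of_real u) (at u within {x1..x2})"
      by (rule has_vector_derivative_real_field)
  qed
  then show ?thesis by (simp add: diff_divide_distrib)
qed

text \<open>
  Fubini on a compact rectangle; the passage to the limit \<open>N \<rightarrow> \<infinity>\<close> is left to uniform convergence,
  because the integral of \<open>F\<close> itself need not converge absolutely.
\<close>

lemma vertical_integral_integral:
  assumes hol: "F holomorphic_on {s. p < Re s}" and p: "p < 1" and x: "0 < x1" "x1 \<le> x2"
  shows "integral {x1..x2} (\<lambda>u. vertical_integral F 1 u N / of_real u)
       = vertical_integral (\<lambda>s. F s / s) 1 x1 N - vertical_integral (\<lambda>s. F s / s) 1 x2 N"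
    and "continuous_on {x1..x2} (\<lambda>u. vertical_integral F 1 u N)"
proof -
  have line: "continuous_on UNIV (\<lambda>t. F (Complex 1 t))" by (rule line_continuous[OF hol p])
  have contF: "continuous_on S (\<lambda>z. F (Complex 1 (snd z)))" for S :: "(real \<times> real) set"
    by (rule continuous_on_compose2[OF line]) (auto intro!: continuous_intros)
  \<comment> \<open>The integrand with \<open>x\<^sup>-\<^sup>s\<close> written out, which shows its joint continuity.\<close>
  define k where "k = (\<lambda>u t. of_real (u powr (- 1)) * (F (Complex 1 t) * cis (- (t * ln u))))"
  have keq: "mellin_integrand F u (Complex 1 t) = k u t" if "u \<in> {x1..x2}" for u t
    using mellin_integrand_line[of u F 1 t] that x by (simp add: k_def)
  have kcont: "continuous_on ({x1..x2} \<times> cbox (- N) N) (\<lambda>(u, t). k u t)"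
    unfolding k_def case_prod_unfold cis_conv_exp using x by (intro continuous_intros contF) auto
  have kcont': "continuous_on (cbox (x1, - N) (x2, N)) (\<lambda>(u, t). k u t / of_real u)"
    unfolding k_def case_prod_unfold cis_conv_exp using x by (intro continuous_intros contF) (auto simp flip: cbox_Pair_eq)
  have V: "vertical_integral F 1 u N = 1 / (2 * of_real pi) * integral (cbox (- N) N) (k u)" if "u \<in> {x1..x2}" for u
    unfolding vertical_integral_def using keq[OF that] by simp
  have "continuous_on {x1..x2} (\<lambda>u. 1 / (2 * of_real pi) * integral (cbox (- N) N) (k u))"
    by (intro continuous_intros integral_continuous_on_param kcont)
  then show "continuous_on {x1..x2} (\<lambda>u. vertical_integral F 1 u N)"
    by (rule continuous_on_eq) (simp add: V)
  have "integral {x1..x2} (\<lambda>u. vertical_integral F 1 u N / of_real u)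
      = integral (cbox x1 x2) (\<lambda>u. 1 / (2 * of_real pi) * integral (cbox (- N) N) (\<lambda>t. k u t / of_real u))"
    unfolding interval_cbox[symmetric]
    by (intro integral_cong) (simp only: V integral_divide, simp)
  also have "\<dots> = 1 / (2 * of_real pi) * integral (cbox x1 x2) (\<lambda>u. integral (cbox (- N) N) (\<lambda>t. k u t / of_real u))"
    by (rule integral_mult_right)
  also have "integral (cbox x1 x2) (\<lambda>u. integral (cbox (- N) N) (\<lambda>t. k u t / of_real u))
      = integral (cbox (- N) N) (\<lambda>t. integral (cbox x1 x2) (\<lambda>u. k u t / of_real u))"
    by (rule integral_swap_continuous[OF kcont'])
  also have "\<dots> = integral {- N..N} (\<lambda>t. mellin_integrand (\<lambda>s. F s / s) x1 (Complex 1 t) - mellin_integrand (\<lambda>s. F s / s) x2 (Complex 1 t))"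
    unfolding interval_cbox[symmetric]
  proof (intro integral_cong)
    fix t
    have nz: "Complex 1 t \<noteq> 0" by (simp add: complex_eq_iff)
    have "integral {x1..x2} (\<lambda>u. k u t / of_real u) = integral {x1..x2} (\<lambda>u. F (Complex 1 t) * (of_real u powr (- Complex 1 t) / of_real u))"
      by (intro integral_cong) (simp add: keq[symmetric])
    also have "\<dots> = F (Complex 1 t) * ((of_real x1 powr (- Complex 1 t) - of_real x2 powr (- Complex 1 t)) / Complex 1 t)"
      by (simp only: integral_mult_right integral_unique[OF powr_has_integral[OF nz x]])
    finally show "integral {x1..x2} (\<lambda>u. k u t / of_real u)
        = mellin_integrand (\<lambda>s. F s / s) x1 (Complex 1 t) - mellin_integrand (\<lambda>s. F s / s) x2 (Complex 1 t)"
      by (simp add: right_diff_distrib diff_divide_distrib mult_ac)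
  qed
  also have "\<dots> = integral {- N..N} (\<lambda>t. mellin_integrand (\<lambda>s. F s / s) x1 (Complex 1 t)) - integral {- N..N} (\<lambda>t. mellin_integrand (\<lambda>s. F s / s) x2 (Complex 1 t))"
  proof (rule Henstock_Kurzweil_Integration.integral_diff)
    have "(\<lambda>s. F s / s) holomorphic_on {s. max p 0 < Re s}"
      by (intro holomorphic_intros holomorphic_on_subset[OF hol]) auto
    then have c: "continuous_on UNIV (\<lambda>t. mellin_integrand (\<lambda>s. F s / s) x (Complex 1 t))" if "x > 0" for x
      using p that by (intro line_continuous[of "mellin_integrand (\<lambda>s. F s / s) x" "max p 0"] mellin_integrand_holomorphic) auto
    show "(\<lambda>t. mellin_integrand (\<lambda>s. F s / s) x1 (Complex 1 t)) integrable_on {- N..N}"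
      by (rule integrable_continuous_real[OF continuous_on_subset[OF c[of x1]]]) (use x in auto)
    show "(\<lambda>t. mellin_integrand (\<lambda>s. F s / s) x2 (Complex 1 t)) integrable_on {- N..N}"
      by (rule integrable_continuous_real[OF continuous_on_subset[OF c[of x2]]]) (use x in auto)
  qed
  finally show "integral {x1..x2} (\<lambda>u. vertical_integral F 1 u N / of_real u)
       = vertical_integral (\<lambda>s. F s / s) 1 x1 N - vertical_integral (\<lambda>s. F s / s) 1 x2 N"
    unfolding vertical_integral_def by (simp only: right_diff_distrib)
qed

text \<open>
  For \<open>x > 1\<close> the line is pushed to the right, where \<open>x\<^sup>-\<^sup>s\<close> decays exponentially while \<open>G\<close> stays bounded by
  a fixed integrable function; the point \<open>x = 1\<close> follows by continuity.
\<close>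

lemma mellin_inverse_beyond_one:
  assumes hol: "G holomorphic_on {s. p < Re s}" and p: "p < 1" and dec: "strip_decay G r" "r > 1"
    and bnd: "\<And>s. 1 \<le> Re s \<Longrightarrow> cmod (G s) \<le> C * cmod s powr (- r)" and x: "1 \<le> x"
  shows "mellin_inverse G 1 x = 0"
proof -
  have C0: "C \<ge> 0" using order_trans[OF norm_ge_zero bnd[of 1]] by simp
  define b where "b = (\<lambda>t::real. C * (indicator {- 1..1} t + indicator {t. 1 \<le> \<bar>t\<bar>} t * \<bar>t\<bar> powr (- r)))"
  have bint: "integrable lborel b"
    unfolding b_def by (intro integrable_mult_right Bochner_Integration.integrable_add integrable_abs_powr_tail dec(2))
      (auto simp: integrable_indicator_iff)
  have Gb: "cmod (G (Complex \<gamma> t)) \<le> b t" if \<gamma>: "1 \<le> \<gamma>" for \<gamma> t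
  proof -
    let ?s = "Complex \<gamma> t"
    have s: "1 \<le> cmod ?s" "\<bar>t\<bar> \<le> cmod ?s"
      using \<gamma> abs_Re_le_cmod[of ?s] abs_Im_le_cmod[of ?s] by auto
    have 1: "cmod ?s powr (- r) \<le> indicator {- 1..1} t + indicator {t. 1 \<le> \<bar>t\<bar>} t * \<bar>t\<bar> powr (- r)"
    proof (cases "1 \<le> \<bar>t\<bar>")
      case True
      then have "cmod ?s powr (- r) \<le> \<bar>t\<bar> powr (- r)" using s dec(2) by (intro powr_mono2') auto
      then show ?thesis using True by (simp add: indicator_def)
    next
      case False
      then have "t \<in> {- 1..1}" by auto
      moreover have "cmod ?s powr (- r) \<le> 1 powr (- r)" using s dec(2) by (intro powr_mono2') auto
      ultimately show ?thesis using False by (simp add: indicator_def)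
    qed
    have "cmod (G ?s) \<le> C * cmod ?s powr (- r)" using bnd[of ?s] \<gamma> by simp
    also have "\<dots> \<le> b t" unfolding b_def by (intro mult_left_mono 1 C0)
    finally show ?thesis .
  qed
  have lint: "integrable lborel (\<lambda>t. G (Complex \<gamma> t))" if \<gamma>: "1 \<le> \<gamma>" for \<gamma>
  proof (rule Bochner_Integration.integrable_bound[OF bint])
    show "(\<lambda>t. G (Complex \<gamma> t)) \<in> borel_measurable lborel"
      using borel_measurable_continuous_onI[OF line_continuous[OF hol, of \<gamma>]] p \<gamma> by simp
    show "AE t in lborel. norm (G (Complex \<gamma> t)) \<le> norm (b t)"
      by (intro AE_I2 order_trans[OF Gb[OF \<gamma>]]) simp
  qed
  define D where "D = integral\<^sup>L lborel b / (2 * pi)"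
  have beyond: "mellin_inverse G 1 x = 0" if x: "1 < x" for x
  proof -
    have le: "cmod (mellin_inverse G 1 x) \<le> D * x powr (- real (n + 1))" for n
    proof -
      have n1: "1 \<le> real (n + 1)" by simp
      have "mellin_inverse G 1 x = mellin_inverse G (real (n + 1)) x"
        using p x by (intro mellin_inverse_shift[OF hol _ _ dec]) auto
      then have "cmod (mellin_inverse G 1 x) = x powr (- real (n + 1)) / (2 * pi) * cmod (fourier (\<lambda>t. G (Complex (real (n + 1)) t)) (ln x))"
        using x by (simp add: mellin_inverse_fourier norm_mult norm_divide)
      also have "\<dots> \<le> x powr (- real (n + 1)) / (2 * pi) * integral\<^sup>L lborel b"
        by (intro mult_left_mono order_trans[OF norm_fourier_le] integral_mono integrable_norm lint[OF n1] bint Gb[OF n1]) auto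
      finally show ?thesis by (simp add: D_def mult_ac)
    qed
    have "(\<lambda>n. D * x powr (- real (n + 1))) \<longlonglongrightarrow> 0" using x by real_asymp
    then have "cmod (mellin_inverse G 1 x) \<le> 0" by (rule tendsto_lowerbound) (use le in auto)
    then show ?thesis by simp
  qed
  show ?thesis
  proof (cases "x = 1")
    case True
    have f0: "fourier (\<lambda>t. G (Complex 1 t)) y = 0" if "y > 0" for y
      using beyond[of "exp y"] that by (simp add: mellin_inverse_fourier)
    have "((\<lambda>y. fourier (\<lambda>t. G (Complex 1 t)) y) \<longlongrightarrow> fourier (\<lambda>t. G (Complex 1 t)) 0) (at_right 0)"
      using fourier_isCont[OF lint[OF order_refl], of 0] unfolding isCont_def by (rule filterlim_mono) (auto simp: at_le)
    moreover have "((\<lambda>y. fourier (\<lambda>t. G (Complex 1 t)) y) \<longlongrightarrow> 0) (at_right 0)"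
      by (rule tendsto_eventually) (auto simp: eventually_at_filter f0)
    ultimately have "fourier (\<lambda>t. G (Complex 1 t)) 0 = 0"
      using tendsto_unique[of "at_right (0::real)"] by (metis trivial_limit_at_right_real)
    then show ?thesis unfolding True by (simp add: mellin_inverse_fourier)
  next
    case False
    then show ?thesis using beyond x by simp
  qed
qed

text \<open>
  On the line \<open>Re s = 1\<close> the difference of the two integrands is \<open>F\<close> times the transform of the
  nonnegative weight \<open>e\<^sup>-\<^sup>v\<close> on \<open>[ln x1, ln x2]\<close>, so positivity of \<open>F\<close> as a multiplier makes the
  difference nonnegative.
\<close>

lemma mellin_inverse_decreasing:
  assumes hol: "F holomorphic_on {s. p < Re s}" and p: "p < 1" and pd: "posdef M (\<lambda>t. F (Complex 1 t))"
    and int: "integrable lborel (\<lambda>t. F (Complex 1 t) / Complex 1 t)" and x: "0 < x1" "x1 \<le> x2"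
  shows "mellin_inverse (\<lambda>s. F s / s) 1 x1 - mellin_inverse (\<lambda>s. F s / s) 1 x2 \<in> \<real>\<^sub>\<ge>\<^sub>0"
proof -
  define w where "w = (\<lambda>v. indicator {ln x1..ln x2} v *\<^sub>R exp (- v))"
  have lnx: "ln x1 \<le> ln x2" using x by simp
  have w: "integrable lborel w" "\<And>v. 0 \<le> w v"
    unfolding w_def by (intro borel_integrable_compact continuous_intros) auto
  have fw: "fourier (\<lambda>v. of_real (w v)) t = (of_real x1 powr (- Complex 1 t) - of_real x2 powr (- Complex 1 t)) / Complex 1 t" for t
  proof -
    let ?s = "Complex 1 t"
    have nz: "?s \<noteq> 0" by (simp add: complex_eq_iff)
    have eq: "of_real (w v) * cis (- (v * t)) = indicator {ln x1..ln x2} v *\<^sub>R exp (- (?s * of_real v))" for v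
    proof -
      have "- (?s * of_real v) = of_real (- v) + \<i> * of_real (- (v * t))" by (simp add: complex_eq_iff)
      then have "exp (- (?s * of_real v)) = of_real (exp (- v)) * cis (- (v * t))"
        by (simp only: exp_add exp_of_real cis_conv_exp)
      then show ?thesis by (simp add: w_def indicator_def)
    qed
    have "fourier (\<lambda>v. of_real (w v)) t = exp (- (?s * of_real (ln x2))) / (- ?s) - exp (- (?s * of_real (ln x1))) / (- ?s)"
      unfolding fourier_def eq
    proof (rule integral_FTC_atLeastAtMost[OF lnx])
      fix v :: real
      have D: "((\<lambda>u. exp (- (c * u)) / (- c)) has_field_derivative exp (- (c * of_real v))) (at (of_real v))" if "c \<noteq> 0" for c :: complex
        using that by (auto intro!: derivative_eq_intros)
      show "((\<lambda>v. exp (- (?s * of_real v)) / (- ?s)) has_vector_derivative exp (- (?s * of_real v))) (at v within {ln x1..ln x2})"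
        by (rule has_vector_derivative_real_field[OF D[OF nz]])
    qed (intro continuous_intros)
    moreover have "of_real x powr (- ?s) = exp (- (?s * of_real (ln x)))" if "x > 0" for x
      using that by (simp add: powr_def Ln_of_real)
    ultimately show ?thesis using x by (simp add: diff_divide_distrib)
  qed
  let ?\<phi> = "\<lambda>t. F (Complex 1 t) * fourier (\<lambda>v. of_real (w v)) t"
  have split: "?\<phi> t = mellin_integrand (\<lambda>s. F s / s) x1 (Complex 1 t) - mellin_integrand (\<lambda>s. F s / s) x2 (Complex 1 t)" for t
    by (simp add: fw right_diff_distrib diff_divide_distrib mult_ac)
  have mint: "integrable lborel (\<lambda>t. mellin_integrand (\<lambda>s. F s / s) x (Complex 1 t))" if "x > 0" for x
    unfolding mellin_integrand_line[OF that] by (intro integrable_mult_right integrable_cis_mult int)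
  have "integrable lborel ?\<phi>" unfolding split using x by (intro Bochner_Integration.integrable_diff mint) auto
  from posdef_fourier_nonneg[OF posdef_mix[OF pd w] this, of 0]
  have "(LINT t|lborel. ?\<phi> t) \<in> \<real>\<^sub>\<ge>\<^sub>0" by (simp add: fourier_def)
  also have "(LINT t|lborel. ?\<phi> t) = (LINT t|lborel. mellin_integrand (\<lambda>s. F s / s) x1 (Complex 1 t)) - (LINT t|lborel. mellin_integrand (\<lambda>s. F s / s) x2 (Complex 1 t))"
    unfolding split using x by (intro Bochner_Integration.integral_diff mint) auto
  finally have "of_real (1 / (2 * pi)) * ((LINT t|lborel. mellin_integrand (\<lambda>s. F s / s) x1 (Complex 1 t)) - (LINT t|lborel. mellin_integrand (\<lambda>s. F s / s) x2 (Complex 1 t))) \<in> \<real>\<^sub>\<ge>\<^sub>0"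
    by (intro nonneg_Reals_mult_I) simp_all
  then show ?thesis unfolding mellin_inverse_def by (simp add: diff_divide_distrib)
qed


lemma nn_integral_continuous_Icc:
  fixes g :: "real \<Rightarrow> real"
  assumes cont: "continuous_on {a..b} g" and nonneg: "\<And>u. u \<in> {a..b} \<Longrightarrow> 0 \<le> g u"
  shows "(\<integral>\<^sup>+u. ennreal (g u) * indicator {a..b} u \<partial>lborel) = ennreal (integral {a..b} g)"
proof -
  let ?h = "\<lambda>u. if u \<in> {a..b} then g u else 0"
  have "(?h has_integral integral {a..b} g) UNIV"
    unfolding has_integral_restrict_UNIV using integrable_integral[OF integrable_continuous_real[OF cont]] .
  moreover have "?h \<in> borel_measurable borel"
  proof -
    have "(\<lambda>u. indicator {a..b} u *\<^sub>R g u) \<in> borel_measurable borel"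
      by (intro borel_measurable_continuous_on_indicator cont) simp
    also have "(\<lambda>u. indicator {a..b} u *\<^sub>R g u) = ?h" by (auto simp: indicator_def)
    finally show ?thesis .
  qed
  ultimately have "integral\<^sup>N lborel ?h = ennreal (integral {a..b} g)"
    using nonneg by (intro nn_integral_has_integral_lborel) auto
  moreover have "(\<integral>\<^sup>+u. ennreal (g u) * indicator {a..b} u \<partial>lborel) = integral\<^sup>N lborel ?h"
    by (intro nn_integral_cong) (auto simp: indicator_def)
  ultimately show ?thesis by simp
qed

lemma integrand_nonneg_of_increments:
  fixes g :: "real \<Rightarrow> complex"
  assumes cont: "continuous_on {a..b} g" and inc: "\<And>u v. a \<le> u \<Longrightarrow> u \<le> v \<Longrightarrow> v \<le> b \<Longrightarrow> integral {u..v} g \<in> \<real>\<^sub>\<ge>\<^sub>0"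
    and u: "a < u" "u < b"
  shows "g u \<in> \<real>\<^sub>\<ge>\<^sub>0"
proof -
  define H where "H = (\<lambda>v. integral {a..v} g)"
  have "(H has_vector_derivative g u) (at u within {a..b})"
    unfolding H_def by (rule integral_has_vector_derivative[OF cont]) (use u in auto)
  then have H: "(H has_vector_derivative g u) (at u)"
    using u by (simp add: at_within_Icc_at)
  have diff: "H v - H w \<in> \<real>\<^sub>\<ge>\<^sub>0" if "a \<le> w" "w \<le> v" "v \<le> b" for v w
  proof -
    have "integral {a..w} g + integral {w..v} g = integral {a..v} g"
      using that by (intro Henstock_Kurzweil_Integration.integral_combine integrable_continuous_real continuous_on_subset[OF cont]) auto
    then have "H v - H w = integral {w..v} g" by (simp add: H_def algebra_simps)
    then show ?thesis using inc[OF that] by simp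
  qed
  have int: "u \<in> interior {a..b}" using u by simp
  have re: "((\<lambda>v. Re (H v)) has_real_derivative Re (g u)) (at u)" and im: "((\<lambda>v. Im (H v)) has_real_derivative Im (g u)) (at u)"
    using bounded_linear.has_vector_derivative[OF bounded_linear_Re H] bounded_linear.has_vector_derivative[OF bounded_linear_Im H] by (simp_all add: has_real_derivative_iff_has_vector_derivative)
  have mono: "mono_on {a..b} (\<lambda>v. L (H v))"
    if "\<And>z. z \<in> \<real>\<^sub>\<ge>\<^sub>0 \<Longrightarrow> 0 \<le> L z" "\<And>z w. L (z - w) = L z - L w" for L :: "complex \<Rightarrow> real"
  proof (rule mono_onI)
    fix v w assume vw: "v \<in> {a..b}" "w \<in> {a..b}" "v \<le> w"
    have "0 \<le> L (H w - H v)" using vw by (intro that(1) diff) auto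
    then show "L (H v) \<le> L (H w)" by (simp add: that(2))
  qed
  have "0 \<le> Re (g u)"
    by (rule mono_on_imp_deriv_nonneg[OF mono re int]) (auto simp: complex_nonneg_Reals_iff)
  moreover have "0 \<le> Im (g u)"
    by (rule mono_on_imp_deriv_nonneg[OF mono im int]) (auto simp: complex_nonneg_Reals_iff)
  moreover have "0 \<le> - Im (g u)"
    by (rule mono_on_imp_deriv_nonneg[OF mono[of "\<lambda>z. - Im z"] DERIV_minus[OF im] int]) (auto simp: complex_nonneg_Reals_iff)
  ultimately show ?thesis by (simp add: complex_nonneg_Reals_iff)
qed

lemma balanced_growth_divide:
  assumes F: "has_growth F 0 0 \<nu>" and \<nu>: "\<nu> < 0"
  shows "strip_decay F (- \<nu>)" "strip_decay (\<lambda>s. F s / s) (1 - \<nu>)"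
    "\<exists>C. \<forall>s. 1 \<le> Re s \<longrightarrow> cmod (F s / s) \<le> C * cmod s powr (- (1 - \<nu>))"
proof -
  obtain C where C: "C > 0" "\<And>s. 1 \<le> \<bar>Im s\<bar> \<or> 1 \<le> Re s \<Longrightarrow> cmod (F s) \<le> C * exp (Re (growth_exponent 0 0 \<nu> s))"
    using has_growthD[OF F zero_less_one] by metis
  have bnd: "cmod (F s) \<le> C * cmod s powr \<nu>" "s \<noteq> 0" if "1 \<le> \<bar>Im s\<bar> \<or> 1 \<le> Re s" for s
  proof -
    show "s \<noteq> 0" using that by auto
    then show "cmod (F s) \<le> C * cmod s powr \<nu>" using C(2)[OF that] by (simp add: growth_exponent_Re powr_def)
  qed
  have quot: "cmod (F s / s) \<le> C * cmod s powr (- (1 - \<nu>))" if s: "1 \<le> \<bar>Im s\<bar> \<or> 1 \<le> Re s" for s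
  proof -
    have "cmod (F s / s) \<le> C * cmod s powr \<nu> / cmod s"
      unfolding norm_divide using bnd(1)[OF s] by (intro divide_right_mono) auto
    also have "\<dots> = C * cmod s powr (- (1 - \<nu>))"
      using bnd(2)[OF s] by (simp add: powr_diff)
    finally show ?thesis .
  qed
  show "\<exists>C. \<forall>s. 1 \<le> Re s \<longrightarrow> cmod (F s / s) \<le> C * cmod s powr (- (1 - \<nu>))" using quot by blast
  have mono: "C * cmod s powr (- q) \<le> C * \<bar>Im s\<bar> powr (- q)" if "1 \<le> \<bar>Im s\<bar>" "q > 0" for s q
    using that C abs_Im_le_cmod[of s] by (intro mult_left_mono powr_mono2') auto
  show "strip_decay (\<lambda>s. F s / s) (1 - \<nu>)" unfolding strip_decay_def
  proof (intro allI exI[of _ C] conjI impI)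
    fix s assume s: "1 \<le> \<bar>Im s\<bar>"
    show "cmod (F s / s) \<le> C * \<bar>Im s\<bar> powr (- (1 - \<nu>))"
      using order_trans[OF quot mono[OF s, of "1 - \<nu>"]] s \<nu> by simp
  qed (rule C(1))
  show "strip_decay F (- \<nu>)" unfolding strip_decay_def
  proof (intro allI exI[of _ C] conjI impI)
    fix s assume s: "1 \<le> \<bar>Im s\<bar>"
    show "cmod (F s) \<le> C * \<bar>Im s\<bar> powr (- (- \<nu>))"
      using order_trans[OF bnd(1)[of s]] mono[OF s, of "- \<nu>"] s \<nu> by simp
  qed (rule C(1))
qed

text \<open>
  The integral of \<open>F\<close> along a vertical line may converge only conditionally, so inversion is applied to
  \<open>F(s)/s\<close> instead. Its inverse Mellin transform \<open>h\<close> satisfies \<open>h(x) = \<integral> f(u)/u du\<close> over \<open>[x, 1]\<close>: it vanishes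
  beyond \<open>1\<close>, is decreasing, and has total mass \<open>F(1) = K\<close>. Monotonicity of \<open>h\<close> gives \<open>f \<ge> 0\<close>, and
  exchanging the integrations shows that \<open>f\<close> has the same mass as \<open>h\<close>. On \<open>(0, 1)\<close> moments are
  bounded by the mass.
\<close>

lemma balanced_growth_FHdam:
  assumes Bs: "Bs \<noteq> []" "valid_params Bs" and As: "\<forall>(A, a)\<in>set As. 0 < a"
    and F: "density_kernel (fox_kernel As Bs) K 0 0 \<nu>" and \<nu>: "\<nu> < 0"
    and \<rho>: "\<rho> = scaled_fox_H K {0<..<1} As Bs"
  shows "is_scaled_fox_H K {0<..<1} As Bs \<rho> \<and> Density_fun \<rho> \<in> FHdam"
proof -
  let ?F = "fox_kernel As Bs"
  let ?G = "\<lambda>s. ?F s / s"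
  let ?f = "fox_H As Bs"
  note hol = holomorphic_right_half[OF Bs(2), of As]
  note p = fox_bound_less_1[OF Bs]
  have K: "K > 0" and F1: "?F 1 = of_real K" and gr: "has_growth ?F 0 0 \<nu>" using F by (auto simp: density_kernel_def)
  note sd = balanced_growth_divide[OF gr \<nu>]
  define q where "q = max (fox_bound Bs) 0"
  have q: "q < 1" using p by (simp add: q_def)
  have holG: "?G holomorphic_on {s. q < Re s}"
    by (intro holomorphic_intros holomorphic_on_subset[OF hol]) (auto simp: q_def)
  have r1: "1 < 1 - \<nu>" using \<nu> by simp
  define h where "h = mellin_inverse ?G 1"
  have pdF: "posdef K (\<lambda>t. ?F (Complex 1 t))" by (rule density_kernel_posdef[OF F])
  have C1: "Complex 1 t = 1 + \<i> * of_real t" for t by (simp add: complex_eq_iff)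
  have pdG: "posdef K (\<lambda>t. ?G (Complex 1 t))"
    using posdef_exponential_mixture[OF pdF, of 1 0] by (simp add: C1)
  have Gint: "integrable lborel (\<lambda>t. ?F (Complex 1 t) / Complex 1 t)"
  proof -
    obtain C where C: "\<And>t. 1 \<le> \<bar>t\<bar> \<Longrightarrow> cmod (?G (Complex 1 t)) \<le> C * \<bar>t\<bar> powr (- (1 - \<nu>))"
      using strip_decay_line[OF sd(2)] by metis
    show ?thesis using continuous_tail_integrable(1)[OF line_continuous[OF holG q] r1 C] by simp
  qed
  obtain CG where CG: "\<And>s. 1 \<le> Re s \<Longrightarrow> cmod (?G s) \<le> CG * cmod s powr (- (1 - \<nu>))" using sd(3) by blast
  have h_zero: "h x = 0" if "1 \<le> x" for x
    unfolding h_def by (rule mellin_inverse_beyond_one[OF holG q sd(2) r1 CG that])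
  have h_nonneg: "h x \<in> \<real>\<^sub>\<ge>\<^sub>0" if "x > 0" for x
    unfolding h_def by (rule mellin_inverse_density(1)[OF holG q sd(2) r1 pdG that])
  have h_dec: "h x1 - h x2 \<in> \<real>\<^sub>\<ge>\<^sub>0" if "0 < x1" "x1 \<le> x2" for x1 x2
    unfolding h_def by (rule mellin_inverse_decreasing[OF hol p pdF Gint that])
  have h_mass: "(\<integral>\<^sup>+x. ennreal (Re (h x)) * indicator {0<..} x \<partial>lborel) = ennreal K"
    using mellin_inverse_density(2)[OF holG q sd(2) r1 pdG, of 0] F1 by (simp add: h_def)
  have h_cont1: "(\<lambda>n. h (u n)) \<longlonglongrightarrow> 0" if "u \<longlonglongrightarrow> 1" "\<And>n. u n > 0" for u
  proof -
    have "(\<lambda>n. of_real (u n powr (- 1) / (2 * pi)) * fourier (\<lambda>t. ?G (Complex 1 t)) (ln (u n))) \<longlonglongrightarrow>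
        of_real (1 powr (- 1) / (2 * pi)) * fourier (\<lambda>t. ?G (Complex 1 t)) (ln 1)"
      by (intro tendsto_intros isCont_tendsto_compose[OF fourier_isCont] Gint that(1)) auto
    then have "(\<lambda>n. h (u n)) \<longlonglongrightarrow> h 1"
      by (simp add: h_def mellin_inverse_fourier that(2))
    then show ?thesis using h_zero[of 1] by simp
  qed
  have val: "(\<exists>!h. has_fox_H As Bs x h) \<and> (\<lambda>n. vertical_integral ?F 1 x (real n)) \<longlonglongrightarrow> ?f x \<and>
     (\<forall>C \<epsilon> N. C > 0 \<longrightarrow> \<epsilon> > 0 \<longrightarrow> (\<forall>s. Re s \<le> 1 \<longrightarrow> 1 \<le> \<bar>Im s\<bar> \<longrightarrow>
         cmod (?F s) * x powr (- Re s) \<le> C * \<bar>Im s\<bar> powr (- (- \<nu>)) * exp (\<epsilon> * Re s)) \<longrightarrow> 1 \<le> N \<longrightarrow>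
       cmod (vertical_integral ?F 1 x N - ?f x) \<le> C * exp (\<epsilon> * 1) / \<epsilon> * N powr (- (- \<nu>)))"
    if x: "0 < x" "x < 1" for x
  proof -
    have \<nu>': "0 < - \<nu>" using \<nu> by simp
    show ?thesis
    proof (rule fox_contours_common_value[OF Bs x(1) \<nu>' left_decay_of_balanced_growth[OF gr \<nu> x]], goal_cases)
      case (1 h)
      have "?f x = h" unfolding fox_H_def using 1(1,2) by (intro the1_equality)
      then show ?case using 1(1) 1(3)[OF p] 1(4)[OF p] by blast
    qed
  qed
  have f_unif: "uniform_limit {x1..x2} (\<lambda>n u. vertical_integral ?F 1 u (real n)) ?f sequentially"
    if x: "0 < x1" "x1 \<le> x2" "x2 < 1" for x1 x2
  proof -
    obtain C where C: "C > 0" "\<And>x s. x1 \<le> x \<Longrightarrow> x \<le> x2 \<Longrightarrow> Re s \<le> 1 \<Longrightarrow> 1 \<le> \<bar>Im s\<bar> \<Longrightarrow>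
        cmod (?F s) * x powr (- Re s) \<le> C * \<bar>Im s\<bar> powr \<nu> * exp (- ln x2 * Re s)"
      using left_decay_of_balanced_growth_uniform[OF gr \<nu> x zero_less_one] by metis
    define \<alpha> where "\<alpha> = C * exp (- ln x2 * 1) / (- ln x2)"
    have ln2: "0 < - ln x2" using x by simp
    have est: "cmod (vertical_integral ?F 1 u N - ?f u) \<le> \<alpha> * N powr \<nu>" if u: "u \<in> {x1..x2}" and N: "1 \<le> N" for u N
    proof -
      have u': "0 < u" "u < 1" using u x by auto
      have "\<forall>s. Re s \<le> 1 \<longrightarrow> 1 \<le> \<bar>Im s\<bar> \<longrightarrow> cmod (?F s) * u powr (- Re s) \<le> C * \<bar>Im s\<bar> powr (- (- \<nu>)) * exp (- ln x2 * Re s)"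
        using C(2)[of u] u by simp
      then have "cmod (vertical_integral ?F 1 u N - ?f u) \<le> C * exp (- ln x2 * 1) / (- ln x2) * N powr (- (- \<nu>))"
        using val[OF u'] C(1) ln2 N by blast
      then show ?thesis by (simp add: \<alpha>_def)
    qed
    have lim: "(\<lambda>n. \<alpha> * real n powr \<nu>) \<longlonglongrightarrow> 0" using \<nu> by real_asymp
    show ?thesis
    proof (rule uniform_limitI)
      fix e :: real assume "e > 0"
      then have "\<forall>\<^sub>F n in sequentially. \<bar>\<alpha> * real n powr \<nu>\<bar> < e" using tendstoD[OF lim, of e] by simp
      then show "\<forall>\<^sub>F n in sequentially. \<forall>u\<in>{x1..x2}. dist (vertical_integral ?F 1 u (real n)) (?f u) < e"
        using eventually_ge_at_top[of 1]
      proof eventually_elim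
        case (elim n)
        then show ?case using est[of _ "real n"] unfolding dist_norm by (fastforce intro: le_less_trans)
      qed
    qed
  qed
  have f_cont: "continuous_on {x1..x2} ?f" if x: "0 < x1" "x1 \<le> x2" "x2 < 1" for x1 x2
    by (rule uniform_limit_theorem[OF always_eventually f_unif[OF x]])
      (use vertical_integral_integral(2)[OF hol p x(1,2)] in auto)
  have f_int: "integral {x1..x2} (\<lambda>u. ?f u / of_real u) = h x1 - h x2" if x: "0 < x1" "x1 \<le> x2" "x2 < 1" for x1 x2
  proof -
    have unif: "uniform_limit {x1..x2} (\<lambda>n u. vertical_integral ?F 1 u (real n) / of_real u) (\<lambda>u. ?f u / of_real u) sequentially"
    proof (rule uniform_lim_divide[OF f_unif[OF x] uniform_limit_const])
      show "bounded (?f ` {x1..x2})"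
        by (intro compact_imp_bounded compact_continuous_image f_cont x) simp
      show "x1 \<le> cmod (of_real u)" if "u \<in> {x1..x2}" for u using that x by simp
    qed (rule x(1))
    have cont: "continuous_on {x1..x2} (\<lambda>u. vertical_integral ?F 1 u (real n) / of_real u)" for n
      using x by (intro continuous_intros vertical_integral_integral(2)[OF hol p x(1,2)]) auto
    obtain I J where IJ: "\<And>n. ((\<lambda>u. vertical_integral ?F 1 u (real n) / of_real u) has_integral I n) {x1..x2}"
      "((\<lambda>u. ?f u / of_real u) has_integral J) {x1..x2}" "I \<longlonglongrightarrow> J"
      using uniform_limit_integral[OF unif cont sequentially_bot] by metis
    have "I n = vertical_integral ?G 1 x1 (real n) - vertical_integral ?G 1 x2 (real n)" for n
      using integral_unique[OF IJ(1)] vertical_integral_integral(1)[OF hol p x(1,2)] by simp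
    then have I: "I = (\<lambda>n. vertical_integral ?G 1 x1 (real n) - vertical_integral ?G 1 x2 (real n))" by blast
    have "I \<longlonglongrightarrow> h x1 - h x2"
      unfolding h_def I using x by (intro tendsto_diff vertical_integral_tendsto[OF holG q sd(2) r1]) auto
    then have "J = h x1 - h x2" using IJ(3) LIMSEQ_unique by blast
    then show ?thesis using integral_unique[OF IJ(2)] by simp
  qed
  have nn: "?f x \<in> \<real>\<^sub>\<ge>\<^sub>0" if x: "0 < x" "x < 1" for x
  proof -
    have ab: "0 < x / 2" "x / 2 \<le> (1 + x) / 2" "(1 + x) / 2 < 1" "x / 2 < x" "x < (1 + x) / 2" using x by auto
    have "?f x / of_real x \<in> \<real>\<^sub>\<ge>\<^sub>0"
    proof (rule integrand_nonneg_of_increments[OF _ _ ab(4,5)])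
      show "continuous_on {x / 2..(1 + x) / 2} (\<lambda>u. ?f u / of_real u)"
        using x by (intro continuous_intros f_cont ab) auto
      fix u v assume uv: "x / 2 \<le> u" "u \<le> v" "v \<le> (1 + x) / 2"
      then have "0 < u" "v < 1" using x by auto
      then show "integral {u..v} (\<lambda>u. ?f u / of_real u) \<in> \<real>\<^sub>\<ge>\<^sub>0"
        using uv(2) h_dec[of u v] by (simp add: f_int)
    qed
    then have "of_real x * (?f x / of_real x) \<in> \<real>\<^sub>\<ge>\<^sub>0" using x by (intro nonneg_Reals_mult_I) auto
    then show ?thesis using x by simp
  qed
  have f_cont': "continuous_on {0<..<1} ?f"
  proof (rule continuous_at_imp_continuous_on, rule ballI)
    fix x :: real assume "x \<in> {0<..<1}"
    then have x: "0 < x" "x < 1" by auto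
    have "continuous_on {x / 2..(1 + x) / 2} ?f" using x by (intro f_cont) auto
    then show "isCont ?f x" by (rule continuous_on_interior) (use x in auto)
  qed
  have \<rho>_eq: "\<rho> x = Re (indicator {0<..<1} x *\<^sub>R ?f x) / K" for x
    by (simp add: \<rho> scaled_fox_H_def indicator_def)
  have nonneg: "0 \<le> \<rho> x" for x
    using nn[of x] K by (auto simp: \<rho>_eq indicator_def complex_nonneg_Reals_iff)
  have meas[measurable]: "\<rho> \<in> borel_measurable borel"
    using borel_measurable_continuous_on_indicator[OF _ f_cont'] unfolding \<rho>_eq[abs_def] by measurable
  have scaled: "is_scaled_fox_H K {0<..<1} As Bs \<rho>"
    unfolding is_scaled_fox_H_def
  proof (intro conjI ballI allI impI)
    fix x :: real assume "x \<in> {0<..<1}"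
    then have x: "0 < x" "x < 1" by auto
    show "\<exists>!h. has_fox_H As Bs x h" using val[OF x] by blast
    show "of_real (\<rho> x) = fox_H As Bs x / of_real K"
      using nn[OF x] x by (simp add: \<rho>_eq complex_nonneg_Reals_iff complex_eq_iff)
  qed (simp add: \<rho>_eq indicator_def)
  have tail: "ennreal (Re (h x)) = (\<integral>\<^sup>+u. ennreal (K * \<rho> u / u) * indicator {x..<1} u \<partial>lborel)" if x: "0 < x" "x < 1" for x
  proof -
    \<comment> \<open>The formula for \<open>h\<close> holds on compact intervals inside \<open>(0, 1)\<close>; the endpoint \<open>1\<close> is reached along \<open>b\<close>.\<close>
    define b where "b = (\<lambda>n::nat. 1 - (1 - x) * inverse (real (Suc n)))"
    have b: "x \<le> b n" "b n < 1" for n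
    proof -
      have "(1 - x) * inverse (real (Suc n)) \<le> (1 - x) * 1" using x by (intro mult_left_mono) (auto simp: inverse_le_1_iff)
      then show "x \<le> b n" by (simp add: b_def)
      show "b n < 1" using x by (simp add: b_def)
    qed
    have b_mono: "b m \<le> b n" if "m \<le> n" for m n
      unfolding b_def using x that by (intro diff_left_mono mult_left_mono le_imp_inverse_le) auto
    have b_lim: "b \<longlonglongrightarrow> 1 - (1 - x) * 0" unfolding b_def by (intro tendsto_intros LIMSEQ_inverse_real_of_nat)
    then have b_lim: "b \<longlonglongrightarrow> 1" by simp
    have U: "(\<Union>n. {x..b n}) = {x..<1}"
    proof safe
      fix u assume u: "u \<in> {x..<1}"
      then have "\<forall>\<^sub>F n in sequentially. u < b n" using order_tendstoD(1)[OF b_lim, of u] by simp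
      then obtain n where "u < b n" by (auto simp: eventually_sequentially)
      then have "u \<in> {x..b n}" using u by simp
      then show "u \<in> (\<Union>n. {x..b n})" by blast
    qed (use b in \<open>auto intro: le_less_trans\<close>)
    have piece: "(\<integral>\<^sup>+u. ennreal (K * \<rho> u / u) * indicator {x..b n} u \<partial>lborel) = ennreal (Re (h x) - Re (h (b n)))" for n
    proof -
      have cont: "continuous_on {x..b n} (\<lambda>u. ?f u / of_real u)"
        using x b[of n] by (intro continuous_intros f_cont) auto
      have "(\<integral>\<^sup>+u. ennreal (K * \<rho> u / u) * indicator {x..b n} u \<partial>lborel) = (\<integral>\<^sup>+u. ennreal (Re (?f u / of_real u)) * indicator {x..b n} u \<partial>lborel)"
        using K x b[of n] by (intro nn_integral_cong) (auto simp: \<rho>_eq indicator_def Re_divide_of_real)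
      also have "\<dots> = ennreal (integral {x..b n} (\<lambda>u. Re (?f u / of_real u)))"
      proof (rule nn_integral_continuous_Icc)
        show "continuous_on {x..b n} (\<lambda>u. Re (?f u / of_real u))" by (intro continuous_intros cont)
        fix u assume "u \<in> {x..b n}"
        then have "0 < u" "u < 1" using x b[of n] by auto
        then show "0 \<le> Re (?f u / of_real u)" using nn[of u] by (simp add: Re_divide_of_real complex_nonneg_Reals_iff)
      qed
      also have "integral {x..b n} (\<lambda>u. Re (?f u / of_real u)) = Re (integral {x..b n} (\<lambda>u. ?f u / of_real u))"
        using integral_linear[OF integrable_continuous_real[OF cont] bounded_linear_Re] by (simp add: o_def)
      also have "\<dots> = Re (h x) - Re (h (b n))" using f_int[OF x(1) b] by simp
      finally show ?thesis .
    qed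
    have "(\<integral>\<^sup>+u. ennreal (K * \<rho> u / u) * indicator {x..<1} u \<partial>lborel) = (SUP n. ennreal (Re (h x) - Re (h (b n))))"
      unfolding U[symmetric] piece[symmetric]
      by (rule SUP_nn_integral_incseq[symmetric]) (auto simp: incseq_def intro: order_trans[OF _ b_mono], measurable)
    also have "\<dots> = ennreal (Re (h x))"
    proof (rule LIMSEQ_unique[OF LIMSEQ_SUP])
      have mono: "Re (h (b n)) \<le> Re (h (b m))" if "m \<le> n" for m n
        using h_dec[of "b m" "b n"] b_mono[OF that] b(1)[of m] x by (auto simp: complex_nonneg_Reals_iff)
      show "incseq (\<lambda>n. ennreal (Re (h x) - Re (h (b n))))"
        unfolding incseq_def using mono by (auto intro!: ennreal_leI)
      have "(\<lambda>n. Re (h (b n))) \<longlonglongrightarrow> Re 0"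
        using b x by (intro tendsto_Re h_cont1 b_lim) (auto intro: less_le_trans)
      then have "(\<lambda>n. Re (h x) - Re (h (b n))) \<longlonglongrightarrow> Re (h x) - 0" by (intro tendsto_intros) simp
      then show "(\<lambda>n. ennreal (Re (h x) - Re (h (b n)))) \<longlonglongrightarrow> ennreal (Re (h x))"
        by (intro tendsto_ennrealI) simp
    qed
    finally show ?thesis by simp
  qed
  have "ennreal K = (\<integral>\<^sup>+x. (\<integral>\<^sup>+u. ennreal (K * \<rho> u / u) * indicator {0<..u} x \<partial>lborel) \<partial>lborel)"
    unfolding h_mass[symmetric]
  proof (intro nn_integral_cong)
    fix x :: real
    have "(\<integral>\<^sup>+u. ennreal (K * \<rho> u / u) * indicator {0<..u} x \<partial>lborel) = (if 0 < x then \<integral>\<^sup>+u. ennreal (K * \<rho> u / u) * indicator {x..<1} u \<partial>lborel else 0)"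
      by (cases "0 < x") (auto intro!: nn_integral_cong nn_integral_zero' AE_I2 simp: indicator_def \<rho>_eq)
    also have "\<dots> = ennreal (Re (h x)) * indicator {0<..} x"
      using tail[of x] h_zero[of x] by (cases "x < 1") (auto simp: indicator_def)
    finally show "ennreal (Re (h x)) * indicator {0<..} x = (\<integral>\<^sup>+u. ennreal (K * \<rho> u / u) * indicator {0<..u} x \<partial>lborel)" by simp
  qed
  also have "\<dots> = (\<integral>\<^sup>+u. (\<integral>\<^sup>+x. ennreal (K * \<rho> u / u) * indicator {0<..u} x \<partial>lborel) \<partial>lborel)"
  proof (rule lborel_pair.Fubini')
    have "(\<lambda>(u, x). ennreal (K * \<rho> u / u) * (if 0 < x \<and> x \<le> u then 1 else 0)) \<in> borel_measurable (lborel \<Otimes>\<^sub>M lborel)"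
      by measurable
    also have "(\<lambda>(u, x). ennreal (K * \<rho> u / u) * (if 0 < x \<and> x \<le> u then 1 else 0)) = (\<lambda>(u, x). ennreal (K * \<rho> u / u) * indicator {0<..u} x)"
      by (auto simp: fun_eq_iff indicator_def)
    finally show "(\<lambda>(u, x). ennreal (K * \<rho> u / u) * indicator {0<..u} x) \<in> borel_measurable (lborel \<Otimes>\<^sub>M lborel)" .
  qed
  also have "\<dots> = (\<integral>\<^sup>+u. ennreal K * ennreal (\<rho> u) \<partial>lborel)"
  proof (intro nn_integral_cong)
    fix u :: real
    show "(\<integral>\<^sup>+x. ennreal (K * \<rho> u / u) * indicator {0<..u} x \<partial>lborel) = ennreal K * ennreal (\<rho> u)"
    proof (cases "0 < u")
      case True
      then show ?thesis using K nonneg[of u] by (simp add: nn_integral_cmult_indicator flip: ennreal_mult)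
    next
      case False
      then show ?thesis by (simp add: \<rho>_eq)
    qed
  qed
  also have "\<dots> = ennreal K * (\<integral>\<^sup>+u. ennreal (\<rho> u) \<partial>lborel)" by (rule nn_integral_cmult) measurable
  finally have "ennreal K * (\<integral>\<^sup>+u. ennreal (\<rho> u) \<partial>lborel) = ennreal K * 1" by simp
  then have mass: "(\<integral>\<^sup>+u. ennreal (\<rho> u) \<partial>lborel) = 1"
    using K by (subst (asm) ennreal_mult_cancel_left) auto
  have "law_with_all_moments (density lborel (\<lambda>x. ennreal (\<rho> x)))"
  proof (rule law_with_all_moments_density[OF meas nonneg _ mass])
    show "\<rho> x = 0" if "x \<le> 0" for x using that by (simp add: \<rho>_eq)
    fix n :: nat
    have "(\<integral>\<^sup>+x. ennreal (x ^ n * \<rho> x) \<partial>lborel) \<le> (\<integral>\<^sup>+x. ennreal (\<rho> x) \<partial>lborel)"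
    proof (intro nn_integral_mono ennreal_leI)
      fix x :: real
      show "x ^ n * \<rho> x \<le> \<rho> x"
      proof (cases "0 < x \<and> x < 1")
        case True
        then show ?thesis using mult_right_mono[of "x ^ n" 1 "\<rho> x"] nonneg[of x] by (simp add: power_le_one)
      qed (auto simp: \<rho>_eq)
    qed
    then show "(\<integral>\<^sup>+x. ennreal (x ^ n * \<rho> x) \<partial>lborel) < \<infinity>" unfolding mass by (auto intro: le_less_trans)
  qed
  moreover have "\<forall>(B, b)\<in>set Bs. 0 < b" using Bs(2) by (auto simp: valid_params_def)
  moreover have "\<exists>r>0. {0<..<1} = {0<..<(r::real)}" by (intro exI[of _ 1]) simp
  ultimately show ?thesis using scaled As K meas nonneg unfolding FHdam_def
    by (intro conjI UnI1 CollectI exI[of _ \<rho>] exI[of _ K] exI[of _ "{0<..<1}"] exI[of _ As] exI[of _ Bs] refl) auto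
qed

section \<open>The point mass as a distribution\<close>

lemma fourier_derivative:
  fixes v v' :: "real \<Rightarrow> real"
  assumes ab: "a \<le> b" and der: "\<And>y. (v has_real_derivative v' y) (at y)" and cont: "continuous_on UNIV v'"
    and zero: "\<And>y. y \<notin> {a<..<b} \<Longrightarrow> v y = 0" "\<And>y. y \<notin> {a<..<b} \<Longrightarrow> v' y = 0"
  shows "fourier (\<lambda>y. of_real (v' y)) t = \<i> * of_real t * fourier (\<lambda>y. of_real (v y)) t"
proof -
  have contv: "continuous_on UNIV v" using der by (meson DERIV_isCont continuous_at_imp_continuous_on)
  define g where "g = (\<lambda>y. of_real (v y) * cis (- (y * t)))"
  define g' where "g' = (\<lambda>y. of_real (v' y) * cis (- (y * t)) - \<i> * of_real t * (of_real (v y) * cis (- (y * t))))"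
  have int: "integrable lborel (\<lambda>y. of_real (w y) * cis (- (y * t)))"
    if "continuous_on UNIV w" "\<And>y. y \<notin> {a<..<b} \<Longrightarrow> w y = 0" for w :: "real \<Rightarrow> real"
  proof -
    have "integrable lborel (\<lambda>y. indicator {a..b} y *\<^sub>R (of_real (w y) * cis (- (y * t))))"
      unfolding cis_conv_exp by (intro borel_integrable_compact continuous_intros continuous_on_subset[OF that(1)]) auto
    moreover have "(\<lambda>y. indicator {a..b} y *\<^sub>R (of_real (w y) * cis (- (y * t)))) = (\<lambda>y. of_real (w y) * cis (- (y * t)))"
      using that(2) by (auto simp: indicator_def fun_eq_iff)
    ultimately show ?thesis by simp
  qed
  have "(LINT y|lborel. indicator {a..b} y *\<^sub>R g' y) = g b - g a"
  proof (rule integral_FTC_atLeastAtMost[OF ab])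
    fix y :: real
    have c: "((\<lambda>y. cis (- (y * t))) has_vector_derivative - (\<i> * of_real t) * cis (- (y * t))) (at y within {a..b})"
    proof -
      have "((\<lambda>z. exp (- (\<i> * of_real t * z))) has_field_derivative - (\<i> * of_real t) * exp (- (\<i> * of_real t * of_real y))) (at (of_real y))"
        by (auto intro!: derivative_eq_intros)
      from has_vector_derivative_real_field[OF this] show ?thesis
        by (simp add: cis_conv_exp mult_ac)
    qed
    have d: "((\<lambda>y. complex_of_real (v y)) has_vector_derivative of_real (v' y)) (at y within {a..b})"
      using der[of y] by (intro has_vector_derivative_of_real)
        (auto simp: has_real_derivative_iff_has_vector_derivative intro: has_vector_derivative_at_within)
    show "(g has_vector_derivative g' y) (at y within {a..b})"
      unfolding g_def using has_vector_derivative_mult[OF d c] by (simp add: g'_def algebra_simps)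
  next
    show "continuous_on {a..b} g'"
      unfolding g'_def cis_conv_exp
      by (intro continuous_intros continuous_on_subset[OF cont] continuous_on_subset[OF contv]) auto
  qed
  moreover have "g a = 0" "g b = 0" using zero(1)[of a] zero(1)[of b] by (simp_all add: g_def)
  moreover have "(LINT y|lborel. indicator {a..b} y *\<^sub>R g' y) = (LINT y|lborel. g' y)"
    by (intro Bochner_Integration.integral_cong refl) (use zero in \<open>auto simp: g'_def indicator_def\<close>)
  moreover have "integrable lborel (\<lambda>y. of_real (v' y) * cis (- (y * t)))" "integrable lborel (\<lambda>y. of_real (v y) * cis (- (y * t)))"
    using int[OF cont] int[OF contv] zero by blast+
  then have "(LINT y|lborel. g' y) = fourier (\<lambda>y. of_real (v' y)) t - \<i> * of_real t * fourier (\<lambda>y. of_real (v y)) t"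
    unfolding g'_def fourier_def by (simp add: Bochner_Integration.integral_diff)
  ultimately show ?thesis by simp
qed

text \<open>
  The Gaussian means of the transform converge to \<open>2\<pi> \<psi>(0)\<close> in any case; if the transform is integrable
  they also converge to its integral.
\<close>

lemma fourier_inversion_at_0:
  assumes \<psi>: "integrable lborel \<psi>" "isCont \<psi> 0" "\<And>y. cmod (\<psi> y) \<le> B" and hat: "integrable lborel (fourier \<psi>)"
  shows "(LINT t|lborel. fourier \<psi> t) = of_real (2 * pi) * \<psi> 0"
proof (rule LIMSEQ_unique[OF _ fourier_gauss_approximation[OF \<psi>]])
  have [measurable]: "fourier \<psi> \<in> borel_measurable borel" using hat by auto
  show "(\<lambda>n. LINT y|lborel. of_real (gauss (real (Suc n)) y) * fourier \<psi> y) \<longlonglongrightarrow> (LINT t|lborel. fourier \<psi> t)"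
  proof (rule integral_dominated_convergence[where w="\<lambda>y. cmod (fourier \<psi> y)"])
    show "integrable lborel (\<lambda>y. cmod (fourier \<psi> y))" using hat by (rule integrable_norm)
    show "AE y in lborel. (\<lambda>n. of_real (gauss (real (Suc n)) y) * fourier \<psi> y) \<longlonglongrightarrow> fourier \<psi> y"
      using gauss_tendsto_1 by (intro AE_I2) (auto intro!: tendsto_eq_intros)
    show "AE y in lborel. cmod (of_real (gauss (real (Suc n)) y) * fourier \<psi> y) \<le> cmod (fourier \<psi> y)" for n
      using gauss_le_1 by (intro AE_I2) (simp add: norm_mult mult_left_le_one_le)
  qed measurable
qed

lemma deriv_zero_outside:
  fixes g :: "real \<Rightarrow> real"
  assumes S: "closed S" and g: "\<And>x. x \<notin> S \<Longrightarrow> g x = 0" and x: "x \<notin> S"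
  shows "deriv g x = 0"
proof -
  have "((\<lambda>_. 0) has_field_derivative 0) (at x)" by simp
  then have "(g has_field_derivative 0) (at x)"
    by (rule has_field_derivative_transform_within_open[of _ _ _ "- S"]) (use S g x in \<open>auto simp: open_Compl\<close>)
  then show ?thesis by (rule DERIV_imp_deriv)
qed

text \<open>
  In the logarithmic variable the pairing with \<open>x\<^sup>-\<^sup>i\<^sup>t\<close> is the Fourier transform of
  \<open>u(y) = \<phi>(e\<^sup>y) e\<^sup>y\<close>. As \<open>u\<close> is smooth with compact support, two integrations by parts give decay of order
  \<open>t\<^sup>-\<^sup>2\<close> and hence integrability.
\<close>

lemma test_function_transform:
  assumes \<phi>: "test_function \<phi>"
  defines "u \<equiv> (\<lambda>y. \<phi> (exp y) * exp y)"
  shows "integrable lborel (\<lambda>y. complex_of_real (u y))" "continuous_on UNIV u" "\<exists>B. \<forall>y. cmod (of_real (u y)) \<le> B"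
    "mellin_pairing \<phi> t = fourier (\<lambda>y. of_real (u y)) t" "integrable lborel (fourier (\<lambda>y. of_real (u y)))"
proof -
  define S where "S = closure {x. \<phi> x \<noteq> 0}"
  have S: "compact S" "S \<subseteq> {0<..}" "closed S" using \<phi> by (auto simp: test_function_def S_def)
  have sm: "(deriv ^^ n) \<phi> differentiable_on UNIV" for n using \<phi> by (simp add: test_function_def)
  have z0: "\<phi> x = 0" if "x \<notin> S" for x using that closure_subset[of "{x. \<phi> x \<noteq> 0}"] by (auto simp: S_def)
  have z1: "deriv \<phi> x = 0" if "x \<notin> S" for x by (rule deriv_zero_outside[OF S(3) z0 that])
  have z2: "deriv (deriv \<phi>) x = 0" if "x \<notin> S" for x by (rule deriv_zero_outside[OF S(3) z1 that])
  have d: "(g has_real_derivative deriv g x) (at x)" if "g differentiable_on UNIV" for g :: "real \<Rightarrow> real" and x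
    using that by (simp add: differentiable_on_def DERIV_deriv_iff_real_differentiable)
  have d0: "(\<phi> has_real_derivative deriv \<phi> x) (at x)" for x using d[OF sm[of 0]] by simp
  have d1: "(deriv \<phi> has_real_derivative deriv (deriv \<phi>) x) (at x)" for x using d[OF sm[of 1]] by simp
  have c2: "continuous_on UNIV (deriv (deriv \<phi>))"
    using differentiable_imp_continuous_on[OF sm[of 2]] by (simp add: numeral_2_eq_2)
  have c1: "continuous_on UNIV (deriv \<phi>)" using differentiable_imp_continuous_on[OF sm[of 1]] by simp
  have c0: "continuous_on UNIV \<phi>" using differentiable_imp_continuous_on[OF sm[of 0]] by simp
  obtain a b where ab: "a \<le> b" "\<And>y. y \<notin> {a<..<b} \<Longrightarrow> exp y \<notin> S"
  proof -
    have "compact (ln ` S)" using S by (intro compact_continuous_image continuous_intros) auto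
    from compact_imp_bounded[OF this] obtain R where R: "\<And>x. x \<in> S \<Longrightarrow> \<bar>ln x\<bar> \<le> R" unfolding bounded_iff by auto
    show thesis
    proof (rule that[of "- (\<bar>R\<bar> + 1)" "\<bar>R\<bar> + 1"])
      fix y assume "y \<notin> {- (\<bar>R\<bar> + 1)<..<\<bar>R\<bar> + 1}"
      then show "exp y \<notin> S" using R[of "exp y"] by auto
    qed simp
  qed
  define u1 where "u1 = (\<lambda>y. deriv \<phi> (exp y) * exp y * exp y + \<phi> (exp y) * exp y)"
  define u2 where "u2 = (\<lambda>y. deriv (deriv \<phi>) (exp y) * exp y * exp y * exp y + 3 * (deriv \<phi> (exp y) * exp y * exp y) + \<phi> (exp y) * exp y)"
  have du: "(u has_real_derivative u1 y) (at y)" for y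
    unfolding u_def u1_def by (rule derivative_eq_intros DERIV_chain2[OF d0] refl | simp add: algebra_simps)+
  have du1: "(u1 has_real_derivative u2 y) (at y)" for y
    unfolding u1_def u2_def by (rule derivative_eq_intros DERIV_chain2[OF d0] DERIV_chain2[OF d1] refl | simp add: algebra_simps)+
  have cu: "continuous_on UNIV u" "continuous_on UNIV u1" "continuous_on UNIV u2"
    unfolding u_def u1_def u2_def
    by (intro continuous_intros continuous_on_compose2[OF c0] continuous_on_compose2[OF c1] continuous_on_compose2[OF c2]; auto)+
  have zu: "u y = 0" "u1 y = 0" "u2 y = 0" if "y \<notin> {a<..<b}" for y
    using z0 z1 z2 ab(2)[OF that] by (simp_all add: u_def u1_def u2_def)
  have int: "integrable lborel (\<lambda>y. complex_of_real (w y))"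
    if "continuous_on UNIV w" "\<And>y. y \<notin> {a<..<b} \<Longrightarrow> w y = 0" for w :: "real \<Rightarrow> real"
  proof -
    have "integrable lborel (\<lambda>y. indicator {a..b} y *\<^sub>R complex_of_real (w y))"
      by (intro borel_integrable_compact continuous_intros continuous_on_subset[OF that(1)]) auto
    moreover have "indicator {a..b} y *\<^sub>R complex_of_real (w y) = complex_of_real (w y)" for y
      using that(2)[of y] by (auto simp: indicator_def)
    ultimately show ?thesis by simp
  qed
  show iu: "integrable lborel (\<lambda>y. complex_of_real (u y))" by (rule int[OF cu(1) zu(1)])
  show "continuous_on UNIV u" by (rule cu(1))
  show "\<exists>B. \<forall>y. cmod (of_real (u y)) \<le> B"
  proof -
    have "compact (u ` {a..b})" by (intro compact_continuous_image continuous_on_subset[OF cu(1)]) auto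
    from compact_imp_bounded[OF this] obtain B where "\<forall>z\<in>u ` {a..b}. norm z \<le> B" unfolding bounded_iff by blast
    then have B: "\<bar>u y\<bar> \<le> B" if "y \<in> {a..b}" for y using that by auto
    have "\<bar>u y\<bar> \<le> max B 0" for y
      using B[of y] zu(1)[of y] by (cases "y \<in> {a<..<b}") auto
    then show ?thesis by auto
  qed
  show "integrable lborel (fourier (\<lambda>y. of_real (u y)))"
  proof (rule continuous_tail_integrable(1)[of _ 2 "LINT y|lborel. cmod (of_real (u2 y))"])
    show "continuous_on UNIV (fourier (\<lambda>y. of_real (u y)))"
      using fourier_isCont[OF iu] by (simp add: continuous_at_imp_continuous_on)
    fix t :: real assume t: "1 \<le> \<bar>t\<bar>"
    have "fourier (\<lambda>y. of_real (u2 y)) t = (\<i> * of_real t) * ((\<i> * of_real t) * fourier (\<lambda>y. of_real (u y)) t)"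
      using fourier_derivative[OF ab(1) du1 cu(3) zu(2,3)] fourier_derivative[OF ab(1) du cu(2) zu(1,2)] by simp
    then have "cmod (fourier (\<lambda>y. of_real (u2 y)) t) = t\<^sup>2 * cmod (fourier (\<lambda>y. of_real (u y)) t)"
      by (simp add: norm_mult power2_eq_square)
    then have "t\<^sup>2 * cmod (fourier (\<lambda>y. of_real (u y)) t) \<le> (LINT y|lborel. cmod (of_real (u2 y)))"
      using norm_fourier_le by metis
    moreover have "t\<^sup>2 > 0" using t by auto
    ultimately have "cmod (fourier (\<lambda>y. of_real (u y)) t) \<le> (LINT y|lborel. cmod (of_real (u2 y))) / t\<^sup>2"
      by (subst pos_le_divide_eq) (auto simp only: mult.commute)
    moreover have "\<bar>t\<bar> powr (- 2) = 1 / t\<^sup>2" using t by (simp add: powr_minus divide_inverse)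
    ultimately show "cmod (fourier (\<lambda>y. of_real (u y)) t) \<le> (LINT y|lborel. cmod (of_real (u2 y))) * \<bar>t\<bar> powr (- 2)"
      by simp
  qed simp
  show "mellin_pairing \<phi> t = fourier (\<lambda>y. of_real (u y)) t"
  proof -
    define g where "g = (\<lambda>x. of_real (\<phi> x) * of_real x powr (- (\<i> * of_real t)))"
    have nz: "complex_of_real x \<notin> \<real>\<^sub>\<le>\<^sub>0" if "x \<in> {exp a..exp b}" for x
      using that less_le_trans[OF exp_gt_zero, of a x] by auto
    have gcont: "continuous_on {exp a..exp b} g"
      unfolding g_def using nz by (intro continuous_intros continuous_on_subset[OF c0]) (auto intro: order.trans[OF exp_ge_zero[of a]])
    have gz: "indicator {0<..} x *\<^sub>R g x = indicator {exp a..exp b} x *\<^sub>R g x" for x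
    proof (cases "x \<in> {exp a..exp b}")
      case True
      then show ?thesis using less_le_trans[OF exp_gt_zero, of a x] by simp
    next
      case False
      have "g x = 0" if "x > 0"
      proof -
        have "ln x \<notin> {a<..<b}"
        proof
          assume "ln x \<in> {a<..<b}"
          then have "exp a < exp (ln x)" "exp (ln x) < exp b"
            by (simp_all only: exp_less_cancel_iff greaterThanLessThan_iff)
          then show False using False that by simp
        qed
        from ab(2)[OF this] show ?thesis using that z0 by (simp add: g_def)
      qed
      then show ?thesis using False by (auto simp: indicator_def)
    qed
    have "mellin_pairing \<phi> t = (LINT x|lborel. indicator {exp a..exp b} x *\<^sub>R g x)"
      unfolding mellin_pairing_def set_lebesgue_integral_def gz[symmetric] by (simp add: g_def)
    also have "\<dots> = integral {exp a..exp b} g"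
      using set_borel_integral_eq_integral(2)[OF borel_integrable_atLeastAtMost'[OF gcont]] by (simp add: set_lebesgue_integral_def)
    also have "\<dots> = integral {a..b} (\<lambda>y. exp y *\<^sub>R g (exp y))"
    proof (rule integral_unique[symmetric], rule has_integral_substitution[OF ab(1) _ _ gcont])
      show "exp a \<le> exp b" "exp ` {a..b} \<subseteq> {exp a..exp b}" using ab(1) by auto
      show "(exp has_field_derivative exp y) (at y within {a..b})" for y by (auto intro!: derivative_eq_intros)
    qed
    also have "\<dots> = integral {a..b} (\<lambda>y. of_real (u y) * cis (- (y * t)))"
      by (intro integral_cong) (simp add: g_def u_def powr_def cis_conv_exp scaleR_conv_of_real Ln_of_real mult_ac)
    also have "\<dots> = (LINT y|lborel. indicator {a..b} y *\<^sub>R (of_real (u y) * cis (- (y * t))))"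
    proof -
      have C: "continuous_on {a..b} (\<lambda>y. of_real (u y) * cis (- (y * t)))"
        unfolding cis_conv_exp by (intro continuous_intros continuous_on_subset[OF cu(1)]) auto
      show ?thesis
        using set_borel_integral_eq_integral(2)[OF borel_integrable_atLeastAtMost'[OF C], unfolded set_lebesgue_integral_def] by (rule sym)
    qed
    also have "\<dots> = fourier (\<lambda>y. of_real (u y)) t"
      unfolding fourier_def by (intro Bochner_Integration.integral_cong refl) (use zu(1) in \<open>auto simp: indicator_def\<close>)
    finally show ?thesis .
  qed
qed

text \<open>
  Fourier inversion at \<open>y = 0\<close>, that is at \<open>x = 1\<close>, where \<open>u(0) = \<phi>(1)\<close>.
\<close>

lemma point_mass_is_fox_H00: "is_scaled_fox_H00 1 (return borel 1)"
  unfolding is_scaled_fox_H00_def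
proof (intro allI impI)
  fix \<phi> assume \<phi>: "test_function \<phi>"
  let ?u = "\<lambda>y. \<phi> (exp y) * exp y"
  note T = test_function_transform[OF \<phi>]
  obtain B where B: "\<And>y. cmod (of_real (?u y)) \<le> B" using T(3) by blast
  have mp: "mellin_pairing \<phi> = fourier (\<lambda>y. of_real (?u y))" by (rule ext) (rule T(4))
  have cont: "isCont (\<lambda>y. complex_of_real (?u y)) 0"
    by (rule continuous_of_real) (use T(2) in \<open>simp only: continuous_on_eq_continuous_at open_UNIV UNIV_I ball_simps\<close>)
  have inv: "(LINT t|lborel. mellin_pairing \<phi> t) = of_real (2 * pi) * of_real (\<phi> 1)"
    unfolding mp using fourier_inversion_at_0[OF T(1) cont B T(5)] by simp
  have "continuous_on UNIV \<phi>"
    using \<phi> differentiable_imp_continuous_on[of "(deriv ^^ 0) \<phi>" UNIV] unfolding test_function_def by (metis funpow_0)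
  then have "(LINT x|return borel 1. \<phi> x) = \<phi> 1"
    by (intro integral_return) (auto intro: borel_measurable_continuous_onI)
  then show "integrable lborel (mellin_pairing \<phi>) \<and> of_real (LINT x|return borel 1. \<phi> x) = fox_H00 \<phi> / of_real 1"
    using T(5) inv by (simp add: mp fox_H00_def)
qed

lemma point_mass_moments: "law_with_all_moments (return borel (1::real))"
  unfolding law_with_all_moments_def
proof (intro conjI allI)
  interpret prob_space "return borel (1::real)" by (rule prob_space_return) simp
  show "prob_space (return borel (1::real))" by unfold_locales
  show "AE x in return borel (1::real). 0 < x" by (subst AE_return) auto
  show "integrable (return borel (1::real)) (\<lambda>x. x ^ n)" for n :: nat
    by (rule integrable_const_bound[of _ 1]) (auto simp: AE_return)
qed simp

section \<open>Parameter lists and the eight cases\<close>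

lemma fox_kernel_Nil: "fox_kernel [] [] = (\<lambda>_. 1)"
  by (simp add: fox_kernel_def fun_eq_iff)

lemma density_kernel_append:
  assumes "density_kernel (fox_kernel As Bs) K \<mu> \<kappa> \<nu>" "density_kernel (fox_kernel As' Bs') K' \<mu>' \<kappa>' \<nu>'"
  shows "density_kernel (fox_kernel (As @ As') (Bs @ Bs')) (K * K') (\<mu> + \<mu>') (\<kappa> + \<kappa>') (\<nu> + \<nu>')"
  using density_kernel_mult[OF assms] by (simp add: fox_kernel_append[abs_def] fox_kernel_append)

text \<open>
  A parameter list lists its factors, so a kernel that is assembled from lists is the product of the
  kernels of the single factors.
\<close>

lemma density_kernel_concat:
  assumes "\<And>i. i \<in> set is \<Longrightarrow> density_kernel (fox_kernel (f i) (g i)) (K i) (\<mu> i) (\<kappa> i) (\<nu> i)"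
  shows "density_kernel (fox_kernel (concat (map f is)) (concat (map g is)))
     (prod_list (map K is)) (sum_list (map \<mu> is)) (sum_list (map \<kappa> is)) (sum_list (map \<nu> is))"
  using assms
proof (induction "is")
  case Nil
  then show ?case using density_kernel_1 by (simp add: fox_kernel_Nil)
next
  case (Cons i "is")
  then show ?case using density_kernel_append[of "f i" "g i"] by simp
qed

lemma fox_params_concat: "fox_params A a k n = concat (map (\<lambda>i. [(A i, a i)]) [k..<Suc n])"
  by (simp add: fox_params_def)

lemma fox_params_split:
  "fox_params A a 1 (p + m) = fox_params A a 1 p @ fox_params A a (p + 1) (p + m)"
proof -
  have "[1..<Suc (p + m)] = [1..<Suc p] @ [Suc p..<Suc (p + m)]"
    using upt_add_eq_append[of 1 "Suc p" m] by simp
  then show ?thesis by (simp add: fox_params_def)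
qed

lemma set_fox_params: "set (fox_params A a k n) = (\<lambda>i. (A i, a i)) ` {k..n}"
  by (simp add: fox_params_def atLeastLessThanSuc_atLeastAtMost del: upt_Suc)

lemma list_interval_sums:
  fixes F :: "nat \<Rightarrow> real"
  shows "sum_list (map F [k..<Suc n]) = (\<Sum>i=k..n. F i)" "prod_list (map F [k..<Suc n]) = (\<Prod>i=k..n. F i)"
  by (simp_all only: sum_list_distinct_conv_sum_set prod.distinct_set_conv_list[symmetric] distinct_upt set_upt
      atLeastLessThanSuc_atLeastAtMost)

lemma density_kernel_Gamma:
  assumes b: "b > 0" "B + b > 0"
  shows "density_kernel (fox_kernel [] [(B, b)]) (Gamma (B + b)) b (b * ln b - b) (B - 1/2)"
proof -
  have k: "fox_kernel [] [(B, b)] = (\<lambda>s. Gamma (of_real B + s * of_real b))" by (simp add: fox_kernel_def fun_eq_iff)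
  have arg: "of_real B + Complex 1 t * of_real b = of_real (B + b) + \<i> * of_real (b * t)" for t
    by (simp add: complex_eq_iff)
  have pd: "posdef M (\<lambda>t. \<phi> t * (Gamma (of_real B + Complex 1 t * of_real b) / of_real (Gamma (B + b))))" if "posdef M \<phi>" for M \<phi>
  proof -
    have "Gamma 1 / Gamma (of_real 1 + \<i> * of_real (0 * t)) = (1 :: complex)" for t :: real by simp
    \<comment> \<open>With \<open>\<zeta> = 0\<close> the second quotient is \<open>1\<close> for every \<open>w\<close>.\<close>
    with posdef_Gamma_ratio[OF that b(2) zero_less_one b(1), of 0] b show ?thesis
      by (simp add: arg Gamma_complex_of_real del: of_real_add of_real_mult)
  qed
  show ?thesis unfolding density_kernel_def k
    using has_growth_Gamma(1)[OF b] b pd by (auto simp: Gamma_real_pos Gamma_complex_of_real simp flip: of_real_add)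
qed

text \<open>
  Both conditions that relate \<open>(A, a)\<close> to \<open>(B, b)\<close> come from positivity. If \<open>a = b\<close>, the growth is
  balanced and \<open>\<nu> = B - A\<close> is the power with which the quotient decays.
\<close>

lemma density_kernel_Gamma_quotient:
  assumes b: "b > 0" "B + b > 0" and a: "a > 0" "A + a > 0" and ab: "a \<le> b" "a * (B + b) \<le> b * (A + a)"
  shows "density_kernel (fox_kernel [(A, a)] [(B, b)]) (Gamma (B + b) / Gamma (A + a))
    (b - a) ((b * ln b - b) - (a * ln a - a)) (B - A)"
proof -
  have k: "fox_kernel [(A, a)] [(B, b)] = (\<lambda>s. Gamma (of_real B + s * of_real b) * inverse (Gamma (of_real A + s * of_real a)))"
    by (simp add: fox_kernel_def fun_eq_iff divide_inverse)
  have arg: "of_real B + Complex 1 t * of_real b = of_real (B + b) + \<i> * of_real (b * t)" for t B b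
    by (simp add: complex_eq_iff)
  have pos: "Gamma (B + b) > 0" "Gamma (A + a) > 0" using a b by (simp_all add: Gamma_real_pos)
  have pd: "posdef M (\<lambda>t. \<phi> t * (Gamma (of_real B + Complex 1 t * of_real b) * inverse (Gamma (of_real A + Complex 1 t * of_real a)) /
      of_real (Gamma (B + b) / Gamma (A + a))))" if "posdef M \<phi>" for M \<phi>
  proof -
    have eq: "\<phi> t * (Gamma (of_real (B + b) + \<i> * of_real (b * t)) / Gamma (of_real (B + b)) *
            (Gamma (of_real (A + a)) / Gamma (of_real (A + a) + \<i> * of_real (a * t)))) =
       \<phi> t * (Gamma (of_real (B + b) + \<i> * of_real (b * t)) * inverse (Gamma (of_real (A + a) + \<i> * of_real (a * t))) / 
         of_real (Gamma (B + b) / Gamma (A + a)))" for t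
      unfolding Gamma_complex_of_real divide_inverse of_real_mult of_real_inverse inverse_mult_distrib inverse_inverse_eq
      by (simp only: mult_ac)
    show ?thesis
      unfolding arg using posdef_Gamma_ratio[OF that b(2) a(2) b(1) less_imp_le[OF a(1)] ab] unfolding eq .
  qed
  have "has_growth (\<lambda>s. Gamma (of_real B + s * of_real b) * inverse (Gamma (of_real A + s * of_real a)))
     (b - a) ((b * ln b - b) - (a * ln a - a)) (B - A)"
  proof -
    have "b + - a = b - a" "(b * ln b - b) + - (a * ln a - a) = (b * ln b - b) - (a * ln a - a)"
      "(B - 1/2) + - (A - 1/2) = B - A" by simp_all
    with has_growth_mult[OF has_growth_Gamma(1)[OF b] has_growth_Gamma(2)[OF a]] show ?thesis by (simp only:)
  qed
  then show ?thesis unfolding density_kernel_def k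
    using pos pd by (auto simp: Gamma_complex_of_real divide_inverse simp flip: of_real_add)
qed

lemma density_kernel_fox_params_Gamma:
  assumes "\<And>i. i \<in> {k..n} \<Longrightarrow> 0 < \<eta> i \<and> 0 < e i + \<eta> i"
  obtains \<kappa> \<nu> where "density_kernel (fox_kernel [] (fox_params e \<eta> k n)) (\<Prod>i=k..n. Gamma (e i + \<eta> i)) (\<Sum>i=k..n. \<eta> i) \<kappa> \<nu>"
proof -
  let ?is = "[k..<Suc n]"
  have "density_kernel (fox_kernel (concat (map (\<lambda>i. []) ?is)) (concat (map (\<lambda>i. [(e i, \<eta> i)]) ?is)))
     (prod_list (map (\<lambda>i. Gamma (e i + \<eta> i)) ?is)) (sum_list (map \<eta> ?is))
     (sum_list (map (\<lambda>i. \<eta> i * ln (\<eta> i) - \<eta> i) ?is)) (sum_list (map (\<lambda>i. e i - 1/2) ?is))"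
    using assms by (intro density_kernel_concat density_kernel_Gamma) auto
  moreover have "concat (map (\<lambda>i. []) ?is) = ([] :: (real \<times> real) list)" by simp
  ultimately have "density_kernel (fox_kernel [] (fox_params e \<eta> k n)) (\<Prod>i=k..n. Gamma (e i + \<eta> i)) (\<Sum>i=k..n. \<eta> i)
     (\<Sum>i=k..n. \<eta> i * ln (\<eta> i) - \<eta> i) (\<Sum>i=k..n. e i - 1/2)"
    by (simp only: fox_params_concat list_interval_sums)
  then show thesis by (rule that)
qed

lemma density_kernel_fox_params_quotient:
  assumes "\<And>i. i \<in> {k..n} \<Longrightarrow> 0 < b i \<and> 0 < B i + b i \<and> 0 < a i \<and> 0 < A i + a i \<and> a i \<le> b i \<and> a i * (B i + b i) \<le> b i * (A i + a i)"
  shows "density_kernel (fox_kernel (fox_params A a k n) (fox_params B b k n)) (\<Prod>i=k..n. Gamma (B i + b i) / Gamma (A i + a i))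
    (\<Sum>i=k..n. b i - a i) (\<Sum>i=k..n. (b i * ln (b i) - b i) - (a i * ln (a i) - a i)) (\<Sum>i=k..n. B i - A i)"
  unfolding fox_params_concat list_interval_sums[symmetric]
  using assms by (intro density_kernel_concat density_kernel_Gamma_quotient) auto

theorem theorem8:
  fixes m p l :: nat
    and e \<eta> b a \<alpha> \<gamma> \<beta> c :: "nat \<Rightarrow> real"
    and K0 K1 K2 K3 K4 K5 K6 K7 :: real
    and \<rho>0 :: "real measure"
    and \<rho>1 \<rho>2 \<rho>3 \<rho>4 \<rho>5 \<rho>6 \<rho>7 :: "real \<Rightarrow> real"
    and Em Ep Epm EBp C CB :: "(real \<times> real) list"
  assumes b: "\<forall>i\<in>{1..p}. 0 < b i"
    and e: "\<forall>j\<in>{1..p+m}. 0 < \<eta> j \<and> 0 < e j + \<eta> j"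
    and a: "\<forall>k\<in>{1..l}. 0 < \<alpha> k \<and> 0 < \<gamma> k \<and> 0 < a k + \<alpha> k"
    and \<beta>: "\<forall>k\<in>{1..l}. 0 < \<beta> k \<and> \<beta> k < 1"
    and c: "\<forall>k\<in>{1..l}. c k = a k - \<alpha> k * \<gamma> k + \<alpha> k"
    and Em: "Em = fox_params e \<eta> 1 m"
    and Ep: "Ep = fox_params e \<eta> 1 p"
    and Epm: "Epm = fox_params e \<eta> 1 (p + m)"
    and EBp: "EBp = fox_params (\<lambda>i. e i + b i) \<eta> 1 p"
    and C: "C = fox_params c (\<lambda>k. \<alpha> k * \<gamma> k) 1 l"
    and CB: "CB = fox_params (\<lambda>k. 1 - \<beta> k + \<beta> k * c k) (\<lambda>k. \<alpha> k * \<beta> k * \<gamma> k) 1 l"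
    and K0: "K0 = 1"
    and K1: "K1 = (\<Prod>i=1..m. Gamma (e i + \<eta> i))"
    and K2: "K2 = (\<Prod>i=1..p. Gamma (e i + \<eta> i) / Gamma (e i + b i + \<eta> i))"
    and K3: "K3 = (\<Prod>i=1..p. Gamma (e i + \<eta> i) / Gamma (e i + b i + \<eta> i)) *
                  (\<Prod>i=p+1..p+m. Gamma (e i + \<eta> i))"
    and K4: "K4 = (\<Prod>k=1..l. Gamma (a k + \<alpha> k) / Gamma (1 - \<beta> k + \<beta> k * a k + \<beta> k * \<alpha> k))"
    and K5: "K5 = K1 * K4"
    and K6: "K6 = K2 * K4"
    and K7: "K7 = K3 * K4"
    and \<rho>0: "\<rho>0 = return borel 1"
    and \<rho>1: "\<rho>1 = scaled_fox_H K1 {0<..} [] Em"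
    and \<rho>2: "\<rho>2 = scaled_fox_H K2 {0<..<1} EBp Ep"
    and \<rho>3: "\<rho>3 = scaled_fox_H K3 {0<..} EBp Epm"
    and \<rho>4: "\<rho>4 = scaled_fox_H K4 {0<..} CB C"
    and \<rho>5: "\<rho>5 = scaled_fox_H K5 {0<..} CB (Em @ C)"
    and \<rho>6: "\<rho>6 = scaled_fox_H K6 {0<..} (EBp @ CB) (Ep @ C)"
    and \<rho>7: "\<rho>7 = scaled_fox_H K7 {0<..} (EBp @ CB) (Epm @ C)"
  shows "(m = 0 \<and> p = 0 \<longrightarrow>
            is_scaled_fox_H00 K0 \<rho>0 \<and> Degenerate \<rho>0 \<in> FHdam) \<and>
         (m > 0 \<longrightarrow>
            is_scaled_fox_H K1 {0<..} [] Em \<rho>1 \<and> Density_fun \<rho>1 \<in> FHdam) \<and>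
         (p > 0 \<longrightarrow>
            is_scaled_fox_H K2 {0<..<1} EBp Ep \<rho>2 \<and> Density_fun \<rho>2 \<in> FHdam) \<and>
         (m > 0 \<and> p > 0 \<longrightarrow>
            is_scaled_fox_H K3 {0<..} EBp Epm \<rho>3 \<and> Density_fun \<rho>3 \<in> FHdam) \<and>
         (l > 0 \<longrightarrow>
            is_scaled_fox_H K4 {0<..} CB C \<rho>4 \<and> Density_fun \<rho>4 \<in> FHdam) \<and>
         (m > 0 \<and> l > 0 \<longrightarrow>
            is_scaled_fox_H K5 {0<..} CB (Em @ C) \<rho>5 \<and> Density_fun \<rho>5 \<in> FHdam) \<and>
         (p > 0 \<and> l > 0 \<longrightarrow>
            is_scaled_fox_H K6 {0<..} (EBp @ CB) (Ep @ C) \<rho>6 \<and> Density_fun \<rho>6 \<in> FHdam) \<and>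
         (m > 0 \<and> p > 0 \<and> l > 0 \<longrightarrow>
            is_scaled_fox_H K7 {0<..} (EBp @ CB) (Epm @ C) \<rho>7 \<and> Density_fun \<rho>7 \<in> FHdam)"
proof -
  have gam: "0 < \<eta> i \<and> 0 < e i + \<eta> i" if "i \<in> {1..p + m}" for i using e that by blast
  obtain \<kappa>1 \<nu>1 where k1: "density_kernel (fox_kernel [] Em) K1 (\<Sum>i=1..m. \<eta> i) \<kappa>1 \<nu>1"
    unfolding Em K1 by (rule density_kernel_fox_params_Gamma[of 1 m \<eta> e]) (use gam in auto)
  define L where "L = (\<Prod>i=p+1..p+m. Gamma (e i + \<eta> i))"
  define Em' where "Em' = fox_params e \<eta> (p + 1) (p + m)"
  obtain \<kappa>1' \<nu>1' where k1': "density_kernel (fox_kernel [] Em') L (\<Sum>i=p+1..p+m. \<eta> i) \<kappa>1' \<nu>1'"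
    unfolding Em'_def L_def by (rule density_kernel_fox_params_Gamma[of "p + 1" "p + m" \<eta> e]) (use gam in auto)
  \<comment> \<open>The beta factors: equal slopes, \<open>b i > 0\<close>.\<close>
  have beta: "0 < \<eta> i \<and> 0 < e i + \<eta> i \<and> 0 < \<eta> i \<and> 0 < (e i + b i) + \<eta> i \<and> \<eta> i \<le> \<eta> i \<and> \<eta> i * (e i + \<eta> i) \<le> \<eta> i * ((e i + b i) + \<eta> i)"
    if "i \<in> {1..p}" for i
  proof -
    have "0 < b i" "0 < \<eta> i" "0 < e i + \<eta> i" using gam[of i] b that by auto
    then show ?thesis by (auto intro!: mult_left_mono)
  qed
  have k2: "density_kernel (fox_kernel EBp Ep) K2 0 0 (\<Sum>i=1..p. - b i)"
    using density_kernel_fox_params_quotient[of 1 p \<eta> e \<eta> "\<lambda>i. e i + b i"] beta unfolding EBp Ep K2 by simp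
  \<comment> \<open>The factors of the list \<open>C\<close>: slopes in the ratio \<open>\<beta> k < 1\<close>.\<close>
  have wright: "0 < \<alpha> k * \<gamma> k \<and> 0 < c k + \<alpha> k * \<gamma> k \<and> 0 < \<alpha> k * \<beta> k * \<gamma> k \<and> 0 < (1 - \<beta> k + \<beta> k * c k) + \<alpha> k * \<beta> k * \<gamma> k \<and>
      \<alpha> k * \<beta> k * \<gamma> k \<le> \<alpha> k * \<gamma> k \<and> \<alpha> k * \<beta> k * \<gamma> k * (c k + \<alpha> k * \<gamma> k) \<le> \<alpha> k * \<gamma> k * ((1 - \<beta> k + \<beta> k * c k) + \<alpha> k * \<beta> k * \<gamma> k)"
    and wright_args: "c k + \<alpha> k * \<gamma> k = a k + \<alpha> k" "(1 - \<beta> k + \<beta> k * c k) + \<alpha> k * \<beta> k * \<gamma> k = 1 - \<beta> k + \<beta> k * a k + \<beta> k * \<alpha> k"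
    and wright_pos: "0 < \<alpha> k * \<gamma> k - \<alpha> k * \<beta> k * \<gamma> k"
    if k: "k \<in> {1..l}" for k
  proof -
    have pos: "0 < \<alpha> k" "0 < \<gamma> k" "0 < a k + \<alpha> k" "0 < \<beta> k" "\<beta> k < 1" using a \<beta> k by auto
    define z where "z = a k + \<alpha> k"
    define d where "d = \<alpha> k * \<gamma> k"
    have zd: "z > 0" "d > 0" using pos by (simp_all add: z_def d_def)
    show arg1: "c k + \<alpha> k * \<gamma> k = a k + \<alpha> k" using c k by simp
    then have ck: "c k = z - d" by (simp add: z_def d_def)
    show "(1 - \<beta> k + \<beta> k * c k) + \<alpha> k * \<beta> k * \<gamma> k = 1 - \<beta> k + \<beta> k * a k + \<beta> k * \<alpha> k"
      unfolding ck z_def d_def by (simp add: algebra_simps)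
    have arg2: "(1 - \<beta> k + \<beta> k * c k) + \<alpha> k * \<beta> k * \<gamma> k = 1 - \<beta> k + \<beta> k * z"
      unfolding ck d_def by (simp add: algebra_simps)
    have d': "\<alpha> k * \<beta> k * \<gamma> k = \<beta> k * d" by (simp add: d_def)
    have lt: "\<beta> k * d < 1 * d" using pos zd by (intro mult_strict_right_mono) auto
    then show "0 < \<alpha> k * \<gamma> k - \<alpha> k * \<beta> k * \<gamma> k" unfolding d' d_def[symmetric] by simp
    \<comment> \<open>The condition \<open>\<zeta>z \<le> \<eta>w\<close> for \<open>\<zeta> = \<beta>\<eta>\<close>, \<open>w = 1 - \<beta> + \<beta>z\<close> reduces to \<open>\<beta> \<le> 1\<close>.\<close>
    have "\<beta> k * d * z \<le> d * (1 - \<beta> k + \<beta> k * z)"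
      using mult_nonneg_nonneg[of d "1 - \<beta> k"] zd pos by (simp add: algebra_simps)
    then show "0 < \<alpha> k * \<gamma> k \<and> 0 < c k + \<alpha> k * \<gamma> k \<and> 0 < \<alpha> k * \<beta> k * \<gamma> k \<and> 0 < (1 - \<beta> k + \<beta> k * c k) + \<alpha> k * \<beta> k * \<gamma> k \<and>
      \<alpha> k * \<beta> k * \<gamma> k \<le> \<alpha> k * \<gamma> k \<and> \<alpha> k * \<beta> k * \<gamma> k * (c k + \<alpha> k * \<gamma> k) \<le> \<alpha> k * \<gamma> k * ((1 - \<beta> k + \<beta> k * c k) + \<alpha> k * \<beta> k * \<gamma> k)"
      unfolding arg2 unfolding arg1 d' using lt pos zd unfolding d_def[symmetric] z_def[symmetric] by (auto intro: add_pos_pos)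
  qed
  define \<mu>4 where "\<mu>4 = (\<Sum>k=1..l. \<alpha> k * \<gamma> k - \<alpha> k * \<beta> k * \<gamma> k)"
  obtain \<kappa>4 \<nu>4 where k4: "density_kernel (fox_kernel CB C) K4 \<mu>4 \<kappa>4 \<nu>4"
  proof -
    have K4': "K4 = (\<Prod>k=1..l. Gamma (c k + \<alpha> k * \<gamma> k) / Gamma ((1 - \<beta> k + \<beta> k * c k) + \<alpha> k * \<beta> k * \<gamma> k))"
      unfolding K4 by (intro prod.cong refl) (simp only: wright_args)
    show thesis
      by (rule that, unfold CB C K4' \<mu>4_def, rule density_kernel_fox_params_quotient, rule wright)
  qed
  have Epm': "Epm = Ep @ Em'" unfolding Epm Ep Em'_def by (rule fox_params_split)
  have K3': "K3 = K2 * L" unfolding K3 K2 L_def ..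
  have \<mu>1: "0 < (\<Sum>i=1..m. \<eta> i)" "0 < (\<Sum>i=p+1..p+m. \<eta> i)" if "m > 0"
    using that gam by (auto intro!: sum_pos)
  have \<mu>4: "0 < \<mu>4" if "l > 0" unfolding \<mu>4_def using that wright_pos by (intro sum_pos) auto
  have \<nu>2: "(\<Sum>i=1..p. - b i) < 0" if "p > 0"
    using that b sum_pos[of "{1..p}" b] by (simp add: sum_negf)
  have v: "valid_params Em" "valid_params Ep" "valid_params Em'" "valid_params C"
    unfolding valid_params_def Em Ep Em'_def C set_fox_params using gam wright by auto
  have vapp: "valid_params (xs @ ys)" if "valid_params xs" "valid_params ys" for xs ys
    using that by (auto simp: valid_params_def)
  have pos: "\<forall>(A, a)\<in>set EBp. 0 < a" "\<forall>(A, a)\<in>set CB. 0 < a"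
    unfolding EBp CB set_fox_params using beta wright by auto
  have ne: "m > 0 \<Longrightarrow> Em \<noteq> []" "p > 0 \<Longrightarrow> Ep \<noteq> []" "l > 0 \<Longrightarrow> C \<noteq> []"
    unfolding Em Ep C by (simp_all add: fox_params_def)
  have C0: "is_scaled_fox_H00 K0 \<rho>0 \<and> Degenerate \<rho>0 \<in> FHdam"
    unfolding K0 \<rho>0 FHdam_def using point_mass_is_fox_H00 point_mass_moments by (auto intro!: exI[of _ "1::real"])
  have C1: "is_scaled_fox_H K1 {0<..} [] Em \<rho>1 \<and> Density_fun \<rho>1 \<in> FHdam" if "m > 0"
    by (rule positive_growth_FHdam[OF ne(1)[OF that] v(1) _ k1 \<mu>1(1)[OF that] \<rho>1]) simp
  have C2: "is_scaled_fox_H K2 {0<..<1} EBp Ep \<rho>2 \<and> Density_fun \<rho>2 \<in> FHdam" if "p > 0"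
    by (rule balanced_growth_FHdam[OF ne(2)[OF that] v(2) pos(1) k2 \<nu>2[OF that] \<rho>2])
  have C3: "is_scaled_fox_H K3 {0<..} EBp Epm \<rho>3 \<and> Density_fun \<rho>3 \<in> FHdam" if "m > 0" "p > 0"
  proof (rule positive_growth_FHdam[OF _ _ _ _ _ \<rho>3])
    show "density_kernel (fox_kernel EBp Epm) K3 (0 + (\<Sum>i=p+1..p+m. \<eta> i)) (0 + \<kappa>1') ((\<Sum>i=1..p. - b i) + \<nu>1')"
      unfolding Epm' K3' using density_kernel_append[OF k2 k1'] by simp
  qed (use that ne v vapp pos \<mu>1 in \<open>simp_all add: Epm'\<close>)
  have C4: "is_scaled_fox_H K4 {0<..} CB C \<rho>4 \<and> Density_fun \<rho>4 \<in> FHdam" if "l > 0"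
    by (rule positive_growth_FHdam[OF ne(3)[OF that] v(4) pos(2) k4 \<mu>4[OF that] \<rho>4])
  have C5: "is_scaled_fox_H K5 {0<..} CB (Em @ C) \<rho>5 \<and> Density_fun \<rho>5 \<in> FHdam" if "m > 0" "l > 0"
  proof (rule positive_growth_FHdam[OF _ _ _ _ _ \<rho>5])
    show "density_kernel (fox_kernel CB (Em @ C)) K5 ((\<Sum>i=1..m. \<eta> i) + \<mu>4) (\<kappa>1 + \<kappa>4) (\<nu>1 + \<nu>4)"
      unfolding K5 using density_kernel_append[OF k1 k4] by simp
    show "0 < (\<Sum>i=1..m. \<eta> i) + \<mu>4" using \<mu>1(1) \<mu>4 that by (intro add_pos_pos)
  qed (use that ne v vapp pos in simp_all)
  have C6: "is_scaled_fox_H K6 {0<..} (EBp @ CB) (Ep @ C) \<rho>6 \<and> Density_fun \<rho>6 \<in> FHdam" if "p > 0" "l > 0"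
  proof (rule positive_growth_FHdam[OF _ _ _ _ _ \<rho>6])
    show "density_kernel (fox_kernel (EBp @ CB) (Ep @ C)) K6 (0 + \<mu>4) (0 + \<kappa>4) ((\<Sum>i=1..p. - b i) + \<nu>4)"
      unfolding K6 by (rule density_kernel_append[OF k2 k4])
  qed (use that ne v vapp pos \<mu>4 in auto)
  have C7: "is_scaled_fox_H K7 {0<..} (EBp @ CB) (Epm @ C) \<rho>7 \<and> Density_fun \<rho>7 \<in> FHdam" if "m > 0" "p > 0" "l > 0"
  proof (rule positive_growth_FHdam[OF _ _ _ _ _ \<rho>7])
    show "density_kernel (fox_kernel (EBp @ CB) (Epm @ C)) K7 (0 + (\<Sum>i=p+1..p+m. \<eta> i) + \<mu>4)
        (0 + \<kappa>1' + \<kappa>4) ((\<Sum>i=1..p. - b i) + \<nu>1' + \<nu>4)"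
      unfolding K7 K3' Epm' using density_kernel_append[OF density_kernel_append[OF k2 k1'] k4] by simp
    show "0 < 0 + (\<Sum>i=p+1..p+m. \<eta> i) + \<mu>4" using \<mu>1(2) \<mu>4 that by (simp add: add_pos_pos)
  qed (use that ne v vapp pos in \<open>auto simp: Epm'\<close>)
  show ?thesis using C0 C1 C2 C3 C4 C5 C6 C7 by blast
qed

end
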